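(* Let $\alpha\in(1,2)$, $T>0$, let $g\in C^1[0,T]$ with $g(0)\ne0$, and let $\Gamma$ be a nonempty open subset of $\partial\Omega$. Then there exists a constant $C>0$ such that the following holds. For $j=1,2$, let $f_j\in H_0^1(\Omega)$ and let $u_j\in H_\alpha(0,T;L^2(\Omega))\cap L^2(0,T;H_0^1(\Omega)\cap H^2(\Omega))$ be the solution of $$\begin{cases}\partial_t^\alpha u_j+A(x)u_j=f_j(x)g(t)&\text{in }\Omega\times(0,T),\\ u_j(x,0)=0,\quad \partial_tu_j(x,0)=0&\text{in }\Omega,\\ u_j=0&\text{on }\partial\Omega\times(0,T).\end{cases}$$ Then $$\|f_1-f_2\|_{\mathcal B}\le C\,\|\partial_{\nu_A}u_1-\partial_{\nu_A}u_2\|_{L^2(\Gamma\times(0,T))}.$$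
   Context: $\Omega\subset\mathbb R^d$ is a bounded domain with sufficiently smooth boundary $\partial\Omega$ and outward unit normal $\nu=(\nu_1,\dots,\nu_d)$. $A_0u=-\sum_{i,j=1}^d\partial_{x_i}(a_{ij}(x)\partial_{x_j}u)$ and $A(x)u=A_0u+B(x)\cdot\nabla u+c(x)u$, where $a_{ij}=a_{ji}\in C^1(\overline\Omega)$, there is $a_0>0$ with $\sum_{i,j}a_{ij}(x)\xi_i\xi_j\ge a_0\sum_j|\xi_j|^2$ for all $x\in\overline\Omega$, $\xi\in\mathbb R^d$, and $B,c\in W^{1,\infty}(\Omega)$. The conormal derivative is $\partial_{\nu_A}u=\sum_{i,j}a_{ij}\,\partial_{x_i}u\,\nu_j$. For $\gamma>0$, $J^\gamma g(t)=\frac1{\Gamma(\gamma)}\int_0^t(t-\tau)^{\gamma-1}g(\tau)\,d\tau$ and $J_{T-}^\gamma g(t)=\frac1{\Gamma(\gamma)}\int_t^T(\tau-t)^{\gamma-1}g(\tau)\,d\tau$. For $\gamma\in(0,1)$, $H_\gamma(0,T)=J^\gamma(L^2(0,T))$; for $\alpha\in(1,2)$, $H_\alpha(0,T)=J^\alpha(L^2(0,T))$, i.e. $g\in H^1(0,T)$ with $g(0)=0$, $g'\in H_{\alpha-1}(0,T)$; $H_\alpha(0,T;L^2(\Omega))$ is the $L^2(\Omega)$-valued analogue. The Caputo derivative is $\partial_t^\alpha g=\frac{d}{dt}J^{2-\alpha}\frac{d}{dt}g$ for $g\in H_\alpha(0,T)$, and the backward Caputo derivative is $\partial_{T-}^\alpha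 g=-\frac{d}{dt}J_{T-}^{2-\alpha}\frac{d}{dt}g$ for $g\in J_{T-}^\alpha(L^2(0,T))$ (note the minus sign). The zero initial conditions are encoded in $u_j\in H_\alpha(0,T;L^2(\Omega))$. Adjoint system: for $\varphi\in C^\infty(\partial\Omega\times(0,T))$ with compact support in $\Gamma\times(0,T)$, $v[\varphi]\in L^2(0,T;H^2(\Omega))\cap J_{T-}^\alpha(L^2(0,T;L^2(\Omega)))$ is the solution $v$ of $$\begin{cases}\partial_{T-}^\alpha v-A_0v+\nabla\cdot(B(x)v)-c(x)v=0&\text{in }\Omega\times(0,T),\\ J_{T-}^{2-\alpha}v(\cdot,T)=J_{T-}^{2-\alpha}v_t(\cdot,T)=0&\text{in }\Omega,\\ v=\varphi&\text{on }\partial\Omega\times(0,T).\end{cases}$$ The bilinear form is $\mathcal B_g(f,\varphi)=\int_0^T\langle f\,g(t),v[\varphi](\cdot,t)\rangle_{L^2(\Omega)}\,dt$, and for $f\in L^2(\Omega)$ $$\|f\|_{\mathcal B}=\sup\big\{|\mathcal B_g(f,\varphi)|:\ \varphi\in C^\infty(\partial\Omega\times(0,T)) \text{ with compact support in } \Gamma\times(0,T),\ \|\varphi\|_{L^2(\Gamma\times(0,T))}=1\big\}.$$ *)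

theory Defs
  imports "HOL-Analysis.Analysis"
begin

(* Conventions.  R^d is a type 'a :: euclidean_space with d = DIM('a); coordinates are indexed by
   the standard orthonormal basis, so a sum over i = 1..d is a sum over Basis, x_i is x \<bullet> i, and
   a_ij is the function a i j for i, j in Basis.  A function on the space-time cylinder is a function
   of the pair (t, x).  An element of L^2 is represented by a Borel function, and all statements
   about it are insensitive to changing it on a null set. *)

section \<open>Classical differentiability\<close>

definition partial :: "'a::euclidean_space \<Rightarrow> ('a \<Rightarrow> real) \<Rightarrow> 'a \<Rightarrow> real" where
  "partial i f x = frechet_derivative f (at x) i"

definition grad :: "('a::euclidean_space \<Rightarrow> real) \<Rightarrow> 'a \<Rightarrow> 'a" where
  "grad f x = (\<Sum>i\<in>Basis. partial i f x *\<^sub>R i)"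

(* C^k(S); meant for open S. *)
primrec Ck_on :: "nat \<Rightarrow> 'a::euclidean_space set \<Rightarrow> ('a \<Rightarrow> real) \<Rightarrow> bool" where
  "Ck_on 0 S f \<longleftrightarrow> continuous_on S f"
| "Ck_on (Suc k) S f \<longleftrightarrow>
     (\<forall>x\<in>S. f differentiable (at x)) \<and> (\<forall>i\<in>Basis. Ck_on k S (partial i f))"

definition smooth_on :: "'a::euclidean_space set \<Rightarrow> ('a \<Rightarrow> real) \<Rightarrow> bool" where
  "smooth_on S f \<longleftrightarrow> (\<forall>k. Ck_on k S f)"

(* C^1 of the closure of the open set S: f and its first derivatives extend continuously. *)
definition C1_closure :: "'a::euclidean_space set \<Rightarrow> ('a \<Rightarrow> real) \<Rightarrow> bool" where
  "C1_closure S f \<longleftrightarrow>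
     continuous_on (closure S) f \<and> (\<forall>x\<in>S. f differentiable (at x)) \<and>
     (\<forall>i\<in>Basis. \<exists>f'. continuous_on (closure S) f' \<and> (\<forall>x\<in>S. f' x = partial i f x))"

definition C1_interval :: "real \<Rightarrow> (real \<Rightarrow> real) \<Rightarrow> bool" where
  "C1_interval T g \<longleftrightarrow>
     (\<exists>g'. continuous_on {0..T} g' \<and>
           (\<forall>t\<in>{0..T}. (g has_real_derivative g' t) (at t within {0..T})))"

section \<open>Domains, outward normal and surface measure\<close>

(* Inside the ball around p, \<Omega> is the part of the ball lying over the graph of a C^k function h of
   the coordinates other than the one in direction b; s = 1 or s = -1 is the orientation.
   Functions on the coordinate hyperplane {y. y \<bullet> b = 0} are encoded as functions on the whole
   space which are constant along b. *)
definition graph_chart ::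
  "nat \<Rightarrow> 'a::euclidean_space set \<Rightarrow> 'a \<Rightarrow> real \<Rightarrow> 'a \<Rightarrow> real \<Rightarrow> ('a \<Rightarrow> real) \<Rightarrow> bool" where
  "graph_chart k \<Omega> p r b s h \<longleftrightarrow>
     r > 0 \<and> b \<in> Basis \<and> s \<in> {1, -1} \<and>
     Ck_on k UNIV h \<and> (\<forall>x y. h (x + y *\<^sub>R b) = h x) \<and>
     \<Omega> \<inter> ball p r = {x \<in> ball p r. h x < s * (x \<bullet> b)}"

definition Ck_boundary :: "nat \<Rightarrow> 'a::euclidean_space set \<Rightarrow> bool" where
  "Ck_boundary k \<Omega> \<longleftrightarrow> (\<forall>p\<in>frontier \<Omega>. \<exists>r b s h. graph_chart k \<Omega> p r b s h)"

definition outward_normal :: "'a::euclidean_space set \<Rightarrow> 'a \<Rightarrow> 'a" where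
  "outward_normal \<Omega> p =
     (THE n. \<exists>r b s h. graph_chart 1 \<Omega> p r b s h \<and>
        n = (1 / sqrt (1 + (norm (grad h p))\<^sup>2)) *\<^sub>R (grad h p - s *\<^sub>R b))"

(* (d-1)-dimensional Lebesgue measure on {y. y \<bullet> b = 0}; a unit point mass if d = 1. *)
definition hyperplane_measure :: "'a::euclidean_space \<Rightarrow> 'a measure" where
  "hyperplane_measure b =
     distr (\<Pi>\<^sub>M c\<in>Basis - {b}. lborel) borel (\<lambda>y. \<Sum>c\<in>Basis - {b}. y c *\<^sub>R c)"

(* In every chart the surface measure is sqrt (1 + |grad h|^2) dy.  The point of the graph over y is
   y + (s * h y) b.  These local formulas are compatible and determine the measure. *)
definition surface_measure :: "'a::euclidean_space set \<Rightarrow> 'a measure" where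
  "surface_measure \<Omega> =
     (THE \<sigma>. sets \<sigma> = sets (restrict_space borel (frontier \<Omega>)) \<and>
        (\<forall>p\<in>frontier \<Omega>. \<forall>r b s h. graph_chart 1 \<Omega> p r b s h \<longrightarrow>
          (\<forall>E\<in>sets \<sigma>. E \<subseteq> ball p r \<longrightarrow>
             emeasure \<sigma> E =
               (\<integral>\<^sup>+y. ennreal (sqrt (1 + (norm (grad h y))\<^sup>2)) *
                     indicator E (y + (s * h y) *\<^sub>R b) \<partial>hyperplane_measure b))))"

section \<open>The spaces L2 and the measures used\<close>

definition L2 :: "'b measure \<Rightarrow> ('b \<Rightarrow> real) set" where
  "L2 M = {f \<in> borel_measurable M. integrable M (\<lambda>x. (f x)\<^sup>2)}"

definition L2_norm :: "'b measure \<Rightarrow> ('b \<Rightarrow> real) \<Rightarrow> real" where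
  "L2_norm M f = sqrt (\<integral>x. (f x)\<^sup>2 \<partial>M)"

definition L2_tendsto ::
  "'b measure \<Rightarrow> ('c \<Rightarrow> 'b \<Rightarrow> real) \<Rightarrow> ('b \<Rightarrow> real) \<Rightarrow> 'c filter \<Rightarrow> bool" where
  "L2_tendsto M F f net \<longleftrightarrow>
     f \<in> L2 M \<and> (\<forall>\<^sub>F n in net. F n \<in> L2 M) \<and>
     ((\<lambda>n. L2_norm M (\<lambda>x. F n x - f x)) \<longlongrightarrow> 0) net"

abbreviation vol :: "'a::euclidean_space set \<Rightarrow> 'a measure" where
  "vol S \<equiv> restrict_space lborel S"

(* L^2(0,T;L^2(\<Omega>)) is L2 (cyl T \<Omega>). *)
definition cyl :: "real \<Rightarrow> 'a::euclidean_space set \<Rightarrow> (real \<times> 'a) measure" where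
  "cyl T \<Omega> = vol {0<..<T} \<Otimes>\<^sub>M vol \<Omega>"

definition lateral ::
  "real \<Rightarrow> 'a::euclidean_space set \<Rightarrow> 'a set \<Rightarrow> (real \<times> 'a) measure" where
  "lateral T \<Omega> \<Gamma> = vol {0<..<T} \<Otimes>\<^sub>M restrict_space (surface_measure \<Omega>) \<Gamma>"

section \<open>Sobolev spaces\<close>

definition test_functions :: "'a::euclidean_space set \<Rightarrow> ('a \<Rightarrow> real) set" where
  "test_functions \<Omega> =
     {\<psi>. smooth_on UNIV \<psi> \<and> compact (closure {x. \<psi> x \<noteq> 0}) \<and> closure {x. \<psi> x \<noteq> 0} \<subseteq> \<Omega>}"

definition locally_L1 :: "'a::euclidean_space set \<Rightarrow> ('a \<Rightarrow> real) \<Rightarrow> bool" where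
  "locally_L1 \<Omega> u \<longleftrightarrow> (\<forall>K. compact K \<and> K \<subseteq> \<Omega> \<longrightarrow> set_integrable lborel K u)"

(* w is the i-th weak partial derivative of u on the open set \<Omega>. *)
definition weak_partial ::
  "'a::euclidean_space set \<Rightarrow> 'a \<Rightarrow> ('a \<Rightarrow> real) \<Rightarrow> ('a \<Rightarrow> real) \<Rightarrow> bool" where
  "weak_partial \<Omega> i u w \<longleftrightarrow>
     locally_L1 \<Omega> u \<and> locally_L1 \<Omega> w \<and>
     (\<forall>\<psi>\<in>test_functions \<Omega>.
        (\<integral>x. u x * partial i \<psi> x \<partial>vol \<Omega>) = - (\<integral>x. w x * \<psi> x \<partial>vol \<Omega>))"

definition Linfty :: "'a::euclidean_space set \<Rightarrow> ('a \<Rightarrow> real) \<Rightarrow> bool" where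
  "Linfty \<Omega> h \<longleftrightarrow> h \<in> borel_measurable (vol \<Omega>) \<and> (\<exists>M. AE x in vol \<Omega>. \<bar>h x\<bar> \<le> M)"

definition W1infty :: "'a::euclidean_space set \<Rightarrow> ('a \<Rightarrow> real) \<Rightarrow> bool" where
  "W1infty \<Omega> h \<longleftrightarrow> Linfty \<Omega> h \<and> (\<forall>i\<in>Basis. \<exists>h'. Linfty \<Omega> h' \<and> weak_partial \<Omega> i h h')"

(* Smooth functions W n converge in H^1(\<Omega>) to w (in particular w belongs to H^1(\<Omega>)). *)
definition H1_tendsto ::
  "'a::euclidean_space set \<Rightarrow> (nat \<Rightarrow> 'a \<Rightarrow> real) \<Rightarrow> ('a \<Rightarrow> real) \<Rightarrow> bool" where
  "H1_tendsto \<Omega> W w \<longleftrightarrow>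
     L2_tendsto (vol \<Omega>) W w sequentially \<and>
     (\<forall>i\<in>Basis. \<exists>w'. weak_partial \<Omega> i w w' \<and>
        L2_tendsto (vol \<Omega>) (\<lambda>n. partial i (W n)) w' sequentially)"

definition H10 :: "'a::euclidean_space set \<Rightarrow> ('a \<Rightarrow> real) set" where
  "H10 \<Omega> = {w. \<exists>W. (\<forall>n. W n \<in> test_functions \<Omega>) \<and> H1_tendsto \<Omega> W w}"

(* b is the trace on the boundary of w in H^1(\<Omega>): the continuous extension of the restriction map
   from functions that are smooth up to the boundary. *)
definition is_trace :: "'a::euclidean_space set \<Rightarrow> ('a \<Rightarrow> real) \<Rightarrow> ('a \<Rightarrow> real) \<Rightarrow> bool" where
  "is_trace \<Omega> w b \<longleftrightarrow>
     (\<exists>W. (\<forall>n. smooth_on UNIV (W n)) \<and> H1_tendsto \<Omega> W w \<and>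
          L2_tendsto (surface_measure \<Omega>) W b sequentially)"

section \<open>Functions of time and space\<close>

(* w is the weak x_i-derivative of u, both in L^2(0,T;L^2(\<Omega>)). *)
definition space_deriv ::
  "real \<Rightarrow> 'a::euclidean_space set \<Rightarrow> 'a \<Rightarrow> (real \<times> 'a \<Rightarrow> real) \<Rightarrow> (real \<times> 'a \<Rightarrow> real) \<Rightarrow> bool" where
  "space_deriv T \<Omega> i u w \<longleftrightarrow>
     u \<in> L2 (cyl T \<Omega>) \<and> w \<in> L2 (cyl T \<Omega>) \<and>
     (AE t in vol {0<..<T}. weak_partial \<Omega> i (\<lambda>x. u (t, x)) (\<lambda>x. w (t, x)))"

(* w is the weak time derivative of u, both in L^2(0,T;L^2(\<Omega>)). *)
definition time_deriv ::
  "real \<Rightarrow> 'a::euclidean_space set \<Rightarrow> (real \<times> 'a \<Rightarrow> real) \<Rightarrow> (real \<times> 'a \<Rightarrow> real) \<Rightarrow> bool" where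
  "time_deriv T \<Omega> u w \<longleftrightarrow>
     u \<in> L2 (cyl T \<Omega>) \<and> w \<in> L2 (cyl T \<Omega>) \<and>
     (AE x in vol \<Omega>. weak_partial {0<..<T} 1 (\<lambda>t. u (t, x)) (\<lambda>t. w (t, x)))"

definition L2_H2 :: "real \<Rightarrow> 'a::euclidean_space set \<Rightarrow> (real \<times> 'a \<Rightarrow> real) set" where
  "L2_H2 T \<Omega> =
     {u. \<exists>p q. (\<forall>i\<in>Basis. space_deriv T \<Omega> i u (p i)) \<and>
               (\<forall>i\<in>Basis. \<forall>j\<in>Basis. space_deriv T \<Omega> j (p i) (q i j))}"

definition L2_H10 :: "real \<Rightarrow> 'a::euclidean_space set \<Rightarrow> (real \<times> 'a \<Rightarrow> real) set" where
  "L2_H10 T \<Omega> =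
     {u. (\<forall>i\<in>Basis. \<exists>p. space_deriv T \<Omega> i u p) \<and>
         (AE t in vol {0<..<T}. (\<lambda>x. u (t, x)) \<in> H10 \<Omega>)}"

(* b in L^2((0,T) \<times> boundary) is the lateral trace of u. *)
definition lateral_trace ::
  "real \<Rightarrow> 'a::euclidean_space set \<Rightarrow> (real \<times> 'a \<Rightarrow> real) \<Rightarrow> (real \<times> 'a \<Rightarrow> real) \<Rightarrow> bool" where
  "lateral_trace T \<Omega> u b \<longleftrightarrow>
     b \<in> L2 (lateral T \<Omega> (frontier \<Omega>)) \<and>
     (AE t in vol {0<..<T}. is_trace \<Omega> (\<lambda>x. u (t, x)) (\<lambda>x. b (t, x)))"

section \<open>Fractional calculus in time\<close>

definition frac_int :: "real \<Rightarrow> (real \<Rightarrow> real) \<Rightarrow> real \<Rightarrow> real" where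
  "frac_int \<gamma> g t =
     1 / Gamma \<gamma> * (LINT \<tau>:{0<..<t}|lborel. (t - \<tau>) powr (\<gamma> - 1) * g \<tau>)"

definition frac_int_back :: "real \<Rightarrow> real \<Rightarrow> (real \<Rightarrow> real) \<Rightarrow> real \<Rightarrow> real" where
  "frac_int_back T \<gamma> g t =
     1 / Gamma \<gamma> * (LINT \<tau>:{t<..<T}|lborel. (\<tau> - t) powr (\<gamma> - 1) * g \<tau>)"

(* The operators J^\<gamma> and J_{T-}^\<gamma> acting in t for each x. *)
definition J :: "real \<Rightarrow> (real \<times> 'a \<Rightarrow> real) \<Rightarrow> real \<times> 'a \<Rightarrow> real" where
  "J \<gamma> u = (\<lambda>(t, x). frac_int \<gamma> (\<lambda>\<tau>. u (\<tau>, x)) t)"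

definition J_back :: "real \<Rightarrow> real \<Rightarrow> (real \<times> 'a \<Rightarrow> real) \<Rightarrow> real \<times> 'a \<Rightarrow> real" where
  "J_back T \<gamma> u = (\<lambda>(t, x). frac_int_back T \<gamma> (\<lambda>\<tau>. u (\<tau>, x)) t)"

(* H_\<alpha>(0,T;L^2(\<Omega>)) and J_{T-}^\<alpha>(L^2(0,T;L^2(\<Omega>))). *)
definition H_frac ::
  "real \<Rightarrow> real \<Rightarrow> 'a::euclidean_space set \<Rightarrow> (real \<times> 'a \<Rightarrow> real) set" where
  "H_frac \<alpha> T \<Omega> =
     {u \<in> L2 (cyl T \<Omega>). \<exists>w\<in>L2 (cyl T \<Omega>). AE z in cyl T \<Omega>. u z = J \<alpha> w z}"

definition H_frac_back ::
  "real \<Rightarrow> real \<Rightarrow> 'a::euclidean_space set \<Rightarrow> (real \<times> 'a \<Rightarrow> real) set" where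
  "H_frac_back \<alpha> T \<Omega> =
     {u \<in> L2 (cyl T \<Omega>). \<exists>w\<in>L2 (cyl T \<Omega>). AE z in cyl T \<Omega>. u z = J_back T \<alpha> w z}"

(* D is d/dt J^{2-\<alpha>} d/dt u. *)
definition caputo ::
  "real \<Rightarrow> real \<Rightarrow> 'a::euclidean_space set \<Rightarrow> (real \<times> 'a \<Rightarrow> real) \<Rightarrow> (real \<times> 'a \<Rightarrow> real) \<Rightarrow> bool" where
  "caputo \<alpha> T \<Omega> u D \<longleftrightarrow>
     (\<exists>u'. time_deriv T \<Omega> u u' \<and> time_deriv T \<Omega> (J (2 - \<alpha>) u') D)"

(* D is - d/dt J_{T-}^{2-\<alpha>} d/dt v; note the sign. *)
definition caputo_back ::
  "real \<Rightarrow> real \<Rightarrow> 'a::euclidean_space set \<Rightarrow> (real \<times> 'a \<Rightarrow> real) \<Rightarrow> (real \<times> 'a \<Rightarrow> real) \<Rightarrow> bool" where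
  "caputo_back \<alpha> T \<Omega> v D \<longleftrightarrow>
     (\<exists>v'. time_deriv T \<Omega> v v' \<and> time_deriv T \<Omega> (J_back T (2 - \<alpha>) v') (\<lambda>z. - D z))"

section \<open>The elliptic operator and the two initial-boundary value problems\<close>

definition coefficients ::
  "'a::euclidean_space set \<Rightarrow> ('a \<Rightarrow> 'a \<Rightarrow> 'a \<Rightarrow> real) \<Rightarrow> ('a \<Rightarrow> 'a) \<Rightarrow> ('a \<Rightarrow> real) \<Rightarrow> bool" where
  "coefficients \<Omega> a B c \<longleftrightarrow>
     (\<forall>i\<in>Basis. \<forall>j\<in>Basis. C1_closure \<Omega> (a i j) \<and> (\<forall>x\<in>closure \<Omega>. a i j x = a j i x)) \<and>
     (\<exists>a0>0. \<forall>x\<in>closure \<Omega>. \<forall>\<xi>.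
        (\<Sum>i\<in>Basis. \<Sum>j\<in>Basis. a i j x * (\<xi> \<bullet> i) * (\<xi> \<bullet> j)) \<ge> a0 * (\<Sum>j\<in>Basis. (\<xi> \<bullet> j)\<^sup>2)) \<and>
     (\<forall>i\<in>Basis. W1infty \<Omega> (\<lambda>x. B x \<bullet> i)) \<and> W1infty \<Omega> c"

(* z is A_0 u = - sum_{i,j} d_i (a_ij d_j u). *)
definition is_A0 ::
  "real \<Rightarrow> 'a::euclidean_space set \<Rightarrow> ('a \<Rightarrow> 'a \<Rightarrow> 'a \<Rightarrow> real) \<Rightarrow>
   (real \<times> 'a \<Rightarrow> real) \<Rightarrow> (real \<times> 'a \<Rightarrow> real) \<Rightarrow> bool" where
  "is_A0 T \<Omega> a u z \<longleftrightarrow>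
     (\<exists>p q. (\<forall>j\<in>Basis. space_deriv T \<Omega> j u (p j)) \<and>
            (\<forall>i\<in>Basis. \<forall>j\<in>Basis. space_deriv T \<Omega> i (\<lambda>(t, x). a i j x * p j (t, x)) (q i j)) \<and>
            z = (\<lambda>y. - (\<Sum>i\<in>Basis. \<Sum>j\<in>Basis. q i j y)))"

(* z is the conormal derivative sum_{i,j} a_ij (d_i u) \<nu>_j on (0,T) \<times> boundary. *)
definition is_conormal ::
  "real \<Rightarrow> 'a::euclidean_space set \<Rightarrow> ('a \<Rightarrow> 'a \<Rightarrow> 'a \<Rightarrow> real) \<Rightarrow>
   (real \<times> 'a \<Rightarrow> real) \<Rightarrow> (real \<times> 'a \<Rightarrow> real) \<Rightarrow> bool" where
  "is_conormal T \<Omega> a u z \<longleftrightarrow>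
     (\<exists>p b. (\<forall>i\<in>Basis. space_deriv T \<Omega> i u (p i) \<and> lateral_trace T \<Omega> (p i) (b i)) \<and>
            z = (\<lambda>(t, x). \<Sum>i\<in>Basis. \<Sum>j\<in>Basis. a i j x * b i (t, x) * (outward_normal \<Omega> x \<bullet> j)))"

(* The homogeneous Dirichlet condition is membership in L^2(0,T;H^1_0), the homogeneous initial
   conditions are membership in H_\<alpha>(0,T;L^2(\<Omega>)). *)
definition forward_solution ::
  "'a::euclidean_space set \<Rightarrow> real \<Rightarrow> real \<Rightarrow> ('a \<Rightarrow> 'a \<Rightarrow> 'a \<Rightarrow> real) \<Rightarrow> ('a \<Rightarrow> 'a) \<Rightarrow> ('a \<Rightarrow> real) \<Rightarrow>
   (real \<Rightarrow> real) \<Rightarrow> ('a \<Rightarrow> real) \<Rightarrow> (real \<times> 'a \<Rightarrow> real) \<Rightarrow> bool" where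
  "forward_solution \<Omega> \<alpha> T a B c g f u \<longleftrightarrow>
     u \<in> H_frac \<alpha> T \<Omega> \<and> u \<in> L2_H10 T \<Omega> \<and> u \<in> L2_H2 T \<Omega> \<and>
     (\<exists>D z p. caputo \<alpha> T \<Omega> u D \<and> is_A0 T \<Omega> a u z \<and> (\<forall>i\<in>Basis. space_deriv T \<Omega> i u (p i)) \<and>
        (AE (t, x) in cyl T \<Omega>.
           D (t, x) + z (t, x) + (\<Sum>i\<in>Basis. (B x \<bullet> i) * p i (t, x)) + c x * u (t, x) = f x * g t))"

(* The terminal conditions are understood as limits in L^2(\<Omega>) as t increases to T. *)
definition adjoint_solution ::
  "'a::euclidean_space set \<Rightarrow> real \<Rightarrow> real \<Rightarrow> ('a \<Rightarrow> 'a \<Rightarrow> 'a \<Rightarrow> real) \<Rightarrow> ('a \<Rightarrow> 'a) \<Rightarrow> ('a \<Rightarrow> real) \<Rightarrow>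
   (real \<times> 'a \<Rightarrow> real) \<Rightarrow> (real \<times> 'a \<Rightarrow> real) \<Rightarrow> bool" where
  "adjoint_solution \<Omega> \<alpha> T a B c \<phi> v \<longleftrightarrow>
     v \<in> L2_H2 T \<Omega> \<and> v \<in> H_frac_back \<alpha> T \<Omega> \<and>
     (\<exists>D z q. caputo_back \<alpha> T \<Omega> v D \<and> is_A0 T \<Omega> a v z \<and>
        (\<forall>i\<in>Basis. space_deriv T \<Omega> i (\<lambda>(t, x). (B x \<bullet> i) * v (t, x)) (q i)) \<and>
        (AE (t, x) in cyl T \<Omega>.
           D (t, x) - z (t, x) + (\<Sum>i\<in>Basis. q i (t, x)) - c x * v (t, x) = 0)) \<and>
     L2_tendsto (vol \<Omega>) (\<lambda>t x. J_back T (2 - \<alpha>) v (t, x)) (\<lambda>_. 0) (at_left T) \<and>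
     (\<exists>v'. time_deriv T \<Omega> v v' \<and>
        L2_tendsto (vol \<Omega>) (\<lambda>t x. J_back T (2 - \<alpha>) v' (t, x)) (\<lambda>_. 0) (at_left T)) \<and>
     lateral_trace T \<Omega> v \<phi>"

section \<open>The norm induced by the adjoint problem\<close>

(* Smooth functions on (0,T) \<times> boundary with compact support in (0,T) \<times> \<Gamma>; smooth means being the
   restriction of a smooth function on the ambient space. *)
definition boundary_data ::
  "'a::euclidean_space set \<Rightarrow> 'a set \<Rightarrow> real \<Rightarrow> (real \<times> 'a \<Rightarrow> real) set" where
  "boundary_data \<Omega> \<Gamma> T =
     {\<phi>. (\<exists>\<Phi>. smooth_on UNIV \<Phi> \<and> (\<forall>z\<in>{0<..<T} \<times> frontier \<Omega>. \<phi> z = \<Phi> z)) \<and>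
         (\<exists>K. compact K \<and> K \<subseteq> {0<..<T} \<times> \<Gamma> \<and> (\<forall>z\<in>{0<..<T} \<times> frontier \<Omega> - K. \<phi> z = 0))}"

(* B_g(f, \<phi>), as a function of the adjoint solution v = v[\<phi>]. *)
definition B_form ::
  "'a::euclidean_space set \<Rightarrow> real \<Rightarrow> (real \<Rightarrow> real) \<Rightarrow> ('a \<Rightarrow> real) \<Rightarrow> (real \<times> 'a \<Rightarrow> real) \<Rightarrow> real" where
  "B_form \<Omega> T g f v = (\<integral>t. (\<integral>x. f x * g t * v (t, x) \<partial>vol \<Omega>) \<partial>vol {0<..<T})"

(* v[\<phi>] is referred to through the problem it solves; being unique almost everywhere it
   contributes exactly one value for each \<phi>.  The supremum is taken in [0, \<infinity>]. *)
definition B_norm ::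
  "'a::euclidean_space set \<Rightarrow> 'a set \<Rightarrow> real \<Rightarrow> real \<Rightarrow> ('a \<Rightarrow> 'a \<Rightarrow> 'a \<Rightarrow> real) \<Rightarrow> ('a \<Rightarrow> 'a) \<Rightarrow>
   ('a \<Rightarrow> real) \<Rightarrow> (real \<Rightarrow> real) \<Rightarrow> ('a \<Rightarrow> real) \<Rightarrow> ennreal" where
  "B_norm \<Omega> \<Gamma> \<alpha> T a B c g f =
     Sup {ennreal \<bar>B_form \<Omega> T g f v\<bar> | \<phi> v.
            \<phi> \<in> boundary_data \<Omega> \<Gamma> T \<and> L2_norm (lateral T \<Omega> \<Gamma>) \<phi> = 1 \<and>
            adjoint_solution \<Omega> \<alpha> T a B c \<phi> v}"

end

theory Submission
  imports Defs
begin

text \<open>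
  The proof pairs the equation for \<open>u\<close> with the solution \<open>v\<close> of the adjoint problem and
  integrates by parts. In time, \<open>u = J^\<alpha> w\<close> and \<open>v = J_{T-}^\<alpha> y\<close>; the two Caputo derivatives are
  \<open>w\<close> and \<open>- y\<close>, and since \<open>J^\<alpha>\<close> and \<open>J_{T-}^\<alpha>\<close> are transposes of each other, moving the
  derivative from \<open>u\<close> to \<open>v\<close> produces no terms at the ends of the time interval
  (\<open>caputo_duality\<close>). In space, \<open>u\<close> vanishes on the boundary and \<open>v\<close> has the trace \<open>\<phi>\<close>, so that
  Green's formula (\<open>elliptic_green\<close>) leaves a single boundary term, the conormal derivative of
  \<open>u\<close> against \<open>\<phi>\<close>. By the adjoint equation everything inside the cylinder cancels. Hence the
  bilinear form at \<open>(f, \<phi>)\<close> is minus the integral of the conormal derivative of \<open>u\<close> times \<open>\<phi>\<close>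
  over the lateral boundary (\<open>B_form_boundary_identity\<close>). This is linear in the data, \<open>\<phi>\<close> is
  supported in \<open>(0,T) \<times> \<Gamma>\<close>, and the Cauchy-Schwarz inequality gives the estimate with constant
  1.

  The weight of the proof is in Green's formula, because the outward normal and the surface
  measure are given only as the unique objects compatible with all local graph charts. Gauss's
  theorem in one chart (\<open>chart_gauss\<close>) rests on the invariance of Lebesgue measure under shears:
  multiply by a cutoff that depends on the height above the graph, and let the cutoff tend to
  the indicator of the domain. This theorem then also proves that the chart measures are
  compatible, since the volume integral does not depend on the chart (\<open>chart_measures_agree\<close>).
  So the surface measure exists, a partition of unity gives \<open>gauss\<close>, and approximation by smooth
  functions gives \<open>green\<close> for Sobolev functions with traces.

  All derivatives in the two problems are weak and enter through witnesses, which are identified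
  by the uniqueness of weak derivatives (\<open>weak_partial_unique\<close>). It rests on smooth bumps that
  approximate indicators of boxes; the same bumps serve as test functions in the comparison of
  chart measures and as partition of unity.
\<close>

section \<open>Partial derivatives and smoothness classes\<close>

lemma partial_eq:
  assumes "(f has_derivative f') (at x)"
  shows "partial i f x = f' i"
  using frechet_derivative_at[OF assms] by (simp add: partial_def)

lemma differentiable_imp_has_derivative_grad:
  fixes f :: "'a::euclidean_space \<Rightarrow> real"
  assumes "f differentiable (at x)"
  shows "(f has_derivative (\<lambda>v. grad f x \<bullet> v)) (at x)"
proof -
  let ?D = "frechet_derivative f (at x)"
  have D: "(f has_derivative ?D) (at x)"
    using assms by (simp add: frechet_derivative_works)
  then have "linear ?D" by (rule has_derivative_linear)
  have "?D v = grad f x \<bullet> v" for v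
  proof -
    have "?D v = ?D (\<Sum>i\<in>Basis. (v \<bullet> i) *\<^sub>R i)" by (simp add: euclidean_representation)
    also have "\<dots> = (\<Sum>i\<in>Basis. (v \<bullet> i) * ?D i)"
      using \<open>linear ?D\<close> by (simp add: linear_sum linear_cmul)
    finally show ?thesis
      by (simp add: grad_def inner_sum_left partial_def inner_commute[of v] mult.commute)
  qed
  then have "?D = (\<lambda>v. grad f x \<bullet> v)" by blast
  with D show ?thesis by simp
qed

lemma grad_inner_Basis: "i \<in> Basis \<Longrightarrow> grad f x \<bullet> i = partial i f x"
  by (simp add: grad_def inner_sum_left inner_Basis if_distrib sum.delta cong: if_cong)

lemma Ck_on_continuous: "Ck_on k S f \<Longrightarrow> continuous_on S f"
  by (cases k) (auto intro!: continuous_at_imp_continuous_on differentiable_imp_continuous_within)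

lemma Ck_on_Suc_imp: "Ck_on (Suc k) S f \<Longrightarrow> Ck_on k S f"
  by (induction k arbitrary: f)
    (auto intro!: continuous_at_imp_continuous_on differentiable_imp_continuous_within)

lemma Ck_on_mono: "Ck_on k S f \<Longrightarrow> j \<le> k \<Longrightarrow> Ck_on j S f"
  by (induction k arbitrary: j) (auto simp del: Ck_on.simps(2) simp: le_Suc_eq dest: Ck_on_Suc_imp)

lemma Ck_on_const: "Ck_on k S (\<lambda>_. c)"
proof -
  have "partial i (\<lambda>_. c) = (\<lambda>_. 0)" for i :: 'a and c
    by (rule ext) (auto intro!: partial_eq derivative_eq_intros)
  then show ?thesis by (induction k arbitrary: c) auto
qed

lemma Ck_on_add:
  assumes "Ck_on k UNIV f" "Ck_on k UNIV g" shows "Ck_on k UNIV (\<lambda>x. f x + g x)"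
  using assms
proof (induction k arbitrary: f g)
  case (Suc k)
  have "partial i (\<lambda>x. f x + g x) = (\<lambda>x. partial i f x + partial i g x)" for i
  proof (rule ext)
    fix x
    show "partial i (\<lambda>x. f x + g x) x = partial i f x + partial i g x"
      using Suc.prems unfolding partial_def
      by (subst frechet_derivative_at[symmetric, OF has_derivative_add]) 
        (auto simp: frechet_derivative_works[symmetric])
  qed
  then show ?case using Suc.prems by (simp add: Suc.IH differentiable_add)
qed (auto intro: continuous_intros)

text \<open>
  Leibniz' rule gives a sum of products one degree lower, so the induction runs over all pairs
  of factors and uses closure under sums.
\<close>

lemma Ck_on_mult:
  assumes "Ck_on k UNIV f" "Ck_on k UNIV g" shows "Ck_on k UNIV (\<lambda>x. f x * g x)"
  using assms
proof (induction k arbitrary: f g)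
  case (Suc k)
  have "partial i (\<lambda>x. f x * g x) = (\<lambda>x. f x * partial i g x + partial i f x * g x)" for i
  proof (rule ext)
    fix x
    show "partial i (\<lambda>x. f x * g x) x = f x * partial i g x + partial i f x * g x"
      using Suc.prems unfolding partial_def
      by (subst frechet_derivative_at[symmetric, OF has_derivative_mult]) 
        (auto simp: frechet_derivative_works[symmetric])
  qed
  moreover have "Ck_on k UNIV f" "Ck_on k UNIV g"
    using Suc.prems Ck_on_Suc_imp by blast+
  ultimately show ?case using Suc.prems 
    by (simp add: Suc.IH Ck_on_add differentiable_mult)
qed (auto intro: continuous_intros)

lemma smooth_on_mult: "smooth_on UNIV f \<Longrightarrow> smooth_on UNIV g \<Longrightarrow> smooth_on UNIV (\<lambda>x. f x * g x)"
  by (auto simp: smooth_on_def Ck_on_mult)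

lemma smooth_on_prod:
  "finite I \<Longrightarrow> (\<And>i. i \<in> I \<Longrightarrow> smooth_on UNIV (f i)) \<Longrightarrow> smooth_on UNIV (\<lambda>x. \<Prod>i\<in>I. f i x)"
proof (induction I rule: finite_induct)
  case empty
  show ?case by (simp add: smooth_on_def Ck_on_const)
next
  case (insert j I)
  then show ?case by (simp add: smooth_on_mult)
qed

section \<open>Smooth bumps on boxes\<close>

text \<open>
  With \<open>P = 1\<close> this is the classical smooth function \<open>exp (- 1 / t)\<close> that vanishes for \<open>t \<le> 0\<close>.
  The polynomial factor in \<open>1 / t\<close> makes the family closed under differentiation, so that
  smoothness can be proved by induction on the order for all \<open>P\<close> at once.
\<close>

definition flat :: "real poly \<Rightarrow> real \<Rightarrow> real" where
  "flat P t = (if t \<le> 0 then 0 else poly P (1 / t) * exp (- (1 / t)))"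

lemma poly_mult_exp_minus_tendsto_0: "((\<lambda>x. poly P x * exp (- x)) \<longlongrightarrow> (0::real)) at_top"
proof -
  have "((\<lambda>x. \<Sum>i\<le>degree P. coeff P i * (x ^ i / exp x)) \<longlongrightarrow> (\<Sum>i\<le>degree P. coeff P i * 0)) at_top"
    by (intro tendsto_sum tendsto_mult tendsto_const tendsto_power_div_exp_0)
  then show ?thesis
    by (simp add: poly_altdef sum_distrib_right exp_minus divide_inverse mult.assoc)
qed

lemma flat_tendsto_0: "(flat P \<longlongrightarrow> 0) (at 0)"
proof -
  have "((\<lambda>t. poly P (1 / t) * exp (- (1 / t))) \<longlongrightarrow> 0) (at_right 0)"
    using filterlim_compose[OF poly_mult_exp_minus_tendsto_0 filterlim_inverse_at_top_right]
    by (simp add: inverse_eq_divide)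
  then have "(flat P \<longlongrightarrow> 0) (at_right 0)"
    by (rule Lim_transform_eventually)
      (auto simp: flat_def eventually_at_filter)
  moreover have "(flat P \<longlongrightarrow> 0) (at_left 0)"
    by (rule Lim_transform_eventually[OF tendsto_const])
      (auto simp: flat_def eventually_at_filter)
  ultimately show ?thesis by (simp add: filterlim_at_split)
qed

text \<open>
  For \<open>t > 0\<close> the chain rule turns \<open>P\<close> into \<open>X^2 (P - P')\<close>. At \<open>t = 0\<close> the difference quotient
  is again a function of the same family, which tends to 0 because the exponential beats every
  polynomial.
\<close>

lemma flat_has_derivative:
  "(flat P has_real_derivative flat ([:0, 0, 1:] * (P - pderiv P)) t) (at t)"
proof -
  consider "t < 0" | "t = 0" | "t > 0" by linarith
  then show ?thesis
  proof cases
    case 1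
    have "((\<lambda>_. 0) has_real_derivative 0) (at t)" by simp
    then have "(flat P has_real_derivative 0) (at t)"
      by (rule has_field_derivative_transform_within_open[where S="{..<0}"])
        (use 1 in \<open>auto simp: flat_def\<close>)
    with 1 show ?thesis by (simp add: flat_def)
  next
    case 2
    \<comment> \<open>Dividing by the argument multiplies the polynomial by the variable.\<close>
    have "((\<lambda>h. flat P h / h) \<longlongrightarrow> 0) (at 0)"
      by (rule Lim_transform_eventually[OF flat_tendsto_0[of "[:0,1:] * P"]])
        (auto simp: flat_def)
    with 2 show ?thesis by (simp add: DERIV_def) (simp add: flat_def)
  next
    case 3
    have inv: "((\<lambda>t. 1 / t) has_real_derivative - (1 / t * (1 / t))) (at t)"
      using 3 by (auto intro!: derivative_eq_intros)
    have "((\<lambda>t. poly P (1 / t) * exp (- (1 / t))) has_real_derivative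
        poly P (1 / t) * (exp (- (1 / t)) * - (- (1 / t * (1 / t)))) +
        poly (pderiv P) (1 / t) * (- (1 / t * (1 / t))) * exp (- (1 / t))) (at t)"
      by (rule DERIV_cong[OF DERIV_mult[OF DERIV_chain2[OF poly_DERIV inv] 
            DERIV_chain2[OF DERIV_exp DERIV_minus[OF inv]]]]) (simp only: ac_simps)
    moreover have "poly P (1 / t) * (exp (- (1 / t)) * - (- (1 / t * (1 / t)))) +
        poly (pderiv P) (1 / t) * (- (1 / t * (1 / t))) * exp (- (1 / t)) =
        flat ([:0, 0, 1:] * (P - pderiv P)) t"
      using 3 by (simp add: flat_def algebra_simps)
    ultimately have "((\<lambda>t. poly P (1 / t) * exp (- (1 / t))) has_real_derivative
        flat ([:0, 0, 1:] * (P - pderiv P)) t) (at t)" by metis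
    then show ?thesis
      by (rule has_field_derivative_transform_within_open[where S="{0<..}"])
        (use 3 in \<open>auto simp: flat_def\<close>)
  qed
qed

lemma smooth_on_flat: "smooth_on UNIV (\<lambda>x::'a::euclidean_space. flat P (m * (x \<bullet> i) + c))"
proof -
  have D: "((\<lambda>x::'a. flat P (m * (x \<bullet> i) + c)) has_derivative
      (\<lambda>v. flat ([:0, 0, 1:] * (P - pderiv P)) (m * (x \<bullet> i) + c) * (m * (v \<bullet> i)))) (at x)" for P x
    by (rule has_derivative_compose[OF _ flat_has_derivative[unfolded has_field_derivative_def]])
      (auto intro!: derivative_eq_intros)
  have "partial j (\<lambda>x::'a. flat P (m * (x \<bullet> i) + c)) = 
      (\<lambda>x. (m * (j \<bullet> i)) * flat ([:0, 0, 1:] * (P - pderiv P)) (m * (x \<bullet> i) + c))" for P j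
    by (rule ext, subst partial_eq[OF D]) simp
  note P = this
  have "Ck_on k UNIV (\<lambda>x::'a. flat P (m * (x \<bullet> i) + c))" for k
  proof (induction k arbitrary: P)
    case 0
    show ?case unfolding Ck_on.simps
      using has_derivative_continuous[OF D] continuous_at_imp_continuous_on by blast
  next
    case (Suc k)
    have "\<forall>x\<in>UNIV. (\<lambda>x::'a. flat P (m * (x \<bullet> i) + c)) differentiable (at x)"
      using D unfolding differentiable_def by blast
    moreover have "\<forall>j\<in>Basis. Ck_on k UNIV (partial j (\<lambda>x::'a. flat P (m * (x \<bullet> i) + c)))"
      unfolding P by (intro ballI Ck_on_mult Ck_on_const Suc.IH)
    ultimately show ?case unfolding Ck_on.simps by blast
  qed
  then show ?thesis by (simp add: smooth_on_def)
qed

text \<open>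
  Every factor increases to 1 on its open half-space as \<open>n\<close> grows, so the bumps approximate the
  indicator of the open box while all of them are supported in the same closed box.
\<close>

definition box_bump :: "'a::euclidean_space \<Rightarrow> 'a \<Rightarrow> nat \<Rightarrow> 'a \<Rightarrow> real" where
  "box_bump a b n x = (\<Prod>i\<in>Basis. flat 1 (real (Suc n) * ((x - a) \<bullet> i)) * flat 1 (real (Suc n) * ((b - x) \<bullet> i)))"

lemma flat_1: "flat 1 t = (if t \<le> 0 then 0 else exp (- (1 / t)))"
  by (simp add: flat_def)

lemma smooth_box_bump: "smooth_on UNIV (box_bump a b n)"
proof -
  have "smooth_on UNIV (\<lambda>x. \<Prod>i\<in>Basis. flat 1 (real (Suc n) * (x \<bullet> i) + (- (real (Suc n) * (a \<bullet> i)))) *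
      flat 1 ((- real (Suc n)) * (x \<bullet> i) + real (Suc n) * (b \<bullet> i)))"
    by (intro smooth_on_prod smooth_on_mult smooth_on_flat finite_Basis)
  also have "(\<lambda>x. \<Prod>i\<in>Basis. flat 1 (real (Suc n) * (x \<bullet> i) + (- (real (Suc n) * (a \<bullet> i)))) *
      flat 1 ((- real (Suc n)) * (x \<bullet> i) + real (Suc n) * (b \<bullet> i))) = box_bump a b n"
    by (auto simp: box_bump_def algebra_simps)
  finally show ?thesis .
qed

lemma box_bump_range: "0 \<le> box_bump a b n x" "box_bump a b n x \<le> 1"
proof -
  have "0 \<le> flat 1 t" "flat 1 t \<le> 1" for t by (simp_all add: flat_1)
  then show "0 \<le> box_bump a b n x" "box_bump a b n x \<le> 1"
    unfolding box_bump_def by (intro prod_nonneg prod_le_1 mult_nonneg_nonneg mult_le_one conjI; blast)+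
qed

lemma box_bump_nonzero_iff: "box_bump a b n x \<noteq> 0 \<longleftrightarrow> x \<in> box a b"
proof -
  have "flat 1 (real (Suc n) * s) \<noteq> 0 \<longleftrightarrow> 0 < s" for s
    by (auto simp: flat_1 not_le mult_le_0_iff simp del: of_nat_Suc)
  then show ?thesis
    by (auto simp: box_bump_def mem_box inner_diff_left simp del: of_nat_Suc)
qed

lemma box_bump_tendsto: "(\<lambda>n. box_bump a b n x) \<longlonglongrightarrow> indicator (box a b) x"
proof (cases "x \<in> box a b")
  case True
  have *: "(\<lambda>n. flat 1 (real (Suc n) * s)) \<longlonglongrightarrow> 1" if "s > 0" for s
  proof -
    have "(\<lambda>n. exp (- (inverse (real (Suc n)) * (1 / s)))) \<longlonglongrightarrow> exp (- (0 * (1 / s)))"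
      by (intro tendsto_intros LIMSEQ_inverse_real_of_nat)
    moreover have "exp (- (inverse (real (Suc n)) * (1 / s))) = flat 1 (real (Suc n) * s)" for n
      using that by (simp add: flat_1 mult_le_0_iff not_le inverse_eq_divide)
    ultimately show ?thesis by simp
  qed
  have "(\<lambda>n. box_bump a b n x) \<longlonglongrightarrow> (\<Prod>i\<in>(Basis::'a set). 1 * 1)"
    unfolding box_bump_def using True by (intro tendsto_intros *) (auto simp: mem_box inner_diff_left)
  with True show ?thesis by simp
next
  case False
  then have "box_bump a b n x = 0" for n using box_bump_nonzero_iff by blast
  with False show ?thesis by simp
qed

lemma box_bump_test: 
  assumes "cbox a b \<subseteq> S" shows "box_bump a b n \<in> test_functions S"
proof -
  have "closure {x. box_bump a b n x \<noteq> 0} \<subseteq> cbox a b"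
    by (intro closure_minimal) (auto simp: box_bump_nonzero_iff box_subset_cbox[THEN subsetD])
  moreover from this have "compact (closure {x. box_bump a b n x \<noteq> 0})"
    by (metis bounded_cbox bounded_subset compact_closure closure_closure bounded_closure closure_subset)
  ultimately show ?thesis
    using assms smooth_box_bump by (auto simp: test_functions_def)
qed

text \<open>
  Boxes whose closures stay inside \<open>U\<close> carry test functions of \<open>U\<close>. Countably many of them
  suffice by Lindelof's theorem, so null sets and measures can be treated box by box.
\<close>

lemma countable_box_cover:
  fixes U :: "'a::euclidean_space set"
  assumes "open U"
  obtains F where "countable F" "\<Union>F = U" "\<And>Q. Q \<in> F \<Longrightarrow> \<exists>u v. Q = box u v \<and> cbox u v \<subseteq> U"
proof -
  define F where "F = {box u v | u v. cbox u v \<subseteq> U}"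
  have "\<Union>F = U"
  proof
    show "\<Union>F \<subseteq> U" using box_subset_cbox by (fastforce simp: F_def)
    show "U \<subseteq> \<Union>F"
    proof
      fix x assume "x \<in> U"
      then obtain a c where "x \<in> box a c" "cbox a c \<subseteq> U"
        using open_contains_cbox[of U x] assms by metis
      then show "x \<in> \<Union>F" unfolding F_def by blast
    qed
  qed
  moreover obtain F' where F': "F' \<subseteq> F" "countable F'" "\<Union>F' = \<Union>F"
  proof (rule Lindelof[of F])
    show "open S" if "S \<in> F" for S using that by (auto simp: F_def)
  qed blast
  ultimately have U: "\<Union>F' = U" by simp
  have "\<exists>u v. Q = box u v \<and> cbox u v \<subseteq> U" if "Q \<in> F'" for Q using F'(1) that unfolding F_def by blast
  with F'(2) U show ?thesis by (rule that)
qed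

lemma box_Int_subbox:
  fixes u v w z :: "'a::euclidean_space"
  shows "\<exists>w' z'. box u v \<inter> box w z = box w' z' \<and> cbox w' z' \<subseteq> cbox u v"
proof (intro exI conjI)
  let ?w = "\<Sum>i\<in>Basis. max (u \<bullet> i) (w \<bullet> i) *\<^sub>R i" and ?z = "\<Sum>i\<in>Basis. min (v \<bullet> i) (z \<bullet> i) *\<^sub>R i"
  show "box u v \<inter> box w z = box ?w ?z" by (auto simp: mem_box)
  show "cbox ?w ?z \<subseteq> cbox u v" by (auto simp: mem_box)
qed

lemma measure_eqI_boxes:
  fixes M N :: "'a::euclidean_space measure"
  assumes M: "sets M = sets borel" and N: "sets N = sets borel"
    and eq: "\<And>a b. emeasure M (box a b) = emeasure N (box a b)"
    and fin: "\<And>a b. emeasure M (box a b) \<noteq> \<infinity>"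
  shows "M = N"
proof (rule measure_eqI_generator_eq)
  let ?E = "range (\<lambda>(a, b). box a b :: 'a set)"
  show "Int_stable ?E"
  proof (rule Int_stableI)
    fix A B assume "A \<in> ?E" "B \<in> ?E"
    then obtain a b c d where "A = box a b" "B = box c d" by auto
    then show "A \<inter> B \<in> ?E" by (auto simp: box_Int_box)
  qed
  show "sets M = sigma_sets UNIV ?E" "sets N = sigma_sets UNIV ?E"
    by (simp_all add: M N borel_eq_box)
  show "(\<Union>n::nat. box (- (real n *\<^sub>R One)) (real n *\<^sub>R One) :: 'a set) = UNIV"
    using UN_box_eq_UNIV by simp
qed (use eq fin in auto)

section \<open>Slicing Lebesgue measure along a coordinate axis\<close>

lemma hyperplane_map_measurable:
  "(\<lambda>y. \<Sum>c\<in>Basis - {b}. y c *\<^sub>R c) \<in> measurable (\<Pi>\<^sub>M c\<in>Basis - {b::'a::euclidean_space}. lborel) borel"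
  by measurable

lemma sets_hyperplane_measure[simp, measurable_cong]: "sets (hyperplane_measure b) = sets borel"
  by (simp add: hyperplane_measure_def)

lemma space_hyperplane_measure[simp]: "space (hyperplane_measure b) = UNIV"
  by (simp add: hyperplane_measure_def)

text \<open>
  Reading off the coordinates maps the hyperplane measure back to the product measure, and a
  measure whose image is sigma-finite is sigma-finite.
\<close>

lemma sigma_finite_hyperplane_measure:
  fixes b :: "'a::euclidean_space"
  shows "sigma_finite_measure (hyperplane_measure b)"
proof -
  interpret product_sigma_finite "\<lambda>_::'a. lborel :: real measure" ..
  let ?P = "\<Pi>\<^sub>M c\<in>Basis - {b}. (lborel :: real measure)"
  define g where "g x = restrict (\<lambda>c. x \<bullet> c) (Basis - {b})" for x :: 'a
  have g: "g \<in> measurable (hyperplane_measure b) ?P"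
    unfolding g_def by (rule measurable_restrict) simp
  have "distr (hyperplane_measure b) ?P g = distr ?P ?P (g \<circ> (\<lambda>y. \<Sum>c\<in>Basis - {b}. y c *\<^sub>R c))"
    unfolding hyperplane_measure_def
    by (rule distr_distr) (use g hyperplane_map_measurable in \<open>auto simp: hyperplane_measure_def\<close>)
  also have "\<dots> = distr ?P ?P (\<lambda>x. x)"
  proof (rule distr_cong)
    fix y assume "y \<in> space ?P"
    then have y: "y \<in> extensional (Basis - {b})" by (auto simp: space_PiM PiE_def)
    have "(\<Sum>c\<in>Basis - {b}. y c *\<^sub>R c) \<bullet> c' = y c'" if "c' \<in> Basis - {b}" for c'
      using that by (simp add: inner_sum_left inner_Basis if_distrib sum.delta cong: if_cong)
    then show "(g \<circ> (\<lambda>y. \<Sum>c\<in>Basis - {b}. y c *\<^sub>R c)) y = y"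
      using y by (auto simp: g_def fun_eq_iff extensional_def)
  qed simp_all
  finally have eq: "distr (hyperplane_measure b) ?P g = ?P" by (simp add: distr_id2)
  have "sigma_finite_measure ?P" by (rule sigma_finite) simp
  then show ?thesis
    using g by (intro sigma_finite_measure_distr[of "hyperplane_measure b" ?P g]) (simp_all add: eq)
qed

lemma AE_hyperplane_measure:
  assumes "b \<in> Basis" shows "AE y in hyperplane_measure b. y \<bullet> b = 0"
  unfolding hyperplane_measure_def
  by (subst AE_distr_iff) (use assms in \<open>auto simp: inner_sum_left inner_Basis intro!: AE_I2 sum.neutral\<close>)

lemma nn_integral_lborel_hyperplane:
  fixes b :: "'a::euclidean_space" and f :: "'a \<Rightarrow> ennreal"
  assumes b: "b \<in> Basis" and [measurable]: "f \<in> borel_measurable borel"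
  shows "(\<integral>\<^sup>+x. f x \<partial>lborel) = (\<integral>\<^sup>+y. (\<integral>\<^sup>+t. f (y + t *\<^sub>R b) \<partial>lborel) \<partial>hyperplane_measure b)"
proof -
  interpret product_sigma_finite "\<lambda>_::'a. lborel :: real measure" ..
  have ins: "Basis = insert b (Basis - {b})" using b by auto
  have "(\<integral>\<^sup>+x. f x \<partial>lborel) = (\<integral>\<^sup>+y. f (\<Sum>c\<in>Basis. y c *\<^sub>R c) \<partial>(\<Pi>\<^sub>M c\<in>Basis. lborel))"
    by (subst lborel_eq, subst nn_integral_distr) auto
  also have "\<dots> = (\<integral>\<^sup>+y. f (\<Sum>c\<in>Basis. y c *\<^sub>R c) \<partial>(\<Pi>\<^sub>M c\<in>insert b (Basis - {b}). lborel))"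
    using ins by simp
  also have "\<dots> = (\<integral>\<^sup>+y. \<integral>\<^sup>+t. f (\<Sum>c\<in>Basis. (y(b := t)) c *\<^sub>R c) \<partial>lborel \<partial>(\<Pi>\<^sub>M c\<in>Basis - {b}. lborel))"
  proof (rule product_nn_integral_insert)
    show "(\<lambda>y. f (\<Sum>c\<in>Basis. y c *\<^sub>R c)) \<in> borel_measurable (\<Pi>\<^sub>M c\<in>insert b (Basis - {b}). lborel)"
      unfolding ins[symmetric] by measurable
  qed auto
  also have "\<dots> = (\<integral>\<^sup>+y. \<integral>\<^sup>+t. f ((\<Sum>c\<in>Basis - {b}. y c *\<^sub>R c) + t *\<^sub>R b) \<partial>lborel \<partial>(\<Pi>\<^sub>M c\<in>Basis - {b}. lborel))"
  proof -
    have "(\<Sum>c\<in>Basis. (y(b := t)) c *\<^sub>R c) = (\<Sum>c\<in>Basis - {b}. y c *\<^sub>R c) + t *\<^sub>R b" for y :: "'a \<Rightarrow> real" and t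
      using b by (subst sum.remove[of _ b]) (auto intro!: sum.cong)
    then show ?thesis by simp
  qed
  also have "\<dots> = (\<integral>\<^sup>+y. (\<integral>\<^sup>+t. f (y + t *\<^sub>R b) \<partial>lborel) \<partial>hyperplane_measure b)"
    unfolding hyperplane_measure_def
    by (subst nn_integral_distr) (auto intro!: lborel.borel_measurable_nn_integral)
  finally show ?thesis .
qed

text \<open>
  The fibres in direction \<open>b\<close> are only translated and reflected, which Lebesgue measure on the
  line does not see. For a graph chart, \<open>\<tau>\<close> is the height above the graph measured towards the
  inside of the domain; integration in these coordinates replaces a change of variables in
  codimension one.
\<close>

lemma lborel_eq_shear:
  fixes b :: "'a::euclidean_space" and h :: "'a \<Rightarrow> real"
  assumes b: "b \<in> Basis" and s: "s \<in> {1, -1}" and [measurable]: "h \<in> borel_measurable borel"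
  shows "distr (hyperplane_measure b \<Otimes>\<^sub>M lborel) borel (\<lambda>(y, \<tau>). y + (s * (h y + \<tau>)) *\<^sub>R b) = lborel"
proof (rule measure_eqI)
  fix E assume "E \<in> sets (distr (hyperplane_measure b \<Otimes>\<^sub>M lborel) borel (\<lambda>(y, \<tau>). y + (s * (h y + \<tau>)) *\<^sub>R b))"
  then have [measurable]: "E \<in> sets borel" by simp
  have "emeasure lborel E = (\<integral>\<^sup>+x. indicator E x \<partial>lborel)" by simp
  also have "\<dots> = (\<integral>\<^sup>+y. (\<integral>\<^sup>+t. indicator E (y + t *\<^sub>R b) \<partial>lborel) \<partial>hyperplane_measure b)"
    by (rule nn_integral_lborel_hyperplane[OF b]) simp
  also have "\<dots> = (\<integral>\<^sup>+y. (\<integral>\<^sup>+\<tau>. indicator E (y + (s * h y + s * \<tau>) *\<^sub>R b) \<partial>lborel) \<partial>hyperplane_measure b)"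
  proof (rule nn_integral_cong)
    fix y
    show "(\<integral>\<^sup>+t. indicator E (y + t *\<^sub>R b) \<partial>lborel) = (\<integral>\<^sup>+\<tau>. indicator E (y + (s * h y + s * \<tau>) *\<^sub>R b) \<partial>lborel)"
      using s by (subst nn_integral_real_affine[of _ s "s * h y"]) auto
  qed
  also have "\<dots> = (\<integral>\<^sup>+z. indicator E (case z of (y, \<tau>) \<Rightarrow> y + (s * (h y + \<tau>)) *\<^sub>R b) \<partial>(hyperplane_measure b \<Otimes>\<^sub>M lborel))"
    by (subst lborel.nn_integral_fst[symmetric]) (auto simp: distrib_left split_beta')
  also have "\<dots> = emeasure (distr (hyperplane_measure b \<Otimes>\<^sub>M lborel) borel (\<lambda>(y, \<tau>). y + (s * (h y + \<tau>)) *\<^sub>R b)) E"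
  proof -
    have "(\<integral>\<^sup>+x. indicator E x \<partial>distr (hyperplane_measure b \<Otimes>\<^sub>M lborel) borel (\<lambda>(y, \<tau>). y + (s * (h y + \<tau>)) *\<^sub>R b)) =
        (\<integral>\<^sup>+z. indicator E (case z of (y, \<tau>) \<Rightarrow> y + (s * (h y + \<tau>)) *\<^sub>R b) \<partial>(hyperplane_measure b \<Otimes>\<^sub>M lborel))"
      by (subst nn_integral_distr) (auto simp: split_beta')
    then show ?thesis by simp
  qed
  finally show "emeasure (distr (hyperplane_measure b \<Otimes>\<^sub>M lborel) borel (\<lambda>(y, \<tau>). y + (s * (h y + \<tau>)) *\<^sub>R b)) E = emeasure lborel E"
    by simp
qed simp

text \<open>
  The cylinder of height 1 over a bounded set lies in a ball.
\<close>

lemma emeasure_hyperplane_bounded: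
  fixes b :: "'a::euclidean_space"
  assumes b: "b \<in> Basis"
  shows "emeasure (hyperplane_measure b) {y. norm y \<le> R} < \<infinity>"
proof -
  have "emeasure (hyperplane_measure b) {y. norm y \<le> R} = (\<integral>\<^sup>+y. indicator {y. norm y \<le> R} y \<partial>hyperplane_measure b)"
    by (subst nn_integral_indicator) auto
  also have "\<dots> \<le> (\<integral>\<^sup>+y. (\<integral>\<^sup>+t. indicator (cball 0 (R + 1)) (y + t *\<^sub>R b) \<partial>lborel) \<partial>hyperplane_measure b)"
  proof (rule nn_integral_mono)
    fix y :: 'a
    show "indicator {y. norm y \<le> R} y \<le> (\<integral>\<^sup>+t. indicator (cball 0 (R + 1)) (y + t *\<^sub>R b) \<partial>lborel)"
    proof (cases "norm y \<le> R")
      case True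
      have "1 = (\<integral>\<^sup>+t. indicator {0..1::real} t \<partial>lborel)" by simp
      also have "\<dots> \<le> (\<integral>\<^sup>+t. indicator (cball 0 (R + 1)) (y + t *\<^sub>R b) \<partial>lborel)"
      proof (rule nn_integral_mono)
        fix t :: real
        have "norm (y + t *\<^sub>R b) \<le> R + 1" if "t \<in> {0..1}"
          using norm_triangle_ineq[of y "t *\<^sub>R b"] that True b by (auto simp: norm_Basis)
        then show "indicator {0..1} t \<le> (indicator (cball 0 (R + 1)) (y + t *\<^sub>R b) :: ennreal)"
          by (auto split: split_indicator)
      qed
      finally show ?thesis using True by simp
    qed simp
  qed
  also have "\<dots> = emeasure lborel (cball 0 (R + 1) :: 'a set)"
    by (subst nn_integral_lborel_hyperplane[OF b, symmetric])
      (auto intro!: borel_measurable_indicator simp: borel_closed)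
  also have "\<dots> < \<infinity>" using emeasure_compact_finite[of "cball (0::'a) (R+1)"] by simp
  finally show ?thesis .
qed

section \<open>Functions continuously differentiable up to the boundary\<close>

text \<open>
  \<open>D\<close> is the gradient on \<open>S\<close> together with its continuous extension to the closure.
\<close>

definition C1_upto :: "'a::euclidean_space set \<Rightarrow> ('a \<Rightarrow> real) \<Rightarrow> ('a \<Rightarrow> 'a) \<Rightarrow> bool" where
  "C1_upto S f D \<longleftrightarrow> continuous_on (closure S) f \<and> continuous_on (closure S) D \<and>
     (\<forall>x\<in>S. (f has_derivative (\<lambda>v. D x \<bullet> v)) (at x))"

lemma C1_closure_imp_C1_upto:
  assumes "C1_closure S f" shows "\<exists>D. C1_upto S f D"
proof -
  obtain d where d: "\<And>i. i \<in> Basis \<Longrightarrow> continuous_on (closure S) (d i) \<and> (\<forall>x\<in>S. d i x = partial i f x)"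
    using assms unfolding C1_closure_def by metis
  define D where "D x = (\<Sum>i\<in>Basis. d i x *\<^sub>R i)" for x
  have "continuous_on (closure S) D"
    unfolding D_def using d by (auto intro!: continuous_intros)
  moreover have "D x = grad f x" if "x \<in> S" for x
    using d that by (simp add: D_def grad_def)
  ultimately have "C1_upto S f D"
    using assms unfolding C1_upto_def C1_closure_def
    by (auto intro: differentiable_imp_has_derivative_grad)
  then show ?thesis by blast
qed

lemma Ck_on_1_UNIV:
  assumes "Ck_on 1 UNIV f"
  shows "continuous_on UNIV f" "continuous_on UNIV (grad f)" "(f has_derivative (\<lambda>v. grad f x \<bullet> v)) (at x)"
proof -
  show "continuous_on UNIV f" using assms by (rule Ck_on_continuous)
  have "\<forall>i\<in>Basis. continuous_on UNIV (partial i f)" using assms by simp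
  then show "continuous_on UNIV (grad f)"
    unfolding grad_def[abs_def] by (auto intro!: continuous_intros)
  show "(f has_derivative (\<lambda>v. grad f x \<bullet> v)) (at x)"
    using assms by (intro differentiable_imp_has_derivative_grad) simp
qed

lemma C1_upto_Ck: "Ck_on 1 UNIV f \<Longrightarrow> C1_upto S f (grad f)"
  using Ck_on_1_UNIV[of f] unfolding C1_upto_def by (auto intro: continuous_on_subset)

lemma C1_upto_smooth: "smooth_on UNIV f \<Longrightarrow> C1_upto S f (grad f)"
  unfolding smooth_on_def by (rule C1_upto_Ck) blast

lemma C1_upto_mult:
  assumes "C1_upto S f D" "C1_upto S g E"
  shows "C1_upto S (\<lambda>x. f x * g x) (\<lambda>x. f x *\<^sub>R E x + g x *\<^sub>R D x)"
  unfolding C1_upto_def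
proof (intro conjI ballI)
  fix x assume "x \<in> S"
  then have "(f has_derivative (\<lambda>v. D x \<bullet> v)) (at x)" "(g has_derivative (\<lambda>v. E x \<bullet> v)) (at x)"
    using assms by (auto simp: C1_upto_def)
  from has_derivative_mult[OF this]
  show "((\<lambda>x. f x * g x) has_derivative (\<lambda>v. (f x *\<^sub>R E x + g x *\<^sub>R D x) \<bullet> v)) (at x)"
    by (simp add: inner_add_left mult.commute)
qed (use assms in \<open>auto intro!: continuous_on_mult continuous_on_add continuous_on_scaleR simp: C1_upto_def\<close>)

lemma C1_upto_sum:
  assumes "finite I" "\<And>k. k \<in> I \<Longrightarrow> C1_upto S (f k) (D k)"
  shows "C1_upto S (\<lambda>x. \<Sum>k\<in>I. f k x) (\<lambda>x. \<Sum>k\<in>I. D k x)"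
  unfolding C1_upto_def
proof (intro conjI ballI)
  fix x assume "x \<in> S"
  then have "((\<lambda>x. \<Sum>k\<in>I. f k x) has_derivative (\<lambda>v. \<Sum>k\<in>I. D k x \<bullet> v)) (at x)"
    using assms by (intro has_derivative_sum) (auto simp: C1_upto_def)
  then show "((\<lambda>x. \<Sum>k\<in>I. f k x) has_derivative (\<lambda>v. (\<Sum>k\<in>I. D k x) \<bullet> v)) (at x)"
    by (simp add: inner_sum_left)
qed (use assms in \<open>auto intro!: continuous_on_sum simp: C1_upto_def\<close>)

lemma C1_upto_compose:
  assumes "C1_upto S f D" and p: "\<And>t. t \<in> f ` closure S \<Longrightarrow> (p has_real_derivative p' t) (at t)"
    and c: "continuous_on (f ` closure S) p'"
  shows "C1_upto S (\<lambda>x. p (f x)) (\<lambda>x. p' (f x) *\<^sub>R D x)"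
  unfolding C1_upto_def
proof (intro conjI ballI)
  have pc: "continuous_on (f ` closure S) p"
    using p DERIV_isCont by (intro continuous_at_imp_continuous_on) blast
  have f: "continuous_on (closure S) f" and D: "continuous_on (closure S) D"
    using assms by (auto simp: C1_upto_def)
  show "continuous_on (closure S) (\<lambda>x. p (f x))"
    using continuous_on_compose2[OF pc f] by simp
  show "continuous_on (closure S) (\<lambda>x. p' (f x) *\<^sub>R D x)"
    using continuous_on_compose2[OF c f] D by (auto intro!: continuous_intros)
  fix x assume x: "x \<in> S"
  then have "(f has_derivative (\<lambda>v. D x \<bullet> v)) (at x)" using assms by (auto simp: C1_upto_def)
  moreover have "f x \<in> f ` closure S" using x closure_subset[of S] by blast
  then have "(p has_derivative (*) (p' (f x))) (at (f x))"
    using p unfolding has_field_derivative_def by blast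
  ultimately have "((\<lambda>x. p (f x)) has_derivative (\<lambda>v. p' (f x) * (D x \<bullet> v))) (at x)"
    by (rule has_derivative_compose)
  then show "((\<lambda>x. p (f x)) has_derivative (\<lambda>v. (p' (f x) *\<^sub>R D x) \<bullet> v)) (at x)"
    by (rule has_derivative_eq_rhs) (simp add: fun_eq_iff)
qed

lemma C1_upto_cong:
  assumes "open S" "C1_upto S f D" "\<And>x. x \<in> closure S \<Longrightarrow> f x = g x"
  shows "C1_upto S g D"
proof -
  have f: "continuous_on (closure S) f" and D: "continuous_on (closure S) D"
    and d: "\<And>x. x \<in> S \<Longrightarrow> (f has_derivative (\<lambda>v. D x \<bullet> v)) (at x)"
    using assms by (auto simp: C1_upto_def)
  have "(g has_derivative (\<lambda>v. D x \<bullet> v)) (at x)" if "x \<in> S" for x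
    using d[OF that] assms(1) that
  proof (rule has_derivative_transform_within_open)
    show "f y = g y" if "y \<in> S" for y using assms(3) that closure_subset by blast
  qed
  moreover have "continuous_on (closure S) g"
    using f assms(3) by (rule continuous_on_eq)
  ultimately show ?thesis using D by (simp add: C1_upto_def)
qed

lemma gradient_zero_where_locally_zero:
  fixes f :: "'a::euclidean_space \<Rightarrow> real"
  assumes "(f has_derivative (\<lambda>v. d \<bullet> v)) (at x)" "open U" "x \<in> U" "\<And>y. y \<in> U \<Longrightarrow> f y = 0"
  shows "d = 0"
proof -
  have "(f has_derivative (\<lambda>v. 0)) (at x)"
    by (rule has_derivative_transform_within_open[OF has_derivative_const[of 0], where s=U]) (use assms in auto)
  from has_derivative_unique[OF assms(1) this] have "d \<bullet> d = 0" by metis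
  then show ?thesis by simp
qed

section \<open>Integrals of partial derivatives\<close>

text \<open>
  Along every line in direction \<open>i\<close> the integral of the derivative vanishes by the fundamental
  theorem of calculus.
\<close>

lemma integral_partial_compact_support:
  fixes G :: "'a::euclidean_space \<Rightarrow> real"
  assumes G: "\<And>x. (G has_derivative (\<lambda>v. D x \<bullet> v)) (at x)" and D: "continuous_on UNIV D"
    and K: "compact K" "\<And>x. x \<notin> K \<Longrightarrow> G x = 0" and i: "i \<in> Basis"
  shows "(\<integral>x. D x \<bullet> i \<partial>lborel) = 0"
proof -
  interpret H: sigma_finite_measure "hyperplane_measure i" by (rule sigma_finite_hyperplane_measure)
  interpret P: pair_sigma_finite "hyperplane_measure i" "lborel :: real measure" ..
  have D0: "D x = 0" if "x \<notin> K" for x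
    using gradient_zero_where_locally_zero[OF G, of "- K" x] K that compact_imp_closed[of K] by auto
  have "D \<in> borel_measurable borel" using D by (rule borel_measurable_continuous_onI)
  note [measurable] = this
  have "integrable lborel (\<lambda>x. indicator K x *\<^sub>R (D x \<bullet> i))"
    using D by (intro borel_integrable_compact K continuous_on_inner) (auto intro: continuous_on_subset)
  moreover have "indicator K x *\<^sub>R (D x \<bullet> i) = D x \<bullet> i" for x
    using D0[of x] by (cases "x \<in> K") auto
  ultimately have int: "integrable lborel (\<lambda>x. D x \<bullet> i)" by (simp only:)
  obtain R where R: "K \<subseteq> cball 0 R" using compact_imp_bounded[OF K(1)] by (force simp: bounded_iff)
  have sh: "distr (hyperplane_measure i \<Otimes>\<^sub>M lborel) borel (\<lambda>(y, \<tau>). y + \<tau> *\<^sub>R i) = lborel"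
    using lborel_eq_shear[of i 1 "\<lambda>_. 0"] i by simp
  have int': "integrable (hyperplane_measure i \<Otimes>\<^sub>M lborel) (\<lambda>(y, t). D (y + t *\<^sub>R i) \<bullet> i)"
    using int unfolding sh[symmetric]
    by (subst (asm) integrable_distr_eq) (auto simp: split_beta')
  have "(\<integral>x. D x \<bullet> i \<partial>lborel) = (\<integral>(y, t). D (y + t *\<^sub>R i) \<bullet> i \<partial>(hyperplane_measure i \<Otimes>\<^sub>M lborel))"
    by (subst sh[symmetric], subst integral_distr) (auto simp: split_beta')
  also have "\<dots> = (\<integral>y. (\<integral>t. D (y + t *\<^sub>R i) \<bullet> i \<partial>lborel) \<partial>hyperplane_measure i)"
    using P.integral_fst[OF int'] by simp
  finally have 1: "(\<integral>x. D x \<bullet> i \<partial>lborel) =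
      (\<integral>y. (\<integral>t. D (y + t *\<^sub>R i) \<bullet> i \<partial>lborel) \<partial>hyperplane_measure i)" .
  have "(\<integral>t. D (y + t *\<^sub>R i) \<bullet> i \<partial>lborel) = 0" for y
  proof -
    define r where "r = \<bar>R\<bar> + \<bar>y \<bullet> i\<bar> + 1"
    have far: "y + t *\<^sub>R i \<notin> K" if "\<bar>t\<bar> \<ge> r" for t
    proof
      assume "y + t *\<^sub>R i \<in> K"
      then have "norm (y + t *\<^sub>R i) \<le> R" using R by auto
      moreover have "\<bar>(y + t *\<^sub>R i) \<bullet> i\<bar> \<le> norm (y + t *\<^sub>R i)" by (rule Basis_le_norm[OF i])
      ultimately show False using that i by (simp add: inner_add_left r_def)
    qed
    have "((\<lambda>t. G (y + t *\<^sub>R i)) has_vector_derivative D (y + t *\<^sub>R i) \<bullet> i) (at t within {-r..r})" for t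
      unfolding has_vector_derivative_def
      by (rule has_derivative_at_withinI, rule has_derivative_eq_rhs[OF has_derivative_compose[OF _ G]])
        (auto intro!: derivative_eq_intros)
    moreover have "continuous_on {-r..r} (\<lambda>t. D (y + t *\<^sub>R i))"
      by (rule continuous_on_compose2[OF D]) (auto intro!: continuous_intros)
    then have "continuous_on {-r..r} (\<lambda>t. D (y + t *\<^sub>R i) \<bullet> i)"
      by (intro continuous_intros)
    moreover have "-r \<le> r" by (simp add: r_def)
    ultimately have "(\<integral>t. indicator {-r..r} t *\<^sub>R (D (y + t *\<^sub>R i) \<bullet> i) \<partial>lborel) = G (y + r *\<^sub>R i) - G (y + (-r) *\<^sub>R i)"
      by (intro integral_FTC_Icc)
    also have "\<dots> = 0" using far[of r] far[of "-r"] K by simp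
    also have "(\<integral>t. indicator {-r..r} t *\<^sub>R (D (y + t *\<^sub>R i) \<bullet> i) \<partial>lborel) = (\<integral>t. D (y + t *\<^sub>R i) \<bullet> i \<partial>lborel)"
      using far D0 by (intro Bochner_Integration.integral_cong) (auto split: split_indicator)
    finally show ?thesis .
  qed
  with 1 show ?thesis by simp
qed

text \<open>
  Extension by zero is continuously differentiable on the whole space, since \<open>S\<close> and the
  complement of \<open>K\<close> are open and cover it.
\<close>

lemma integral_partial_interior_support:
  fixes f :: "'a::euclidean_space \<Rightarrow> real"
  assumes S: "open S" and f: "C1_upto S f D" and K: "compact K" "K \<subseteq> S" "\<And>x. x \<in> S - K \<Longrightarrow> f x = 0"
    and i: "i \<in> Basis"
  shows "(\<integral>x. D x \<bullet> i \<partial>vol S) = 0"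
proof -
  have cK: "closed K" using K by (simp add: compact_imp_closed)
  define G where "G x = (if x \<in> S then f x else 0)" for x
  define D' where "D' x = (if x \<in> S then D x else 0)" for x
  have fS: "(f has_derivative (\<lambda>v. D x \<bullet> v)) (at x)" if "x \<in> S" for x
    using f that by (auto simp: C1_upto_def)
  have G0: "G x = 0" if "x \<notin> K" for x using that K by (auto simp: G_def)
  have D0: "D' x = 0" if "x \<notin> K" for x
    using gradient_zero_where_locally_zero[OF fS, of x "S - K"] that K S cK by (auto simp: D'_def)
  have "(G has_derivative (\<lambda>v. D' x \<bullet> v)) (at x)" for x
  proof (cases "x \<in> S")
    case True
    show ?thesis
      by (rule has_derivative_transform_within_open[of f _ _ _ S]) (use fS True S in \<open>auto simp: G_def D'_def\<close>)
  next
    case False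
    show ?thesis
      by (rule has_derivative_transform_within_open[of "\<lambda>_. 0" _ _ _ "- K"])
        (use False K cK G0 in \<open>auto simp: D'_def\<close>)
  qed
  moreover have "continuous_on UNIV D'"
  proof -
    have "continuous_on S D" using f closure_subset by (auto simp: C1_upto_def intro: continuous_on_subset)
    then have "continuous_on S D'" by (rule continuous_on_eq) (simp add: D'_def)
    moreover have "continuous_on (- K) D'"
      by (rule continuous_on_eq[OF continuous_on_const[of _ 0]]) (use D0 in auto)
    ultimately have "continuous_on (S \<union> - K) D'"
      using S cK by (intro continuous_on_open_Un) auto
    moreover have "S \<union> - K = UNIV" using K by auto
    ultimately show ?thesis by simp
  qed
  ultimately have "(\<integral>x. D' x \<bullet> i \<partial>lborel) = 0"
    using integral_partial_compact_support[of G D' K i] K G0 i by blast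
  moreover have "(\<integral>x. D x \<bullet> i \<partial>vol S) = (\<integral>x. D' x \<bullet> i \<partial>lborel)"
    using S by (subst integral_restrict_space) (auto simp: D'_def intro!: Bochner_Integration.integral_cong)
  ultimately show ?thesis by simp
qed

section \<open>Gauss's theorem in a graph chart\<close>

lemma continuous_bounded_on_compact:
  fixes f :: "'a::topological_space \<Rightarrow> real"
  assumes "compact K" "continuous_on K f"
  obtains C where "\<And>x. x \<in> K \<Longrightarrow> \<bar>f x\<bar> \<le> C"
proof -
  have "bounded (f ` K)" using assms by (intro compact_imp_bounded compact_continuous_image)
  then obtain C where "\<forall>y\<in>f ` K. norm y \<le> C" unfolding bounded_iff by blast
  then show ?thesis using that[of C] by simp
qed

definition chart_normal :: "'a::euclidean_space \<Rightarrow> real \<Rightarrow> ('a \<Rightarrow> real) \<Rightarrow> 'a \<Rightarrow> 'a" where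
  "chart_normal b s h x = (1 / sqrt (1 + (norm (grad h x))\<^sup>2)) *\<^sub>R (grad h x - s *\<^sub>R b)"

text \<open>
  The measure on the graph prescribed by one chart, as a measure on the whole space: the area
  element on the hyperplane, pushed forward to the graph.
\<close>

definition chart_measure :: "'a::euclidean_space \<Rightarrow> real \<Rightarrow> ('a \<Rightarrow> real) \<Rightarrow> 'a measure" where
  "chart_measure b s h =
     distr (density (hyperplane_measure b) (\<lambda>y. ennreal (sqrt (1 + (norm (grad h y))\<^sup>2))))
       borel (\<lambda>y. y + (s * h y) *\<^sub>R b)"

lemma sets_chart_measure[simp, measurable_cong]: "sets (chart_measure b s h) = sets borel"
  by (simp add: chart_measure_def)

lemma graph_chartD:
  assumes "graph_chart 1 \<Omega> p r b s h"
  shows "r > 0" "b \<in> Basis" "s \<in> {1, -1}" "s * s = 1" "Ck_on 1 UNIV h" "h (x + t *\<^sub>R b) = h x"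
    "x \<in> ball p r \<Longrightarrow> x \<in> \<Omega> \<longleftrightarrow> h x < s * (x \<bullet> b)"
  using assms unfolding graph_chart_def by auto

text \<open>
  \<open>h\<close> is invariant under translation along \<open>b\<close>, hence so are its derivatives.
\<close>

lemma grad_shift:
  assumes "\<And>x t. h (x + t *\<^sub>R b) = (h x :: real)"
  shows "grad h (x + t *\<^sub>R b) = grad h (x :: 'a::euclidean_space)"
proof -
  have shift: "(h has_derivative L) (at x)" if "(h has_derivative L) (at (x + t *\<^sub>R b))" for L x t
  proof -
    have "((\<lambda>x. x + t *\<^sub>R b) has_derivative (\<lambda>v. v)) (at x)"
      by (auto intro!: derivative_eq_intros)
    from has_derivative_compose[where g=h, OF this that]
    show ?thesis using assms by simp
  qed
  have iff: "(h has_derivative L) (at (x + t *\<^sub>R b)) \<longleftrightarrow> (h has_derivative L) (at x)" for L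
    using shift[of L x t] shift[of L "x + t *\<^sub>R b" "-t"] by auto
  show ?thesis by (simp add: grad_def partial_def frechet_derivative_def iff)
qed

lemma continuous_chart_normal:
  assumes "Ck_on 1 UNIV h" shows "continuous_on UNIV (chart_normal b s h)"
proof -
  have "0 < sqrt (1 + (norm (grad h x))\<^sup>2)" for x
    by (simp add: add_pos_nonneg)
  then have "sqrt (1 + (norm (grad h x))\<^sup>2) \<noteq> 0" for x
    by (metis less_irrefl)
  then show ?thesis unfolding chart_normal_def[abs_def]
    by (intro continuous_intros Ck_on_1_UNIV(2)[OF assms]) blast
qed

lemma chart_normal_measurable[measurable]:
  "Ck_on 1 UNIV h \<Longrightarrow> chart_normal b s h \<in> borel_measurable borel"
  by (intro borel_measurable_continuous_onI continuous_chart_normal)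

text \<open>
  The area element cancels the normalization of the normal vector, which leaves the unnormalized
  normal \<open>grad h - s b\<close>.
\<close>

lemma integral_chart_measure:
  assumes h: "Ck_on 1 UNIV h" "\<And>x t. h (x + t *\<^sub>R b) = h x" and [measurable]: "f \<in> borel_measurable borel"
  shows "(\<integral>x. f x * (chart_normal b s h x \<bullet> i) \<partial>chart_measure b s h) =
    (\<integral>y. f (y + (s * h y) *\<^sub>R b) * ((grad h y - s *\<^sub>R b) \<bullet> i) \<partial>hyperplane_measure b)"
proof -
  have [measurable]: "h \<in> borel_measurable borel" "grad h \<in> borel_measurable borel"
    using Ck_on_1_UNIV(1,2)[OF h(1)] by (auto intro: borel_measurable_continuous_onI)
  note [measurable] = chart_normal_measurable[OF h(1)]
  have pos: "0 < sqrt (1 + (norm (grad h y))\<^sup>2)" for y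
    by (simp add: add_pos_nonneg)
  have "(\<integral>x. f x * (chart_normal b s h x \<bullet> i) \<partial>chart_measure b s h) =
    (\<integral>y. sqrt (1 + (norm (grad h y))\<^sup>2) *\<^sub>R
      (f (y + (s * h y) *\<^sub>R b) * (chart_normal b s h (y + (s * h y) *\<^sub>R b) \<bullet> i)) \<partial>hyperplane_measure b)"
    unfolding chart_measure_def
    by (subst integral_distr, measurable, subst integral_density) (use pos in \<open>auto intro!: AE_I2 less_imp_le\<close>)
  also have "\<dots> = (\<integral>y. f (y + (s * h y) *\<^sub>R b) * ((grad h y - s *\<^sub>R b) \<bullet> i) \<partial>hyperplane_measure b)"
  proof (rule Bochner_Integration.integral_cong[OF refl])
    fix y
    show "sqrt (1 + (norm (grad h y))\<^sup>2) *\<^sub>R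
      (f (y + (s * h y) *\<^sub>R b) * (chart_normal b s h (y + (s * h y) *\<^sub>R b) \<bullet> i)) =
      f (y + (s * h y) *\<^sub>R b) * ((grad h y - s *\<^sub>R b) \<bullet> i)"
      using pos[of y] by (simp add: chart_normal_def grad_shift[OF h(2)])
  qed
  finally show ?thesis .
qed

lemma flat_1_tendsto_1:
  assumes "c > 0" shows "(\<lambda>n. flat 1 (real n * c - 1)) \<longlonglongrightarrow> 1"
proof -
  have lim: "filterlim (\<lambda>n. real n * c - 1) at_top sequentially"
    using assms by real_asymp
  have "(\<lambda>n. exp (- (1 / (real n * c - 1)))) \<longlonglongrightarrow> exp (- 0)"
    by (intro tendsto_intros tendsto_divide_0[OF tendsto_const] filterlim_at_top_imp_at_infinity lim)
  moreover have "\<forall>\<^sub>F n in sequentially. exp (- (1 / (real n * c - 1))) = flat 1 (real n * c - 1)"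
    using filterlim_at_top_dense[THEN iffD1, OF lim, rule_format, of 0]
    by eventually_elim (simp add: flat_1)
  ultimately show ?thesis by (simp add: tendsto_cong)
qed

lemma flat_measurable[measurable]: "flat P \<in> borel_measurable borel"
  using flat_has_derivative[of P] DERIV_isCont
  by (intro borel_measurable_continuous_onI continuous_at_imp_continuous_on) blast

lemma flat_density_nonneg: "0 \<le> flat [:0, 0, 1:] t"
  by (simp add: flat_def)

lemma flat_1_deriv: "(flat 1 has_real_derivative flat [:0, 0, 1:] t) (at t)"
  using flat_has_derivative[of 1 t] by simp

text \<open>
  The density is the derivative of \<open>flat 1\<close>, which rises from 0 to 1.
\<close>

lemma has_bochner_integral_flat_density: "has_bochner_integral lborel (flat [:0, 0, 1:]) 1"
proof -
  have lim: "(flat 1 \<longlongrightarrow> 1) at_top"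
  proof -
    have "((\<lambda>t::real. exp (- (1 / t))) \<longlongrightarrow> exp (- 0)) at_top"
      by (intro tendsto_intros tendsto_divide_0[OF tendsto_const] filterlim_at_top_imp_at_infinity filterlim_ident)
    moreover have "\<forall>\<^sub>F t in at_top. exp (- (1 / t)) = flat 1 t"
      using eventually_gt_at_top[of 0] by eventually_elim (simp add: flat_1)
    ultimately show ?thesis by (simp add: tendsto_cong)
  qed
  have "(\<integral>\<^sup>+t. ennreal (flat [:0, 0, 1:] t) * indicator {0..} t \<partial>lborel) = ennreal (1 - flat 1 0)"
    by (rule nn_integral_FTC_atLeast[OF _ flat_1_deriv flat_density_nonneg lim]) simp
  moreover have "ennreal (flat [:0, 0, 1:] t) * indicator {0..} t = ennreal (flat [:0, 0, 1:] t)" for t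
    by (auto simp: flat_def split: split_indicator)
  ultimately have "(\<integral>\<^sup>+t. ennreal (flat [:0, 0, 1:] t) \<partial>lborel) = ennreal 1"
    by (simp add: flat_1)
  then show ?thesis
    by (intro has_bochner_integral_nn_integral) (auto simp: flat_density_nonneg)
qed

lemma integrable_vol_continuous:
  fixes f :: "'a::euclidean_space \<Rightarrow> real"
  assumes "open S" "bounded S" "continuous_on (closure S) f"
  shows "integrable (vol S) f"
proof -
  have "set_integrable lborel (closure S) f"
    unfolding set_integrable_def
    using assms by (intro borel_integrable_compact) (auto simp: compact_closure)
  then have "set_integrable lborel S f"
    by (rule set_integrable_subset) (use assms(1) closure_subset in auto)
  then show ?thesis using assms(1) by (simp add: integrable_restrict_space set_integrable_def)
qed

lemma norm_le_norm_add_orthogonal: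
  assumes "y \<bullet> b = 0" shows "norm y \<le> norm (y + t *\<^sub>R b)"
proof -
  have "(norm y)\<^sup>2 \<le> (norm (y + t *\<^sub>R b))\<^sup>2"
    using assms zero_le_mult_iff[of "t * t" "b \<bullet> b"]
    by (simp add: power2_norm_eq_inner inner_add_left inner_add_right inner_commute mult.assoc)
  then show ?thesis by (rule power2_le_imp_le) simp
qed

lemma borel_measurable_supported:
  fixes f :: "'a::euclidean_space \<Rightarrow> real"
  assumes "closed K" "continuous_on K f" "\<And>x. x \<notin> K \<Longrightarrow> f x = 0"
  shows "f \<in> borel_measurable borel"
proof -
  have "(\<lambda>x. indicator K x *\<^sub>R f x) \<in> borel_measurable borel"
    using assms by (intro borel_measurable_continuous_on_indicator) auto
  moreover have "indicator K x *\<^sub>R f x = f x" for x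
    using assms(3)[of x] by (cases "x \<in> K") auto
  ultimately show ?thesis by (simp only:)
qed

text \<open>
  Let \<open>F x = s (x \<bullet> b) - h x\<close>, so that inside the ball the domain is \<open>F > 0\<close>, and let
  \<open>N = - grad F\<close> be the unnormalized outward normal. Multiplying \<open>f\<close> by the cutoff
  \<open>flat 1 (n F - 1)\<close> makes it vanish near the boundary, so the integral of the derivative of the
  product is 0. When the derivative falls on \<open>f\<close>, the limit is the integral of \<open>D\<close> over the
  domain. When it falls on the cutoff, the result is a mollified surface integral: slicing by
  the height \<open>F\<close> and rescaling it by \<open>n\<close> concentrates the probability density \<open>e\<close> at the graph.
  The limit exists because \<open>f\<close> is continuous up to the boundary.
\<close>

lemma chart_gauss:
  fixes f :: "'a::euclidean_space \<Rightarrow> real"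
  assumes \<Omega>: "open \<Omega>" "bounded \<Omega>" and ch: "graph_chart 1 \<Omega> p r b s h"
    and f: "C1_upto \<Omega> f D" and K: "compact K" "K \<subseteq> ball p r" "K \<subseteq> closure \<Omega>"
    and f0: "\<And>x. x \<notin> K \<Longrightarrow> f x = 0" and i: "i \<in> Basis"
  shows "(\<integral>x. D x \<bullet> i \<partial>vol \<Omega>) = (\<integral>x. f x * (chart_normal b s h x \<bullet> i) \<partial>chart_measure b s h)"
proof -
  note C = graph_chartD[OF ch]
  have b: "b \<in> Basis" and ss: "s * s = 1" using C by blast+
  define N where "N x = grad h x - s *\<^sub>R b" for x
  define F where "F x = s * (x \<bullet> b) - h x" for x
  define e where "e = flat [:0, 0, 1:]"
  define P where "P y = y + (s * h y) *\<^sub>R b" for y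
  have hc: "continuous_on UNIV h" "continuous_on UNIV (grad h)" using Ck_on_1_UNIV[OF C(5)] by auto
  have Fc: "continuous_on UNIV F" unfolding F_def using hc by (intro continuous_intros)
  have Nc: "continuous_on UNIV N" unfolding N_def using hc by (intro continuous_intros)
  have [measurable]: "h \<in> borel_measurable borel" "N \<in> borel_measurable borel" "F \<in> borel_measurable borel"
    using hc Nc Fc by (auto intro: borel_measurable_continuous_onI)
  have [measurable]: "\<Omega> \<in> sets borel" using \<Omega> by simp
  have [measurable]: "e \<in> borel_measurable borel" unfolding e_def by simp
  have cl: "continuous_on (closure \<Omega>) f" "continuous_on (closure \<Omega>) D" using f by (auto simp: C1_upto_def)
  have fK: "continuous_on K f" using cl K by (auto intro: continuous_on_subset)
  have [measurable]: "f \<in> borel_measurable borel"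
    using K fK f0 by (intro borel_measurable_supported[of K]) (auto intro: compact_imp_closed)
  have FC1: "C1_upto \<Omega> F (\<lambda>x. - N x)"
    unfolding C1_upto_def
  proof (intro conjI ballI)
    fix x
    have "((\<lambda>x. s * (x \<bullet> b) - h x) has_derivative (\<lambda>v. s * (v \<bullet> b) - grad h x \<bullet> v)) (at x)"
      by (intro derivative_intros Ck_on_1_UNIV(3)[OF C(5)])
    then show "(F has_derivative (\<lambda>v. - N x \<bullet> v)) (at x)"
      unfolding F_def N_def
      by (rule has_derivative_eq_rhs) (simp add: fun_eq_iff inner_diff_left inner_diff_right inner_commute)
  qed (use Fc Nc in \<open>auto intro: continuous_on_subset continuous_on_minus\<close>)
  have ec: "continuous_on UNIV e"
    unfolding e_def using flat_has_derivative DERIV_isCont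
    by (intro continuous_at_imp_continuous_on) blast
  have integrable_X: "integrable (vol \<Omega>) (\<lambda>x. f x * (real n * e (real n * F x - 1)) * (N x \<bullet> i))" for n :: nat
    using cl Fc Nc
    by (intro integrable_vol_continuous \<Omega> continuous_intros continuous_on_compose2[OF ec])
      (auto intro: continuous_on_subset)
  have Nshift: "N (y + t *\<^sub>R b) = N y" for y t
    by (simp add: N_def grad_shift[OF C(6)])
  \<comment> \<open>In the shear coordinates the height variable is the value of \<open>F\<close>.\<close>
  have Fshift: "F (y + (s * (h y + \<tau>)) *\<^sub>R b) = \<tau>" if "y \<bullet> b = 0" for y \<tau>
  proof -
    have "F (y + (s * (h y + \<tau>)) *\<^sub>R b) = (s * s) * (h y + \<tau>) - h y"
      using that b C(6) by (simp add: F_def inner_add_left)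
    then show ?thesis by (simp add: ss)
  qed
  have approx: "(\<integral>x. flat 1 (real n * F x - 1) * (D x \<bullet> i) \<partial>vol \<Omega>) =
      (\<integral>x. f x * (real n * e (real n * F x - 1)) * (N x \<bullet> i) \<partial>vol \<Omega>)" if n: "n > 0" for n :: nat
  proof -
    define g where "g x = flat 1 (real n * F x - 1)" for x
    have d: "((\<lambda>t. flat 1 (real n * t - 1)) has_real_derivative real n * e (real n * t - 1)) (at t)" for t
      unfolding e_def
      by (rule DERIV_cong[OF DERIV_chain2[OF flat_1_deriv, of "\<lambda>t. real n * t - 1" "real n"]])
        (auto intro!: derivative_eq_intros)
    have dc: "continuous_on A (\<lambda>t. real n * e (real n * t - 1))" for A
      by (intro continuous_intros continuous_on_compose2[OF ec]) auto
    have g: "C1_upto \<Omega> g (\<lambda>x. (real n * e (real n * F x - 1)) *\<^sub>R - N x)"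
      unfolding g_def by (rule C1_upto_compose[OF FC1 d dc])
    \<comment> \<open>The product is supported in \<open>Kn\<close>, where \<open>F\<close> is at least \<open>1 / n\<close>: a compact
        subset of the domain.\<close>
    define Kn where "Kn = K \<inter> {x. 1 / real n \<le> F x}"
    have "closed {x. 1 / real n \<le> F x}"
      using continuous_closed_vimage[of "{1 / real n..}" F] Fc
      by (simp add: vimage_def continuous_on_eq_continuous_at)
    then have "compact Kn" using K(1) by (auto simp: Kn_def compact_Int_closed)
    moreover have "Kn \<subseteq> \<Omega>"
    proof
      fix x assume x: "x \<in> Kn"
      then have "0 < F x" using n by (auto simp: Kn_def intro: less_le_trans[of 0 "1 / real n"])
      then show "x \<in> \<Omega>" using x K(2) C(7)[of x] by (auto simp: Kn_def F_def)
    qed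
    moreover have "f x * g x = 0" if "x \<in> \<Omega> - Kn" for x
    proof (cases "x \<in> K")
      case True
      then have "F x < 1 / real n" using that by (auto simp: Kn_def)
      then have "real n * F x - 1 \<le> 0" using n by (simp add: field_simps)
      then show ?thesis by (simp add: g_def flat_1)
    qed (simp add: f0)
    ultimately have "(\<integral>x. (f x *\<^sub>R ((real n * e (real n * F x - 1)) *\<^sub>R - N x) + g x *\<^sub>R D x) \<bullet> i \<partial>vol \<Omega>) = 0"
      by (intro integral_partial_interior_support[OF \<Omega>(1) C1_upto_mult[OF f g] _ _ _ i])
    then have zero: "(\<integral>x. (f x *\<^sub>R ((real n * e (real n * F x - 1)) *\<^sub>R - N x) + g x *\<^sub>R D x) \<bullet> i \<partial>vol \<Omega>) = 0" .
    have int1: "integrable (vol \<Omega>) (\<lambda>x. f x * (real n * e (real n * F x - 1)) * (N x \<bullet> i))"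
      by (rule integrable_X)
    have int2: "integrable (vol \<Omega>) (\<lambda>x. g x * (D x \<bullet> i))"
      using cl g by (intro integrable_vol_continuous \<Omega> continuous_intros) (auto simp: C1_upto_def)
    have "(f x *\<^sub>R ((real n * e (real n * F x - 1)) *\<^sub>R - N x) + g x *\<^sub>R D x) \<bullet> i =
        g x * (D x \<bullet> i) - f x * (real n * e (real n * F x - 1)) * (N x \<bullet> i)" for x
      by (simp add: inner_diff_left)
    with zero have "(\<integral>x. g x * (D x \<bullet> i) - f x * (real n * e (real n * F x - 1)) * (N x \<bullet> i) \<partial>vol \<Omega>) = 0"
      by (simp only:)
    with int1 int2 show ?thesis by (simp add: g_def)
  qed
  have lim1: "(\<lambda>n. \<integral>x. flat 1 (real n * F x - 1) * (D x \<bullet> i) \<partial>vol \<Omega>) \<longlonglongrightarrow> (\<integral>x. D x \<bullet> i \<partial>vol \<Omega>)"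
  proof (rule integral_dominated_convergence[where w="\<lambda>x. \<bar>D x \<bullet> i\<bar>"])
    have Di: "integrable (vol \<Omega>) (\<lambda>x. D x \<bullet> i)"
      using cl by (intro integrable_vol_continuous \<Omega> continuous_intros)
    then show "integrable (vol \<Omega>) (\<lambda>x. \<bar>D x \<bullet> i\<bar>)" by (rule integrable_abs)
    show [measurable]: "(\<lambda>x. D x \<bullet> i) \<in> borel_measurable (vol \<Omega>)"
      using Di by (rule borel_measurable_integrable)
    have [measurable]: "F \<in> borel_measurable (vol \<Omega>)"
      by (rule measurable_restrict_space1) (simp add: \<open>F \<in> borel_measurable borel\<close>)
    show "(\<lambda>x. flat 1 (real n * F x - 1) * (D x \<bullet> i)) \<in> borel_measurable (vol \<Omega>)" for n
      by measurable
    show "AE x in vol \<Omega>. norm (flat 1 (real n * F x - 1) * (D x \<bullet> i)) \<le> \<bar>D x \<bullet> i\<bar>" for n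
    proof (intro AE_I2)
      fix x
      have "\<bar>flat 1 (real n * F x - 1)\<bar> \<le> 1" by (simp add: flat_1)
      then show "norm (flat 1 (real n * F x - 1) * (D x \<bullet> i)) \<le> \<bar>D x \<bullet> i\<bar>"
        by (simp add: abs_mult mult_left_le_one_le)
    qed
    show "AE x in vol \<Omega>. (\<lambda>n. flat 1 (real n * F x - 1) * (D x \<bullet> i)) \<longlonglongrightarrow> D x \<bullet> i"
    proof (intro AE_I2)
      fix x assume "x \<in> space (vol \<Omega>)"
      then have x: "x \<in> \<Omega>" by (simp add: space_restrict_space)
      show "(\<lambda>n. flat 1 (real n * F x - 1) * (D x \<bullet> i)) \<longlonglongrightarrow> D x \<bullet> i"
      proof (cases "x \<in> K")
        case True
        then have "0 < F x" using C(7)[of x] K(2) x by (auto simp: F_def)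
        then show ?thesis using tendsto_mult[OF flat_1_tendsto_1 tendsto_const] by fastforce
      next
        case False
        have "D x = 0"
        proof (rule gradient_zero_where_locally_zero)
          show "(f has_derivative (\<lambda>v. D x \<bullet> v)) (at x)" using f x by (auto simp: C1_upto_def)
          show "open (\<Omega> - K)" "x \<in> \<Omega> - K" using \<Omega> K x False by (auto simp: compact_imp_closed)
        qed (simp add: f0)
        then show ?thesis by simp
      qed
    qed
  qed
  obtain R where R: "\<And>x. x \<in> K \<Longrightarrow> norm x \<le> R"
    using compact_imp_bounded[OF K(1)] by (auto simp: bounded_iff)
  obtain M where M: "M \<ge> 0" "\<And>x. \<bar>f x\<bar> \<le> M"
  proof -
    obtain M where "\<And>x. x \<in> K \<Longrightarrow> \<bar>f x\<bar> \<le> M" using continuous_bounded_on_compact[OF K(1) fK] by blast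
    then have "\<bar>f x\<bar> \<le> \<bar>M\<bar>" for x using f0[of x] by (cases "x \<in> K") force+
    then show ?thesis using that[of "\<bar>M\<bar>"] by simp
  qed
  obtain L where L: "L \<ge> 0" "\<And>y. norm y \<le> R \<Longrightarrow> \<bar>N y \<bullet> i\<bar> \<le> L"
  proof -
    have "continuous_on (cball 0 R) (\<lambda>y. N y \<bullet> i)"
      using Nc by (intro continuous_intros) (auto intro: continuous_on_subset)
    then obtain L where "\<And>y. y \<in> cball 0 R \<Longrightarrow> \<bar>N y \<bullet> i\<bar> \<le> L"
      using continuous_bounded_on_compact[OF compact_cball] by blast
    then have "\<bar>N y \<bullet> i\<bar> \<le> \<bar>L\<bar>" if "norm y \<le> R" for y using that by force
    then show ?thesis using that[of "\<bar>L\<bar>"] by simp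
  qed
  have e_int: "integrable lborel e" "integral\<^sup>L lborel e = 1"
    using has_bochner_integral_flat_density by (auto simp: e_def has_bochner_integral_iff)
  have e_nn: "0 \<le> e t" for t by (simp add: e_def flat_density_nonneg)
  \<comment> \<open>The point over \<open>y\<close> at which \<open>n F - 1\<close> has the value \<open>\<sigma>\<close>.\<close>
  define q where "q n y \<sigma> = y + (s * (h y + (1 + \<sigma>) / real n)) *\<^sub>R b" for n :: nat and y \<sigma>
  define \<Phi> where "\<Phi> n y \<sigma> = indicator \<Omega> (q n y \<sigma>) * f (q n y \<sigma>) * e \<sigma> * (N y \<bullet> i)" for n y \<sigma>
  have \<Phi>meas: "(\<lambda>(y, \<sigma>). \<Phi> n y \<sigma>) \<in> borel_measurable (hyperplane_measure b \<Otimes>\<^sub>M lborel)" for n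
    unfolding \<Phi>_def q_def by measurable
  have orth: "norm y \<le> R" if "y \<bullet> b = 0" "f (y + t *\<^sub>R b) \<noteq> 0" for y t
    using norm_le_norm_add_orthogonal[OF that(1), of t] R[of "y + t *\<^sub>R b"] f0 that(2) by force
  have \<Phi>bound: "\<bar>\<Phi> n y \<sigma>\<bar> \<le> (M * L * indicator {y. norm y \<le> R} y) * e \<sigma>" if y: "y \<bullet> b = 0" for n y \<sigma>
  proof (cases "f (q n y \<sigma>) = 0")
    case True
    then show ?thesis using M L e_nn by (simp add: \<Phi>_def)
  next
    case False
    then have y': "norm y \<le> R" using orth[OF y] by (simp add: q_def)
    have "\<bar>\<Phi> n y \<sigma>\<bar> = (indicator \<Omega> (q n y \<sigma>) * \<bar>f (q n y \<sigma>)\<bar>) * e \<sigma> * \<bar>N y \<bullet> i\<bar>"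
      using e_nn by (simp add: \<Phi>_def abs_mult)
    also have "\<dots> \<le> (1 * M) * e \<sigma> * L"
      using M L(1) L(2)[OF y'] e_nn by (intro mult_mono mult_nonneg_nonneg) auto
    finally show ?thesis using y' by (simp add: mult_ac)
  qed
  \<comment> \<open>The factor \<open>n\<close> is absorbed by the substitution \<open>\<tau> = (1 + \<sigma>) / n\<close>.\<close>
  have slice: "(\<integral>x. f x * (real n * e (real n * F x - 1)) * (N x \<bullet> i) \<partial>vol \<Omega>) =
      (\<integral>y. (\<integral>\<sigma>. \<Phi> n y \<sigma> \<partial>lborel) \<partial>hyperplane_measure b)" if n: "n > 0" for n :: nat
  proof -
    interpret H: sigma_finite_measure "hyperplane_measure b" by (rule sigma_finite_hyperplane_measure)
    interpret PS: pair_sigma_finite "hyperplane_measure b" "lborel :: real measure" ..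
    define W where "W x = indicator \<Omega> x * (f x * (real n * e (real n * F x - 1)) * (N x \<bullet> i))" for x
    have [measurable]: "W \<in> borel_measurable borel" unfolding W_def by measurable
    note sh = lborel_eq_shear[OF b C(3) \<open>h \<in> borel_measurable borel\<close>]
    have "integrable lborel W"
      using integrable_X[of n] \<Omega>(1) by (simp add: integrable_restrict_space W_def[abs_def])
    then have int: "integrable (hyperplane_measure b \<Otimes>\<^sub>M lborel) (\<lambda>(y, \<tau>). W (y + (s * (h y + \<tau>)) *\<^sub>R b))"
      unfolding sh[symmetric] by (subst (asm) integrable_distr_eq) (auto simp: split_beta')
    have "(\<integral>x. f x * (real n * e (real n * F x - 1)) * (N x \<bullet> i) \<partial>vol \<Omega>) = (\<integral>x. W x \<partial>lborel)"
      using \<Omega>(1) by (simp add: integral_restrict_space W_def)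
    also have "\<dots> = (\<integral>(y, \<tau>). W (y + (s * (h y + \<tau>)) *\<^sub>R b) \<partial>(hyperplane_measure b \<Otimes>\<^sub>M lborel))"
      by (subst sh[symmetric], subst integral_distr) (auto simp: split_beta')
    also have "\<dots> = (\<integral>y. (\<integral>\<tau>. W (y + (s * (h y + \<tau>)) *\<^sub>R b) \<partial>lborel) \<partial>hyperplane_measure b)"
      using PS.integral_fst[OF int] by simp
    also have "\<dots> = (\<integral>y. (\<integral>\<sigma>. \<Phi> n y \<sigma> \<partial>lborel) \<partial>hyperplane_measure b)"
    proof (rule integral_cong_AE)
      show "AE y in hyperplane_measure b. (\<integral>\<tau>. W (y + (s * (h y + \<tau>)) *\<^sub>R b) \<partial>lborel) = (\<integral>\<sigma>. \<Phi> n y \<sigma> \<partial>lborel)"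
        using AE_hyperplane_measure[OF b]
      proof eventually_elim
        case (elim y)
        have W: "W (y + (s * (h y + (1 / real n + 1 / real n * \<sigma>))) *\<^sub>R b) = real n * \<Phi> n y \<sigma>" for \<sigma>
        proof -
          have t: "1 / real n + 1 / real n * \<sigma> = (1 + \<sigma>) / real n" by (simp add: add_divide_distrib)
          have "F (q n y \<sigma>) = (1 + \<sigma>) / real n" "N (q n y \<sigma>) = N y"
            by (simp_all add: q_def Fshift[OF elim] Nshift)
          then show ?thesis
            unfolding t q_def[symmetric] W_def \<Phi>_def using n by simp
        qed
        have "(\<integral>\<tau>. W (y + (s * (h y + \<tau>)) *\<^sub>R b) \<partial>lborel) =
            \<bar>1 / real n\<bar> *\<^sub>R (\<integral>\<sigma>. W (y + (s * (h y + (1 / real n + 1 / real n * \<sigma>))) *\<^sub>R b) \<partial>lborel)"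
          using n by (intro lborel_integral_real_affine) auto
        also have "\<dots> = (\<integral>\<sigma>. \<Phi> n y \<sigma> \<partial>lborel)"
          unfolding W using n by simp
        finally show ?case .
      qed
    qed (use \<Phi>meas in \<open>auto intro!: lborel.borel_measurable_lebesgue_integral simp: split_beta'\<close>)
    finally show ?thesis .
  qed
  have lim\<Phi>: "(\<lambda>n. \<integral>\<sigma>. \<Phi> n y \<sigma> \<partial>lborel) \<longlonglongrightarrow> f (P y) * (N y \<bullet> i)" if y: "y \<bullet> b = 0" for y
  proof -
    have "(\<lambda>n. \<integral>\<sigma>. \<Phi> n y \<sigma> \<partial>lborel) \<longlonglongrightarrow> (\<integral>\<sigma>. f (P y) * (N y \<bullet> i) * e \<sigma> \<partial>lborel)"
    proof (rule integral_dominated_convergence)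
      show "integrable lborel (\<lambda>\<sigma>. (M * L * indicator {y. norm y \<le> R} y) * e \<sigma>)"
        using e_int by simp
      show "\<Phi> n y \<in> borel_measurable lborel" for n
        unfolding \<Phi>_def q_def by measurable
      show "AE \<sigma> in lborel. (\<lambda>n. \<Phi> n y \<sigma>) \<longlonglongrightarrow> f (P y) * (N y \<bullet> i) * e \<sigma>"
      proof (intro AE_I2)
        fix \<sigma> :: real
        show "(\<lambda>n. \<Phi> n y \<sigma>) \<longlonglongrightarrow> f (P y) * (N y \<bullet> i) * e \<sigma>"
        proof (cases "\<sigma> > 0")
          case False
          then show ?thesis by (simp add: \<Phi>_def e_def flat_def)
        next
          case True
          have "(\<lambda>n. y + (s * (h y + (1 + \<sigma>) * inverse (real n))) *\<^sub>R b) \<longlonglongrightarrow> y + (s * (h y + (1 + \<sigma>) * 0)) *\<^sub>R b"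
            by (intro tendsto_intros tendsto_inverse_0_at_top filterlim_real_sequentially)
          then have qlim: "(\<lambda>n. q n y \<sigma>) \<longlonglongrightarrow> P y" by (simp add: q_def P_def divide_inverse)
          have Fq: "F (q n y \<sigma>) > 0" if "n > 0" for n
          proof -
            have "F (q n y \<sigma>) = (1 + \<sigma>) / real n"
              unfolding q_def by (rule Fshift[OF y])
            then show ?thesis using that True by simp
          qed
          \<comment> \<open>The points approach the graph from inside, where \<open>f\<close> is continuous up
              to the boundary.\<close>
          have "(\<lambda>n. indicator \<Omega> (q n y \<sigma>) * f (q n y \<sigma>)) \<longlonglongrightarrow> f (P y)"
          proof (cases "P y \<in> K")
            case False
            have "\<forall>\<^sub>F n in sequentially. q n y \<sigma> \<in> - K"
              using qlim False K(1) by (intro topological_tendstoD) (auto simp: compact_imp_closed open_Compl)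
            then have "\<forall>\<^sub>F n in sequentially. indicator \<Omega> (q n y \<sigma>) * f (q n y \<sigma>) = 0"
              by eventually_elim (simp add: f0)
            then show ?thesis using f0[OF False] by (simp add: tendsto_eventually)
          next
            case True
            have "\<forall>\<^sub>F n in sequentially. q n y \<sigma> \<in> ball p r"
              using qlim True K(2) by (intro topological_tendstoD) auto
            then have ev: "\<forall>\<^sub>F n in sequentially. q n y \<sigma> \<in> \<Omega>"
              using eventually_gt_at_top[of 0]
            proof eventually_elim
              case (elim n)
              then show ?case using C(7)[of "q n y \<sigma>"] Fq[of n] by (auto simp: F_def)
            qed
            then have "\<forall>\<^sub>F n in sequentially. q n y \<sigma> \<in> closure \<Omega>"
              by eventually_elim (use closure_subset in blast)
            then have "(\<lambda>n. f (q n y \<sigma>)) \<longlonglongrightarrow> f (P y)"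
              using continuous_on_tendsto_compose[OF cl(1) qlim] True K(3) by blast
            moreover have "\<forall>\<^sub>F n in sequentially. f (q n y \<sigma>) = indicator \<Omega> (q n y \<sigma>) * f (q n y \<sigma>)"
              using ev by eventually_elim simp
            ultimately show ?thesis by (rule Lim_transform_eventually)
          qed
          from tendsto_mult[OF this tendsto_const, of "e \<sigma> * (N y \<bullet> i)"]
          show ?thesis by (simp add: \<Phi>_def mult_ac)
        qed
      qed
      show "AE \<sigma> in lborel. norm (\<Phi> n y \<sigma>) \<le> (M * L * indicator {y. norm y \<le> R} y) * e \<sigma>" for n
        using \<Phi>bound[OF y] by simp
    qed simp
    then show ?thesis using e_int by simp
  qed
  have lim2: "(\<lambda>n. \<integral>x. f x * (real n * e (real n * F x - 1)) * (N x \<bullet> i) \<partial>vol \<Omega>) \<longlonglongrightarrow>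
      (\<integral>y. f (P y) * (N y \<bullet> i) \<partial>hyperplane_measure b)"
  proof -
    have "(\<lambda>n. \<integral>y. (\<integral>\<sigma>. \<Phi> n y \<sigma> \<partial>lborel) \<partial>hyperplane_measure b) \<longlonglongrightarrow>
        (\<integral>y. f (P y) * (N y \<bullet> i) \<partial>hyperplane_measure b)"
    proof (rule integral_dominated_convergence)
      show "integrable (hyperplane_measure b) (\<lambda>y. M * L * indicator {y. norm y \<le> R} y)"
        using emeasure_hyperplane_bounded[OF b, of R] by (intro integrable_mult_right integrable_real_indicator) auto
      show "(\<lambda>y. \<integral>\<sigma>. \<Phi> n y \<sigma> \<partial>lborel) \<in> borel_measurable (hyperplane_measure b)" for n
        using \<Phi>meas by (rule lborel.borel_measurable_lebesgue_integral)
      show "AE y in hyperplane_measure b. (\<lambda>n. \<integral>\<sigma>. \<Phi> n y \<sigma> \<partial>lborel) \<longlonglongrightarrow> f (P y) * (N y \<bullet> i)"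
        using AE_hyperplane_measure[OF b] by eventually_elim (rule lim\<Phi>)
      show "AE y in hyperplane_measure b. norm (\<integral>\<sigma>. \<Phi> n y \<sigma> \<partial>lborel) \<le> M * L * indicator {y. norm y \<le> R} y" for n
        using AE_hyperplane_measure[OF b]
      proof eventually_elim
        case (elim y)
        have "norm (\<integral>\<sigma>. \<Phi> n y \<sigma> \<partial>lborel) \<le> (\<integral>\<sigma>. (M * L * indicator {y. norm y \<le> R} y) * e \<sigma> \<partial>lborel)"
        proof (rule Bochner_Integration.integral_norm_bound_integral)
          show int: "integrable lborel (\<lambda>\<sigma>. (M * L * indicator {y. norm y \<le> R} y) * e \<sigma>)"
            using e_int by simp
          have "\<Phi> n y \<in> borel_measurable lborel"
            unfolding \<Phi>_def q_def by measurable
          then show "integrable lborel (\<Phi> n y)"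
            using \<Phi>bound[OF elim] by (intro Bochner_Integration.integrable_bound[OF int]) (auto intro!: AE_I2 order_trans[OF _ abs_ge_self])
          show "norm (\<Phi> n y \<sigma>) \<le> (M * L * indicator {y. norm y \<le> R} y) * e \<sigma>" for \<sigma>
            using \<Phi>bound[OF elim] by simp
        qed
        then show ?case using e_int by simp
      qed
      show "(\<lambda>y. f (P y) * (N y \<bullet> i)) \<in> borel_measurable (hyperplane_measure b)"
        unfolding P_def by measurable
    qed
    moreover have "\<forall>\<^sub>F n in sequentially. (\<integral>y. (\<integral>\<sigma>. \<Phi> n y \<sigma> \<partial>lborel) \<partial>hyperplane_measure b) =
        (\<integral>x. f x * (real n * e (real n * F x - 1)) * (N x \<bullet> i) \<partial>vol \<Omega>)"
      using eventually_gt_at_top[of 0] by eventually_elim (simp add: slice)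
    ultimately show ?thesis by (rule Lim_transform_eventually)
  qed
  have "\<forall>\<^sub>F n in sequentially. (\<integral>x. flat 1 (real n * F x - 1) * (D x \<bullet> i) \<partial>vol \<Omega>) =
      (\<integral>x. f x * (real n * e (real n * F x - 1)) * (N x \<bullet> i) \<partial>vol \<Omega>)"
    using eventually_gt_at_top[of 0] by eventually_elim (rule approx)
  with lim1 have "(\<lambda>n. \<integral>x. f x * (real n * e (real n * F x - 1)) * (N x \<bullet> i) \<partial>vol \<Omega>) \<longlonglongrightarrow> (\<integral>x. D x \<bullet> i \<partial>vol \<Omega>)"
    by (rule Lim_transform_eventually)
  from LIMSEQ_unique[OF this lim2] show ?thesis
    unfolding P_def N_def by (subst integral_chart_measure) (use C in auto)
qed

section \<open>The outward normal\<close>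

lemma grad_orthogonal:
  assumes "Ck_on 1 UNIV h" "\<And>x t. h (x + t *\<^sub>R b) = h x"
  shows "grad h x \<bullet> b = 0"
proof -
  have "((\<lambda>t. x + t *\<^sub>R b) has_derivative (\<lambda>t. t *\<^sub>R b)) (at 0)"
    by (auto intro!: derivative_eq_intros)
  moreover have "(h has_derivative (\<lambda>v. grad h x \<bullet> v)) (at (x + 0 *\<^sub>R b))"
    using Ck_on_1_UNIV(3)[OF assms(1)] by simp
  ultimately have "((\<lambda>t. h (x + t *\<^sub>R b)) has_derivative (\<lambda>t. grad h x \<bullet> (t *\<^sub>R b))) (at 0)"
    by (rule has_derivative_compose)
  then have "((\<lambda>t. h x) has_derivative (\<lambda>t::real. grad h x \<bullet> (t *\<^sub>R b))) (at 0)"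
    using assms(2) by simp
  from has_derivative_unique[OF this has_derivative_const] have "grad h x \<bullet> (1 *\<^sub>R b) = 0" by metis
  then show ?thesis by simp
qed

text \<open>
  \<open>grad h\<close> is orthogonal to \<open>b\<close>.
\<close>

lemma norm_graph_normal:
  assumes "graph_chart 1 \<Omega> p r b s h"
  shows "norm (grad h x - s *\<^sub>R b) = sqrt (1 + (norm (grad h x))\<^sup>2)"
proof -
  note C = graph_chartD[OF assms]
  have 1: "grad h x \<bullet> b = 0" using grad_orthogonal[OF C(5,6)] .
  have "(norm (grad h x - s *\<^sub>R b))\<^sup>2 = 1 + (norm (grad h x))\<^sup>2"
    using 1 C(2,4) by (simp add: power2_norm_eq_inner inner_diff_left inner_diff_right inner_commute)
  then show ?thesis by (metis norm_ge_zero real_sqrt_unique)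
qed

lemma norm_chart_normal:
  assumes "graph_chart 1 \<Omega> p r b s h" shows "norm (chart_normal b s h x) = 1"
proof -
  have "0 < sqrt (1 + (norm (grad h x))\<^sup>2)" by (simp add: add_pos_nonneg)
  then show ?thesis by (simp add: chart_normal_def norm_graph_normal[OF assms])
qed

lemma graph_chart_recenter:
  assumes "graph_chart k \<Omega> p r b s h" "q \<in> ball p r"
  shows "graph_chart k \<Omega> q (r - dist p q) b s h"
proof -
  have "ball q (r - dist p q) \<subseteq> ball p r"
    by (auto simp: dist_commute) (metis add.commute dist_commute dist_triangle_lt less_diff_eq)
  moreover have "\<Omega> \<inter> ball q (r - dist p q) = {x \<in> ball q (r - dist p q). h x < s * (x \<bullet> b)}"
  proof -
    have "\<Omega> \<inter> ball p r = {x \<in> ball p r. h x < s * (x \<bullet> b)}"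
      using assms(1) unfolding graph_chart_def by blast
    with calculation show ?thesis by blast
  qed
  moreover have "0 < r - dist p q" using assms(2) by simp
  ultimately show ?thesis using assms(1) unfolding graph_chart_def by blast
qed

text \<open>
  A point of the graph is approached from inside along \<open>s b\<close>; a point strictly on the wrong side
  of the graph has a neighbourhood that avoids the domain.
\<close>

lemma frontier_in_chart:
  assumes "open \<Omega>" and ch: "graph_chart 1 \<Omega> p r b s h" and x: "x \<in> ball p r"
  shows "x \<in> frontier \<Omega> \<longleftrightarrow> h x = s * (x \<bullet> b)"
proof -
  note C = graph_chartD[OF ch]
  have fr: "frontier \<Omega> = closure \<Omega> - \<Omega>" using assms(1) by (simp add: frontier_def interior_open)
  have hc: "continuous_on UNIV h" using Ck_on_1_UNIV(1)[OF C(5)] .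
  show ?thesis
  proof
    assume "x \<in> frontier \<Omega>"
    then have 1: "x \<in> closure \<Omega>" "x \<notin> \<Omega>" using fr by auto
    then have "h x \<ge> s * (x \<bullet> b)" using C(7)[OF x] by simp
    moreover have "\<not> h x > s * (x \<bullet> b)"
    proof
      assume a: "h x > s * (x \<bullet> b)"
      let ?U = "ball p r \<inter> {x. s * (x \<bullet> b) < h x}"
      have "open ?U" using hc by (intro open_Int open_Collect_less continuous_intros) auto
      moreover have "?U \<inter> \<Omega> = {}" using C(7) by force
      moreover have "x \<in> ?U" using a x by simp
      ultimately show False using 1 open_Int_closure_eq_empty[of ?U \<Omega>] by blast
    qed
    ultimately show "h x = s * (x \<bullet> b)" by simp
  next
    assume eq: "h x = s * (x \<bullet> b)"
    then have "x \<notin> \<Omega>" using C(7)[OF x] by simp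
    moreover have "x \<in> closure \<Omega>"
    proof (rule closure_sequential[THEN iffD2], intro exI conjI allI)
      define d where "d = (r - dist p x) / 2"
      have d: "d > 0" "d + dist p x < r" using x by (auto simp: d_def field_simps)
      define y where "y n = x + (s * (d * inverse (real (Suc n)))) *\<^sub>R b" for n
      have "(\<lambda>n. y n) \<longlonglongrightarrow> x + (s * (d * 0)) *\<^sub>R b"
        unfolding y_def by (intro tendsto_intros LIMSEQ_inverse_real_of_nat)
      then show "y \<longlonglongrightarrow> x" by simp
      fix n
      have pos: "0 < d * inverse (real (Suc n))" using d by simp
      have le: "d * inverse (real (Suc n)) \<le> d" using d by (simp add: field_simps)
      have "dist x (y n) = \<bar>s\<bar> * (d * inverse (real (Suc n)))"
        using C(2) pos d(1) by (simp add: y_def dist_norm abs_mult)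
      then have "dist x (y n) \<le> d" using le C(3) by auto
      then have "y n \<in> ball p r" using dist_triangle[of p "y n" x] d by simp
      moreover have "s * (y n \<bullet> b) = s * (x \<bullet> b) + s * s * (d * inverse (real (Suc n)))"
        using C(2) by (simp add: y_def inner_add_left distrib_left)
      ultimately show "y n \<in> \<Omega>" using C(7)[of "y n"] pos eq C(4,6) by (simp add: y_def)
    qed
    ultimately show "x \<in> frontier \<Omega>" using fr by simp
  qed
qed

text \<open>
  If the unit normals \<open>u\<close> and \<open>u'\<close> were different, then \<open>w = u' - u\<close> would have
  \<open>u \<bullet> w < 0 < u' \<bullet> w\<close>. Starting from \<open>q\<close> in the direction \<open>w\<close> one would enter the domain
  according to the first chart and leave it according to the second.
\<close>

lemma chart_normal_unique:
  assumes "open \<Omega>" and ch: "graph_chart 1 \<Omega> p r b s h" "graph_chart 1 \<Omega> p' r' b' s' h'"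
    and q: "q \<in> ball p r" "q \<in> ball p' r'" "q \<in> frontier \<Omega>"
  shows "chart_normal b s h q = chart_normal b' s' h' q"
proof (rule ccontr)
  define u where "u = chart_normal b s h q"
  define u' where "u' = chart_normal b' s' h' q"
  assume "chart_normal b s h q \<noteq> chart_normal b' s' h' q"
  then have ne: "u \<noteq> u'" by (simp add: u_def u'_def)
  have n1: "u \<bullet> u = 1" "u' \<bullet> u' = 1"
    using norm_chart_normal[OF ch(1), of q] norm_chart_normal[OF ch(2), of q]
    by (simp_all add: u_def u'_def norm_eq_1)
  have "0 < (u - u') \<bullet> (u - u')" using ne by simp
  then have lt: "u \<bullet> u' < 1" using n1 by (simp add: inner_diff_left inner_diff_right inner_commute)
  define w where "w = u' - u"
  have w: "u \<bullet> w < 0" "u' \<bullet> w > 0" using lt n1 by (auto simp: w_def inner_diff_right inner_commute)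
  have slope: "((\<lambda>t. h (q + t *\<^sub>R w) - s * ((q + t *\<^sub>R w) \<bullet> b)) has_real_derivative
      sqrt (1 + (norm (grad h q))\<^sup>2) * (chart_normal b s h q \<bullet> w)) (at 0)"
    if ch: "graph_chart 1 \<Omega> p r b s h" for p r b s h
  proof -
    have "((\<lambda>t. q + t *\<^sub>R w) has_derivative (\<lambda>t. t *\<^sub>R w)) (at 0)"
      by (auto intro!: derivative_eq_intros)
    moreover have "(h has_derivative (\<lambda>v. grad h q \<bullet> v)) (at (q + 0 *\<^sub>R w))"
      using Ck_on_1_UNIV(3)[OF graph_chartD(5)[OF ch]] by simp
    ultimately have "((\<lambda>t. h (q + t *\<^sub>R w)) has_derivative (\<lambda>t. grad h q \<bullet> (t *\<^sub>R w))) (at 0)"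
      by (rule has_derivative_compose)
    then have d: "((\<lambda>t. h (q + t *\<^sub>R w)) has_real_derivative grad h q \<bullet> w) (at 0)"
      unfolding has_field_derivative_def by (rule has_derivative_eq_rhs) (simp add: fun_eq_iff)
    have pos: "0 < sqrt (1 + (norm (grad h q))\<^sup>2)" by (simp add: add_pos_nonneg)
    show ?thesis
    proof (rule DERIV_cong[OF DERIV_diff[OF d DERIV_cmult]])
      have "((\<lambda>t. (q \<bullet> b) + t * (w \<bullet> b)) has_real_derivative w \<bullet> b) (at 0)"
        by (auto intro!: derivative_eq_intros)
      then show "((\<lambda>t. (q + t *\<^sub>R w) \<bullet> b) has_real_derivative w \<bullet> b) (at 0)"
        by (simp add: inner_add_left)
      show "grad h q \<bullet> w - s * (w \<bullet> b) = sqrt (1 + (norm (grad h q))\<^sup>2) * (chart_normal b s h q \<bullet> w)"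
        using pos by (simp add: chart_normal_def inner_diff_left inner_diff_right inner_commute)
    qed
  qed
  have pos: "0 < sqrt (1 + (norm x)\<^sup>2)" for x :: 'a by (simp add: add_pos_nonneg)
  have "sqrt (1 + (norm (grad h q))\<^sup>2) * (chart_normal b s h q \<bullet> w) < 0"
    using w pos mult_less_0_iff unfolding u_def by blast
  from DERIV_neg_dec_right[OF slope[OF ch(1)] this]
  obtain d where d: "d > 0" "\<And>t. 0 < t \<Longrightarrow> t < d \<Longrightarrow>
      h (q + t *\<^sub>R w) - s * ((q + t *\<^sub>R w) \<bullet> b) < h q - s * (q \<bullet> b)" by auto
  have "0 < sqrt (1 + (norm (grad h' q))\<^sup>2) * (chart_normal b' s' h' q \<bullet> w)"
    using w pos zero_less_mult_iff unfolding u'_def by blast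
  from DERIV_pos_inc_right[OF slope[OF ch(2)] this]
  obtain d' where d': "d' > 0" "\<And>t. 0 < t \<Longrightarrow> t < d' \<Longrightarrow>
      h' q - s' * (q \<bullet> b') < h' (q + t *\<^sub>R w) - s' * ((q + t *\<^sub>R w) \<bullet> b')" by auto
  have "open (ball p r \<inter> ball p' r')" by auto
  then obtain \<epsilon> where \<epsilon>: "\<epsilon> > 0" "ball q \<epsilon> \<subseteq> ball p r \<inter> ball p' r'"
    using q open_contains_ball by blast
  have wn: "norm w > 0" using w by auto
  define t where "t = min (min d d') (\<epsilon> / norm w) / 2"
  have t: "0 < t" "t < d" "t < d'" "t * norm w < \<epsilon>"
  proof -
    define m where "m = min (min d d') (\<epsilon> / norm w)"
    have m: "0 < m" "m \<le> d" "m \<le> d'" "m \<le> \<epsilon> / norm w"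
      using d(1) d'(1) \<epsilon>(1) wn by (simp_all add: m_def)
    have tm: "t = m / 2" by (simp add: t_def m_def)
    show "0 < t" using m tm by simp
    show "t < d" using m tm by simp
    show "t < d'" using m tm by simp
    have "t < \<epsilon> / norm w" using m tm by simp
    then show "t * norm w < \<epsilon>" using wn by (simp add: pos_less_divide_eq)
  qed
  then have "q + t *\<^sub>R w \<in> ball q \<epsilon>" by (simp add: dist_norm)
  then have in2: "q + t *\<^sub>R w \<in> ball p r" "q + t *\<^sub>R w \<in> ball p' r'" using \<epsilon> by auto
  have "h q = s * (q \<bullet> b)" "h' q = s' * (q \<bullet> b')"
    using frontier_in_chart[OF assms(1)] ch q by blast+
  then have "h (q + t *\<^sub>R w) < s * ((q + t *\<^sub>R w) \<bullet> b)" "h' (q + t *\<^sub>R w) > s' * ((q + t *\<^sub>R w) \<bullet> b')"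
    using d(2)[of t] d'(2)[of t] t by simp_all
  then show False
    using graph_chartD(7)[OF ch(1) in2(1)] graph_chartD(7)[OF ch(2) in2(2)] by simp
qed

text \<open>
  This is what makes the definite description of the outward normal meaningful: charts centred
  at \<open>q\<close> exist by recentring, and all of them give the same vector.
\<close>

lemma outward_normal_chart:
  assumes "open \<Omega>" and ch: "graph_chart 1 \<Omega> p r b s h" and q: "q \<in> ball p r" "q \<in> frontier \<Omega>"
  shows "outward_normal \<Omega> q = chart_normal b s h q"
  unfolding outward_normal_def
proof (rule the_equality)
  show "\<exists>r b' s' h'. graph_chart 1 \<Omega> q r b' s' h' \<and> chart_normal b s h q =
      (1 / sqrt (1 + (norm (grad h' q))\<^sup>2)) *\<^sub>R (grad h' q - s' *\<^sub>R b')"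
    using graph_chart_recenter[OF ch q(1)] unfolding chart_normal_def by blast
next
  fix n assume "\<exists>r b' s' h'. graph_chart 1 \<Omega> q r b' s' h' \<and> n =
      (1 / sqrt (1 + (norm (grad h' q))\<^sup>2)) *\<^sub>R (grad h' q - s' *\<^sub>R b')"
  then obtain r' b' s' h' where c: "graph_chart 1 \<Omega> q r' b' s' h'" and n: "n = chart_normal b' s' h' q"
    unfolding chart_normal_def by blast
  have "q \<in> ball q r'" using graph_chartD(1)[OF c] by simp
  then show "n = chart_normal b s h q"
    unfolding n using chart_normal_unique[OF assms(1) c ch] q by blast
qed

lemma Ck_boundary_mono: "Ck_boundary k \<Omega> \<Longrightarrow> j \<le> k \<Longrightarrow> Ck_boundary j \<Omega>"
  unfolding Ck_boundary_def graph_chart_def by (meson Ck_on_mono)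

lemma continuous_outward_normal:
  assumes "open \<Omega>" "Ck_boundary 1 \<Omega>"
  shows "continuous_on (frontier \<Omega>) (outward_normal \<Omega>)"
  unfolding continuous_on_eq_continuous_within
proof
  fix q assume q: "q \<in> frontier \<Omega>"
  then obtain r b s h where ch: "graph_chart 1 \<Omega> q r b s h" using assms(2) unfolding Ck_boundary_def by blast
  note C = graph_chartD[OF ch]
  have "continuous (at q within frontier \<Omega>) (chart_normal b s h)"
    using continuous_chart_normal[OF C(5)] continuous_on_subset[of UNIV _ "frontier \<Omega>"] q
    unfolding continuous_on_eq_continuous_within by blast
  then show "continuous (at q within frontier \<Omega>) (outward_normal \<Omega>)"
  proof (rule continuous_transform_within[OF _ C(1) q])
    fix x assume "x \<in> frontier \<Omega>" "dist x q < r"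
    then show "chart_normal b s h x = outward_normal \<Omega> x"
      by (intro outward_normal_chart[OF assms(1) ch, symmetric]) (auto simp: dist_commute)
  qed
qed

section \<open>The surface measure\<close>

lemma AE_chart_measure_graph:
  assumes ch: "graph_chart 1 \<Omega> p r b s h"
  shows "AE x in chart_measure b s h. h x = s * (x \<bullet> b)"
proof -
  note C = graph_chartD[OF ch]
  have [measurable]: "h \<in> borel_measurable borel" "grad h \<in> borel_measurable borel"
    using Ck_on_1_UNIV(1,2)[OF C(5)] by (auto intro: borel_measurable_continuous_onI)
  have "AE y in hyperplane_measure b. h (y + (s * h y) *\<^sub>R b) = s * ((y + (s * h y) *\<^sub>R b) \<bullet> b)"
    using AE_hyperplane_measure[OF C(2)]
  proof eventually_elim
    case (elim y)
    then show ?case using C(2,4,6) by (simp add: inner_add_left flip: mult.assoc)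
  qed
  then show ?thesis
    unfolding chart_measure_def by (subst AE_distr_iff) (auto simp: AE_density)
qed

lemma emeasure_chart_measure:
  assumes "Ck_on 1 UNIV h" and [measurable]: "E \<in> sets borel"
  shows "emeasure (chart_measure b s h) E =
    (\<integral>\<^sup>+y. ennreal (sqrt (1 + (norm (grad h y))\<^sup>2)) * indicator E (y + (s * h y) *\<^sub>R b) \<partial>hyperplane_measure b)"
proof -
  have [measurable]: "h \<in> borel_measurable borel" "grad h \<in> borel_measurable borel"
    using Ck_on_1_UNIV(1,2)[OF assms(1)] by (auto intro: borel_measurable_continuous_onI)
  have "(\<lambda>y. y + (s * h y) *\<^sub>R b) \<in> borel_measurable borel" by measurable
  from measurable_sets_borel[OF this assms(2)]
  have [measurable]: "(\<lambda>y. y + (s * h y) *\<^sub>R b) -` E \<in> sets borel" by simp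
  show ?thesis unfolding chart_measure_def
    by (subst emeasure_distr, simp_all, subst emeasure_density) (auto simp: indicator_def intro!: nn_integral_cong)
qed

lemma emeasure_chart_measure_bounded:
  assumes ch: "graph_chart 1 \<Omega> p r b s h" and A: "bounded A" "A \<in> sets borel"
  shows "emeasure (chart_measure b s h) A < \<infinity>"
proof -
  note C = graph_chartD[OF ch]
  obtain R where R: "\<And>x. x \<in> A \<Longrightarrow> norm x \<le> R" using A(1) by (auto simp: bounded_iff)
  define J where "J y = sqrt (1 + (norm (grad h y))\<^sup>2)" for y
  have "continuous_on UNIV J" unfolding J_def using Ck_on_1_UNIV(2)[OF C(5)] by (intro continuous_intros)
  then have "continuous_on (cball 0 R) J" by (rule continuous_on_subset) simp
  then obtain L where "\<And>y. y \<in> cball 0 R \<Longrightarrow> \<bar>J y\<bar> \<le> L"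
    using continuous_bounded_on_compact[OF compact_cball] by blast
  then have L: "J y \<le> \<bar>L\<bar>" if "norm y \<le> R" for y using that by force
  have "emeasure (chart_measure b s h) A \<le> (\<integral>\<^sup>+y. ennreal \<bar>L\<bar> * indicator {y. norm y \<le> R} y \<partial>hyperplane_measure b)"
    unfolding emeasure_chart_measure[OF C(5) A(2)]
  proof (rule nn_integral_mono_AE)
    show "AE y in hyperplane_measure b. ennreal (sqrt (1 + (norm (grad h y))\<^sup>2)) * indicator A (y + (s * h y) *\<^sub>R b)
        \<le> ennreal \<bar>L\<bar> * indicator {y. norm y \<le> R} y"
      using AE_hyperplane_measure[OF C(2)]
    proof eventually_elim
      case (elim y)
      show ?case
      proof (cases "y + (s * h y) *\<^sub>R b \<in> A")
        case True
        then have "norm y \<le> R" using norm_le_norm_add_orthogonal[OF elim, of "s * h y"] R by force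
        then show ?thesis using True L[of y] by (simp add: J_def ennreal_leI)
      qed simp
    qed
  qed
  also have "\<dots> < \<infinity>"
    using emeasure_hyperplane_bounded[OF C(2), of R]
    by (subst nn_integral_cmult_indicator) (auto simp: ennreal_mult_less_top)
  finally show ?thesis .
qed

text \<open>
  A measurable subset of the union splits into countably many disjoint pieces, each inside one
  member.
\<close>

lemma measures_agree_on_countable_union:
  assumes sets: "sets M = sets N" and F: "countable F" "F \<subseteq> sets M"
    and eq: "\<And>Q E. Q \<in> F \<Longrightarrow> E \<in> sets M \<Longrightarrow> E \<subseteq> Q \<Longrightarrow> emeasure M E = emeasure N E"
    and E: "E \<in> sets M" "E \<subseteq> \<Union>F"
  shows "emeasure M E = emeasure N E"
proof (cases "F = {}")
  case True
  then show ?thesis using E by simp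
next
  case False
  define A where "A = from_nat_into F"
  have AF: "A n \<in> F" for n using False by (simp add: A_def from_nat_into)
  have rA: "range A = F" using range_from_nat_into[OF False F(1)] by (simp add: A_def)
  have dm: "disjointed A n \<in> sets M" for n
    using AF F(2) sets.range_disjointed_sets[of A M] by blast
  define G where "G n = E \<inter> disjointed A n" for n
  have G: "range G \<subseteq> sets M" "disjoint_family G" "(\<Union>n. G n) = E"
  proof -
    show "range G \<subseteq> sets M" using dm E by (auto simp: G_def)
    show "disjoint_family G"
      using disjoint_family_disjointed[of A] unfolding G_def disjoint_family_on_def by blast
    have "(\<Union>n. G n) = E \<inter> (\<Union>n. disjointed A n)" by (auto simp: G_def)
    also have "\<dots> = E" using E(2) rA by (auto simp: UN_disjointed_eq)
    finally show "(\<Union>n. G n) = E" .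
  qed
  have "emeasure M (G n) = emeasure N (G n)" for n
    using G(1) disjointed_subset[of A n] by (intro eq[OF AF[of n]]) (auto simp: G_def)
  then have "(\<Sum>n. emeasure M (G n)) = (\<Sum>n. emeasure N (G n))" by simp
  then show ?thesis
    using suminf_emeasure[OF G(1,2)] suminf_emeasure[of G N] G sets by simp
qed

text \<open>
  Both charts describe the same domain, so Gauss's theorem in either of them expresses the same
  volume integral. Taken in the direction \<open>b\<close> of the first chart and with test functions that
  approximate indicators of boxes, it shows that the two chart measures, weighted with the same
  component of the normal, agree on boxes. That component is nowhere zero on the graph of the
  first chart, so the weight can be removed. This replaces a direct comparison of the two
  parametrizations.
\<close>

lemma chart_measures_agree_on_box:
  fixes \<Omega> :: "'a::euclidean_space set"
  assumes \<Omega>: "open \<Omega>" "bounded \<Omega>"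
    and ch: "graph_chart 1 \<Omega> p r b s h" "graph_chart 1 \<Omega> p' r' b' s' h'"
    and uv: "cbox u v \<subseteq> ball p r \<inter> ball p' r'"
    and E: "E \<in> sets borel" "E \<subseteq> frontier \<Omega> \<inter> box u v"
  shows "emeasure (chart_measure b s h) E = emeasure (chart_measure b' s' h') E"
proof -
  note C = graph_chartD[OF ch(1)] and C' = graph_chartD[OF ch(2)]
  let ?M = "chart_measure b s h" and ?M' = "chart_measure b' s' h'"
  \<comment> \<open>The reciprocal of the area element, since \<open>grad h\<close> is orthogonal to \<open>b\<close>; in
      particular positive.\<close>
  define \<kappa> where "\<kappa> x = - s * (chart_normal b s h x \<bullet> b)" for x
  have sq: "0 < sqrt (1 + (norm (grad h x))\<^sup>2)" for x by (simp add: add_pos_nonneg)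
  have \<kappa>: "\<kappa> x = 1 / sqrt (1 + (norm (grad h x))\<^sup>2)" for x
    using grad_orthogonal[OF C(5,6)] C(2,4) by (simp add: \<kappa>_def chart_normal_def inner_diff_left)
  have \<kappa>pos: "0 < \<kappa> x" for x unfolding \<kappa> using sq by simp
  have \<kappa>le: "\<kappa> x \<le> 1" for x unfolding \<kappa> using sq[of x] by (simp add: pos_divide_le_eq)
  have [measurable]: "chart_normal b s h \<in> borel_measurable borel" "chart_normal b' s' h' \<in> borel_measurable borel"
    using chart_normal_measurable C(5) C'(5) by auto
  have [measurable]: "\<kappa> \<in> borel_measurable borel" unfolding \<kappa>_def[abs_def] by measurable
  have [measurable]: "frontier \<Omega> \<in> sets borel" "closure \<Omega> \<in> sets borel" by auto
  have ub: "box u v \<subseteq> ball p r" "box u v \<subseteq> ball p' r'" using uv box_subset_cbox by blast+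
  have key: "(\<integral>x. indicator (frontier \<Omega> \<inter> box w z) x * \<kappa> x \<partial>?M) =
      (\<integral>x. indicator (frontier \<Omega> \<inter> box w z) x * \<kappa> x \<partial>?M')"
    if wz: "cbox w z \<subseteq> cbox u v" for w z
  proof -
    \<comment> \<open>Cutting off outside the closure gives a function with compact support in the
        closure, without affecting differentiability inside.\<close>
    define \<psi> where "\<psi> n x = box_bump w z n x * indicator (closure \<Omega>) x" for n x
    define D where "D n = grad (box_bump w z n)" for n
    have bm: "box_bump w z n \<in> borel_measurable borel" for n
      using C1_upto_smooth[OF smooth_box_bump, of UNIV w z n]
      by (intro borel_measurable_continuous_onI) (auto simp: C1_upto_def)
    have \<psi>C1: "C1_upto \<Omega> (\<psi> n) (D n)" for n
      unfolding D_def by (rule C1_upto_cong[OF \<Omega>(1) C1_upto_smooth[OF smooth_box_bump]]) (simp add: \<psi>_def)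
    have K: "compact (cbox w z \<inter> closure \<Omega>)" by (intro compact_Int_closed) auto
    have \<psi>0: "\<psi> n x = 0" if "x \<notin> cbox w z \<inter> closure \<Omega>" for n x
      using that box_bump_nonzero_iff[of w z n x] box_subset_cbox[of w z] by (auto simp: \<psi>_def)
    have lim: "(\<lambda>n. \<integral>x. \<psi> n x * (chart_normal c t k x \<bullet> b) \<partial>chart_measure c t k) \<longlonglongrightarrow>
        (\<integral>x. - s * (indicator (frontier \<Omega> \<inter> box w z) x * \<kappa> x) \<partial>chart_measure c t k)"
      if ch2: "graph_chart 1 \<Omega> P R c t k" and sub: "cbox w z \<subseteq> ball P R" for P R c t k
    proof (rule integral_dominated_convergence)
      have [measurable]: "chart_normal c t k \<in> borel_measurable borel"
        using chart_normal_measurable graph_chartD(5)[OF ch2] .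
      show "(\<lambda>x. - s * (indicator (frontier \<Omega> \<inter> box w z) x * \<kappa> x)) \<in> borel_measurable (chart_measure c t k)"
        by measurable
      show "(\<lambda>x. \<psi> n x * (chart_normal c t k x \<bullet> b)) \<in> borel_measurable (chart_measure c t k)" for n
        using bm[of n] unfolding \<psi>_def by measurable
      show "integrable (chart_measure c t k) (indicator (cbox w z) :: 'a \<Rightarrow> real)"
        using emeasure_chart_measure_bounded[OF ch2, of "cbox w z"] by (intro integrable_real_indicator) auto
      show "AE x in chart_measure c t k. norm (\<psi> n x * (chart_normal c t k x \<bullet> b)) \<le> indicator (cbox w z) x" for n
      proof (intro AE_I2)
        fix x
        have "\<bar>chart_normal c t k x \<bullet> b\<bar> \<le> 1"
          using Basis_le_norm[OF C(2), of "chart_normal c t k x"] norm_chart_normal[OF ch2] by simp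
        moreover have "\<bar>\<psi> n x\<bar> \<le> 1"
          using box_bump_range[of w z n x] by (auto simp: \<psi>_def abs_mult split: split_indicator)
        ultimately have "\<bar>\<psi> n x * (chart_normal c t k x \<bullet> b)\<bar> \<le> 1"
          unfolding abs_mult by (rule mult_le_one[rotated 2]) simp
        then show "norm (\<psi> n x * (chart_normal c t k x \<bullet> b)) \<le> indicator (cbox w z) x"
          using \<psi>0[of x n] by (cases "x \<in> cbox w z") auto
      qed
      show "AE x in chart_measure c t k. (\<lambda>n. \<psi> n x * (chart_normal c t k x \<bullet> b)) \<longlonglongrightarrow>
          - s * (indicator (frontier \<Omega> \<inter> box w z) x * \<kappa> x)"
        using AE_chart_measure_graph[OF ch2]
      proof eventually_elim
        case (elim x)
        have l: "(\<lambda>n. \<psi> n x * (chart_normal c t k x \<bullet> b)) \<longlonglongrightarrow>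
          (indicator (box w z) x * indicator (closure \<Omega>) x) * (chart_normal c t k x \<bullet> b)"
          unfolding \<psi>_def by (intro tendsto_mult box_bump_tendsto tendsto_const)
        moreover have "(indicator (box w z) x * indicator (closure \<Omega>) x) * (chart_normal c t k x \<bullet> b) =
          - s * (indicator (frontier \<Omega> \<inter> box w z) x * \<kappa> x)"
        proof (cases "x \<in> box w z")
          case False
          then show ?thesis by simp
        next
          case True
          then have x: "x \<in> ball P R" "x \<in> ball p r" using sub wz uv box_subset_cbox by blast+
          then have fr: "x \<in> frontier \<Omega>" using frontier_in_chart[OF \<Omega>(1) ch2] elim by simp
          then have "x \<in> closure \<Omega>" by (simp add: frontier_def)
          moreover have "chart_normal c t k x = chart_normal b s h x"
            using chart_normal_unique[OF \<Omega>(1) ch2 ch(1) x fr] .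
          moreover have "- s * \<kappa> x = chart_normal b s h x \<bullet> b"
            using C(4) by (simp add: \<kappa>_def flip: mult.assoc)
          ultimately show ?thesis using True fr by simp
        qed
        ultimately show ?case by simp
      qed
    qed
    have g: "(\<integral>x. \<psi> n x * (chart_normal c t k x \<bullet> b) \<partial>chart_measure c t k) = (\<integral>x. D n x \<bullet> b \<partial>vol \<Omega>)"
      if ch2: "graph_chart 1 \<Omega> P R c t k" and sub: "cbox w z \<subseteq> ball P R" for n P R c t k
    proof (rule chart_gauss[OF \<Omega> ch2 \<psi>C1 K _ _ \<psi>0 C(2), symmetric])
      show "cbox w z \<inter> closure \<Omega> \<subseteq> ball P R" using sub by blast
    qed auto
    have "(\<integral>x. - s * (indicator (frontier \<Omega> \<inter> box w z) x * \<kappa> x) \<partial>?M) =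
        (\<integral>x. - s * (indicator (frontier \<Omega> \<inter> box w z) x * \<kappa> x) \<partial>?M')"
    proof -
      have sub: "cbox w z \<subseteq> ball p r" "cbox w z \<subseteq> ball p' r'" using wz uv by blast+
      show ?thesis
        using LIMSEQ_unique[OF lim[OF ch(1) sub(1), unfolded g[OF ch(1) sub(1)]]
            lim[OF ch(2) sub(2), unfolded g[OF ch(2) sub(2)]]] .
    qed
    moreover have "s \<noteq> 0" using C(4) by auto
    ultimately show ?thesis by simp
  qed
  define w where "w x = ennreal (indicator (frontier \<Omega> \<inter> box u v) x * \<kappa> x)" for x
  have [measurable]: "w \<in> borel_measurable borel" unfolding w_def by measurable
  have emw: "emeasure (density (chart_measure c t k) w) X =
      ennreal (\<integral>x. indicator (frontier \<Omega> \<inter> (box u v \<inter> X)) x * \<kappa> x \<partial>chart_measure c t k)"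
    if ch2: "graph_chart 1 \<Omega> P R c t k" and X: "X \<in> sets borel" for P R c t k X
  proof -
    have "emeasure (density (chart_measure c t k) w) X = 
      (\<integral>\<^sup>+x. ennreal (indicator (frontier \<Omega> \<inter> (box u v \<inter> X)) x * \<kappa> x) \<partial>chart_measure c t k)"
      using X by (subst emeasure_density) (auto simp: w_def intro!: nn_integral_cong split: split_indicator)
    also have "\<dots> = ennreal (\<integral>x. indicator (frontier \<Omega> \<inter> (box u v \<inter> X)) x * \<kappa> x \<partial>chart_measure c t k)"
    proof (rule nn_integral_eq_integral)
      have i1: "integrable (chart_measure c t k) (indicator (cbox u v) :: 'a \<Rightarrow> real)"
        using emeasure_chart_measure_bounded[OF ch2, of "cbox u v"] by (intro integrable_real_indicator) auto
      show "integrable (chart_measure c t k) (\<lambda>x. indicator (frontier \<Omega> \<inter> (box u v \<inter> X)) x * \<kappa> x)"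
        by (rule Bochner_Integration.integrable_bound[OF i1])
          (use X \<kappa>le \<kappa>pos box_subset_cbox[of u v] in \<open>auto simp: less_imp_le split: split_indicator\<close>)
    qed (simp add: \<kappa>pos less_imp_le)
    finally show ?thesis .
  qed
  have "density ?M w = density ?M' w"
  proof (rule measure_eqI_boxes)
    show "emeasure (density ?M w) (box a b) \<noteq> \<infinity>" for a b
      by (simp add: emw[OF ch(1)])
    fix a b :: 'a
    obtain w' z' where wz: "box u v \<inter> box a b = box w' z'" "cbox w' z' \<subseteq> cbox u v" using box_Int_subbox by blast
    show "emeasure (density ?M w) (box a b) = emeasure (density ?M' w) (box a b)"
      using key[OF wz(2)] by (simp add: emw[OF ch(1)] emw[OF ch(2)] wz(1))
  qed simp_all
  moreover have "emeasure (chart_measure c t k) E = (\<integral>\<^sup>+x. ennreal (1 / \<kappa> x) * indicator E x \<partial>density (chart_measure c t k) w)"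
    for c t k
  proof -
    have "(\<integral>\<^sup>+x. ennreal (1 / \<kappa> x) * indicator E x \<partial>density (chart_measure c t k) w) =
        (\<integral>\<^sup>+x. w x * (ennreal (1 / \<kappa> x) * indicator E x) \<partial>chart_measure c t k)"
      using E by (subst nn_integral_density) auto
    also have "\<dots> = (\<integral>\<^sup>+x. indicator E x \<partial>chart_measure c t k)"
    proof (rule nn_integral_cong)
      fix x
      show "w x * (ennreal (1 / \<kappa> x) * indicator E x) = indicator E x"
      proof (cases "x \<in> E")
        case True
        then have "x \<in> frontier \<Omega> \<inter> box u v" using E(2) by blast
        then show ?thesis using \<kappa>pos[of x] True by (simp add: w_def flip: ennreal_mult')
      qed simp
    qed
    finally show ?thesis using E by simp
  qed
  ultimately show ?thesis by simp
qed

lemma chart_measures_agree: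
  fixes \<Omega> :: "'a::euclidean_space set"
  assumes \<Omega>: "open \<Omega>" "bounded \<Omega>"
    and ch: "graph_chart 1 \<Omega> p r b s h" "graph_chart 1 \<Omega> p' r' b' s' h'"
    and E: "E \<in> sets borel" "E \<subseteq> frontier \<Omega> \<inter> ball p r \<inter> ball p' r'"
  shows "emeasure (chart_measure b s h) E = emeasure (chart_measure b' s' h') E"
proof -
  let ?U = "ball p r \<inter> ball p' r'"
  have "open ?U" by auto
  then obtain F' where F': "countable F'" "\<Union>F' = ?U" "\<And>Q. Q \<in> F' \<Longrightarrow> \<exists>u v. Q = box u v \<and> cbox u v \<subseteq> ?U"
    using countable_box_cover by metis
  let ?G = "(\<lambda>Q. frontier \<Omega> \<inter> Q) ` F'"
  show ?thesis
  proof (rule measures_agree_on_countable_union[of _ _ ?G])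
    show "countable ?G" using F' by simp
    show "?G \<subseteq> sets (chart_measure b s h)" using F'(3) by force
    show "E \<subseteq> \<Union>?G" using E F'(2) by auto
    fix Q E' assume "Q \<in> ?G" "E' \<in> sets (chart_measure b s h)" "E' \<subseteq> Q"
    then obtain u v where "cbox u v \<subseteq> ?U" "E' \<subseteq> frontier \<Omega> \<inter> box u v" "E' \<in> sets borel"
    proof -
      assume *: "\<And>u v. cbox u v \<subseteq> ?U \<Longrightarrow> E' \<subseteq> frontier \<Omega> \<inter> box u v \<Longrightarrow> E' \<in> sets borel \<Longrightarrow> thesis"
      obtain Q' where Q': "Q = frontier \<Omega> \<inter> Q'" "Q' \<in> F'" using \<open>Q \<in> ?G\<close> by blast
      obtain u v where "Q' = box u v" "cbox u v \<subseteq> ?U" using F'(3)[OF Q'(2)] by blast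
      then show thesis using * Q'(1) \<open>E' \<subseteq> Q\<close> \<open>E' \<in> sets (chart_measure b s h)\<close> by simp
    qed
    then show "emeasure (chart_measure b s h) E' = emeasure (chart_measure b' s' h') E'"
      by (intro chart_measures_agree_on_box[OF \<Omega> ch])
  qed (use E in auto)
qed

lemma finite_chart_cover:
  fixes \<Omega> :: "'a::euclidean_space set"
  assumes \<Omega>: "bounded \<Omega>" "Ck_boundary 1 \<Omega>"
  obtains r b s h X where "\<And>q. q \<in> frontier \<Omega> \<Longrightarrow> graph_chart 1 \<Omega> q (r q) (b q) (s q) (h q)"
    and "X \<subseteq> frontier \<Omega>" "finite X" "frontier \<Omega> \<subseteq> (\<Union>q\<in>X. ball q (r q))"
proof -
  have "\<forall>q\<in>frontier \<Omega>. \<exists>r b s h. graph_chart 1 \<Omega> q r b s h" using \<Omega>(2) by (simp add: Ck_boundary_def)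
  then obtain r b s h where ch: "\<And>q. q \<in> frontier \<Omega> \<Longrightarrow> graph_chart 1 \<Omega> q (r q) (b q) (s q) (h q)" by metis
  have "compact (frontier \<Omega>)" using \<Omega>(1) by (rule compact_frontier_bounded)
  moreover have "frontier \<Omega> \<subseteq> (\<Union>q\<in>frontier \<Omega>. ball q (r q))"
    using graph_chartD(1)[OF ch] by force
  ultimately obtain X where X: "X \<subseteq> frontier \<Omega>" "finite X" "frontier \<Omega> \<subseteq> (\<Union>q\<in>X. ball q (r q))"
    using compactE_image[of "frontier \<Omega>" "frontier \<Omega>" "\<lambda>q. ball q (r q)"] by (metis open_ball)
  with ch show ?thesis by (rule that)
qed

text \<open>
  Finitely many charts cover the boundary; cutting it into disjoint Borel pieces, one for each
  chart, and adding up the chart measures of the pieces defines a measure. It is compatible with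
  every chart because chart measures agree on overlaps.
\<close>

lemma surface_measure_exists:
  fixes \<Omega> :: "'a::euclidean_space set"
  assumes \<Omega>: "open \<Omega>" "bounded \<Omega>" "Ck_boundary 1 \<Omega>"
  shows "\<exists>S. sets S = sets borel \<and> finite_measure S \<and>
    (\<forall>p r b s h E. graph_chart 1 \<Omega> p r b s h \<longrightarrow> E \<in> sets borel \<longrightarrow> E \<subseteq> frontier \<Omega> \<inter> ball p r \<longrightarrow>
      emeasure S E = emeasure (chart_measure b s h) E)"
proof -
  obtain r b s h X where ch: "\<And>q. q \<in> frontier \<Omega> \<Longrightarrow> graph_chart 1 \<Omega> q (r q) (b q) (s q) (h q)"
    and X: "X \<subseteq> frontier \<Omega>" "finite X" "frontier \<Omega> \<subseteq> (\<Union>q\<in>X. ball q (r q))"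
    using finite_chart_cover[OF \<Omega>(2,3)] by metis
  obtain xs where xs: "set xs = X" using X(2) finite_list by blast
  define A where "A k = (if k < length xs then frontier \<Omega> \<inter> ball (xs ! k) (r (xs ! k)) else {})" for k
  define M where "M k = chart_measure (b (xs ! k)) (s (xs ! k)) (h (xs ! k))" for k
  have M: "sets (M k) = sets borel" for k by (simp add: M_def)
  \<comment> \<open>Disjoint pieces, each inside the ball of its chart.\<close>
  define D where "D = disjointed A"
  have chk: "graph_chart 1 \<Omega> (xs ! k) (r (xs ! k)) (b (xs ! k)) (s (xs ! k)) (h (xs ! k))" if "k < length xs" for k
    using that xs X(1) by (intro ch) auto
  have "range A \<subseteq> sets borel" by (auto simp: A_def)
  then have Dm: "D k \<in> sets borel" for k
    using sets.range_disjointed_sets[of A borel] unfolding D_def by blast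
  have DA: "D k \<subseteq> A k" for k unfolding D_def by (rule disjointed_subset)
  have UD: "(\<Union>k<length xs. D k) = frontier \<Omega>"
  proof -
    have "k < length xs" if "x \<in> D k" for k x using DA[of k] that by (auto simp: A_def split: if_splits)
    then have "(\<Union>k<length xs. D k) = (\<Union>k. D k)" by blast
    also have "\<dots> = (\<Union>k. A k)" unfolding D_def by (rule UN_disjointed_eq)
    also have "\<dots> = (\<Union>k<length xs. frontier \<Omega> \<inter> ball (xs ! k) (r (xs ! k)))" by (auto simp: A_def split: if_splits)
    also have "\<dots> = frontier \<Omega>" using X(3) xs by (fastforce simp: in_set_conv_nth)
    finally show ?thesis .
  qed
  define \<mu> where "\<mu> E = (\<Sum>k<length xs. emeasure (M k) (E \<inter> D k))" for E
  define S where "S = measure_of UNIV (sets borel) \<mu>"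
  have sets_S: "sets S = sets borel"
    using sets.sigma_sets_eq[of "borel :: 'a measure"] by (simp add: S_def sets_measure_of_conv)
  have emS: "emeasure S E = \<mu> E" if "E \<in> sets borel" for E
    unfolding S_def
  proof (rule emeasure_measure_of_sigma)
    show "sigma_algebra UNIV (sets borel :: 'a set set)"
      using sets.sigma_algebra_axioms[of "borel :: 'a measure"] by simp
    show "positive (sets borel) \<mu>" by (simp add: positive_def \<mu>_def)
    show "countably_additive (sets borel) \<mu>"
    proof (rule countably_additiveI)
      fix F :: "nat \<Rightarrow> 'a set" assume F: "range F \<subseteq> sets borel" "disjoint_family F"
      have "(\<Sum>i. emeasure (M k) (F i \<inter> D k)) = emeasure (M k) ((\<Union>i. F i) \<inter> D k)" for k
      proof -
        have "range (\<lambda>i. F i \<inter> D k) \<subseteq> sets (M k)" using F(1) Dm[of k] by (auto simp: M)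
        moreover have "disjoint_family (\<lambda>i. F i \<inter> D k)" using F(2) by (auto simp: disjoint_family_on_def)
        ultimately show ?thesis by (subst suminf_emeasure) auto
      qed
      then show "(\<Sum>i. \<mu> (F i)) = \<mu> (\<Union>i. F i)"
        unfolding \<mu>_def by (subst suminf_sum) auto
    qed
  qed (use that in simp)
  have "emeasure S E = emeasure (chart_measure b' s' h') E"
    if c: "graph_chart 1 \<Omega> p' r' b' s' h'" and E: "E \<in> sets borel" "E \<subseteq> frontier \<Omega> \<inter> ball p' r'" for p' r' b' s' h' E
  proof -
    have "emeasure S E = (\<Sum>k<length xs. emeasure (chart_measure b' s' h') (E \<inter> D k))"
      unfolding emS[OF E(1)] \<mu>_def
    proof (rule sum.cong[OF refl])
      fix k assume k: "k \<in> {..<length xs}"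
      show "emeasure (M k) (E \<inter> D k) = emeasure (chart_measure b' s' h') (E \<inter> D k)"
        unfolding M_def using E Dm[of k] DA[of k] k
        by (intro chart_measures_agree[OF \<Omega>(1,2) chk c]) (auto simp: A_def)
    qed
    also have "\<dots> = emeasure (chart_measure b' s' h') (\<Union>k<length xs. E \<inter> D k)"
    proof (rule sum_emeasure)
      show "(\<lambda>k. E \<inter> D k) ` {..<length xs} \<subseteq> sets (chart_measure b' s' h')" using E Dm by auto
      show "disjoint_family_on (\<lambda>k. E \<inter> D k) {..<length xs}"
        using disjoint_family_disjointed[of A] unfolding D_def disjoint_family_on_def by blast
    qed simp
    also have "(\<Union>k<length xs. E \<inter> D k) = E" using UD E(2) by auto
    finally show ?thesis .
  qed
  moreover have "finite_measure S"
  proof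
    have "emeasure (M k) (UNIV \<inter> D k) < \<infinity>" if "k < length xs" for k
    proof -
      have "bounded (UNIV \<inter> D k)" using DA[of k] that
        by (auto simp: A_def intro: bounded_subset[OF bounded_ball])
      then show ?thesis
        unfolding M_def using Dm by (intro emeasure_chart_measure_bounded[OF chk[OF that]]) auto
    qed
    then have "\<mu> UNIV < \<infinity>" unfolding \<mu>_def by (simp add: less_top)
    moreover have "space S = UNIV" by (simp add: S_def space_measure_of_conv)
    ultimately show "emeasure S (space S) \<noteq> \<infinity>" by (simp add: emS)
  qed
  ultimately show ?thesis using sets_S by blast
qed

text \<open>
  The chart formulas determine a measure on the boundary, because finitely many charts cover it.
  So the definite description of the surface measure denotes the restriction to the boundary of
  any measure that satisfies them.
\<close>

lemma surface_measure_characterization: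
  fixes \<Omega> :: "'a::euclidean_space set"
  assumes \<Omega>: "open \<Omega>" "bounded \<Omega>" "Ck_boundary 1 \<Omega>"
    and S: "sets S = sets borel"
      "\<And>p r b s h E. graph_chart 1 \<Omega> p r b s h \<Longrightarrow> E \<in> sets borel \<Longrightarrow> E \<subseteq> frontier \<Omega> \<inter> ball p r \<Longrightarrow>
        emeasure S E = emeasure (chart_measure b s h) E"
  shows "surface_measure \<Omega> = restrict_space S (frontier \<Omega>)"
proof -
  let ?P = "\<lambda>\<sigma>. sets \<sigma> = sets (restrict_space borel (frontier \<Omega>)) \<and>
        (\<forall>p\<in>frontier \<Omega>. \<forall>r b s h. graph_chart 1 \<Omega> p r b s h \<longrightarrow>
          (\<forall>E\<in>sets \<sigma>. E \<subseteq> ball p r \<longrightarrow>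
             emeasure \<sigma> E =
               (\<integral>\<^sup>+y. ennreal (sqrt (1 + (norm (grad h y))\<^sup>2)) *
                     indicator E (y + (s * h y) *\<^sub>R b) \<partial>hyperplane_measure b)))"
  have fr[measurable]: "frontier \<Omega> \<in> sets borel" by simp
  have setsR: "E \<in> sets (restrict_space borel (frontier \<Omega>)) \<longleftrightarrow> E \<in> sets borel \<and> E \<subseteq> frontier \<Omega>" for E
    by (subst sets_restrict_space_iff) auto
  let ?R = "restrict_space S (frontier \<Omega>)"
  have R1: "sets ?R = sets (restrict_space borel (frontier \<Omega>))"
    using S(1) by (rule sets_restrict_space_cong)
  have R2: "emeasure ?R E = emeasure S E" if "E \<in> sets borel" "E \<subseteq> frontier \<Omega>" for E
    using that S(1) by (intro emeasure_restrict_space) auto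
  have PR: "?P ?R"
  proof (intro conjI R1 ballI allI impI)
    fix p r b s h E assume p: "p \<in> frontier \<Omega>" and c: "graph_chart 1 \<Omega> p r b s h" and E: "E \<in> sets ?R" "E \<subseteq> ball p r"
    then have E': "E \<in> sets borel" "E \<subseteq> frontier \<Omega>" using R1 setsR by auto
    then show "emeasure ?R E = (\<integral>\<^sup>+y. ennreal (sqrt (1 + (norm (grad h y))\<^sup>2)) *
                     indicator E (y + (s * h y) *\<^sub>R b) \<partial>hyperplane_measure b)"
      using S(2)[OF c E'(1)] E(2) emeasure_chart_measure[OF graph_chartD(5)[OF c] E'(1)] by (simp add: R2)
  qed
  have uniq: "\<sigma> = ?R" if P: "?P \<sigma>" for \<sigma>
  proof (rule measure_eqI)
    show s: "sets \<sigma> = sets ?R" using P R1 by simp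
    fix E assume E: "E \<in> sets \<sigma>"
    obtain r b s h X where ch: "\<And>q. q \<in> frontier \<Omega> \<Longrightarrow> graph_chart 1 \<Omega> q (r q) (b q) (s q) (h q)"
      and X: "X \<subseteq> frontier \<Omega>" "finite X" "frontier \<Omega> \<subseteq> (\<Union>q\<in>X. ball q (r q))"
      using finite_chart_cover[OF \<Omega>(2,3)] by metis
    let ?F = "(\<lambda>q. frontier \<Omega> \<inter> ball q (r q)) ` X"
    have sigE: "E' \<in> sets borel \<and> E' \<subseteq> frontier \<Omega>" if "E' \<in> sets \<sigma>" for E' using that P setsR by blast
    show "emeasure \<sigma> E = emeasure ?R E"
    proof (rule measures_agree_on_countable_union[OF s])
      show "countable ?F" using X(2) by (simp add: countable_finite)
      show "?F \<subseteq> sets \<sigma>"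
      proof
        fix Q assume "Q \<in> ?F"
        then show "Q \<in> sets \<sigma>" unfolding conjunct1[OF P] setsR by auto
      qed
      show "E \<in> sets \<sigma>" by (rule E)
      show "E \<subseteq> \<Union>?F" using sigE[OF E] X(3) by blast
      fix Q E' assume Q: "Q \<in> ?F" and E': "E' \<in> sets \<sigma>" "E' \<subseteq> Q"
      then obtain q where q: "q \<in> frontier \<Omega>" "E' \<subseteq> ball q (r q)" using X(1) by auto
      have "E' \<in> sets ?R" using E' s by simp
      then show "emeasure \<sigma> E' = emeasure ?R E'"
        using conjunct2[OF P, rule_format, OF q(1) ch[OF q(1)] E'(1) q(2)]
          conjunct2[OF PR, rule_format, OF q(1) ch[OF q(1)] _ q(2)] by metis
    qed
  qed
  show ?thesis unfolding surface_measure_def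
    using PR by (rule the_equality) (rule uniq)
qed

section \<open>Gauss's theorem on the whole domain\<close>

text \<open>
  A Borel function on the whole space, for use with measures that are defined there.
\<close>

definition extended_normal :: "'a::euclidean_space set \<Rightarrow> 'a \<Rightarrow> 'a" where
  "extended_normal \<Omega> x = indicator (frontier \<Omega>) x *\<^sub>R outward_normal \<Omega> x"

lemma extended_normal_measurable:
  assumes "open \<Omega>" "Ck_boundary 1 \<Omega>"
  shows "extended_normal \<Omega> \<in> borel_measurable borel"
  unfolding extended_normal_def[abs_def]
  by (rule borel_measurable_continuous_on_indicator) (auto intro: continuous_outward_normal[OF assms])

lemma integral_indicator_eq_of_emeasure_eq:
  fixes g :: "'a::euclidean_space \<Rightarrow> real"
  assumes S: "sets S = sets borel" and A: "A \<in> sets borel"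
    and eq: "\<And>E. E \<in> sets borel \<Longrightarrow> E \<subseteq> A \<Longrightarrow> emeasure S E = emeasure M E"
    and M: "sets M = sets borel"
    and g: "g \<in> borel_measurable borel"
  shows "(\<integral>x. indicator A x * g x \<partial>S) = (\<integral>x. indicator A x * g x \<partial>M)"
proof -
  have [measurable_cong]: "sets S = sets borel" "sets M = sets borel" by fact+
  note [measurable] = A g
  have "density S (\<lambda>x. ennreal (indicator A x)) = density M (\<lambda>x. ennreal (indicator A x))"
  proof (rule measure_eqI)
    show "sets (density S (\<lambda>x. ennreal (indicator A x))) = sets (density M (\<lambda>x. ennreal (indicator A x)))"
      by (simp add: S M)
    fix E assume "E \<in> sets (density S (\<lambda>x. ennreal (indicator A x)))"
    then have E[measurable]: "E \<in> sets borel" by (simp add: S)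
    have "emeasure (density N (\<lambda>x. ennreal (indicator A x))) E = emeasure N (A \<inter> E)" if N: "sets N = sets borel" for N
    proof -
      have [measurable_cong]: "sets N = sets borel" by fact
      have "ennreal (indicator A x) * indicator E x = indicator (A \<inter> E) x" for x
        by (auto split: split_indicator)
      then have "emeasure (density N (\<lambda>x. ennreal (indicator A x))) E = (\<integral>\<^sup>+x. indicator (A \<inter> E) x \<partial>N)"
        by (subst emeasure_density) (simp_all add: N)
      then show ?thesis by (simp add: N)
    qed
    then show "emeasure (density S (\<lambda>x. ennreal (indicator A x))) E = emeasure (density M (\<lambda>x. ennreal (indicator A x))) E"
      using eq[of "A \<inter> E"] S M A E by simp
  qed
  then have "integral\<^sup>L (density S (\<lambda>x. ennreal (indicator A x))) g = integral\<^sup>L (density M (\<lambda>x. ennreal (indicator A x))) g"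
    by simp
  then show ?thesis by (subst (asm) (1 2) integral_density) auto
qed

text \<open>
  Every point of the closure lies in an open box whose closure is contained in the domain or in
  the ball of a chart. With the bumps of finitely many such boxes as a partition of unity the
  theorem reduces to functions supported in one closed box, where it is either trivial or the
  theorem in a chart.
\<close>

theorem gauss:
  fixes \<Omega> :: "'a::euclidean_space set" and f :: "'a \<Rightarrow> real"
  assumes \<Omega>: "open \<Omega>" "bounded \<Omega>" "Ck_boundary 1 \<Omega>"
    and S: "sets S = sets borel" "finite_measure S"
      "\<And>p r b s h E. graph_chart 1 \<Omega> p r b s h \<Longrightarrow> E \<in> sets borel \<Longrightarrow> E \<subseteq> frontier \<Omega> \<inter> ball p r \<Longrightarrow>
        emeasure S E = emeasure (chart_measure b s h) E"
    and f: "C1_upto \<Omega> f D" and i: "i \<in> Basis"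
  shows "(\<integral>x. D x \<bullet> i \<partial>vol \<Omega>) = (\<integral>x. indicator (frontier \<Omega>) x * (f x * (outward_normal \<Omega> x \<bullet> i)) \<partial>S)"
proof -
  interpret S: finite_measure S by fact
  have [measurable_cong]: "sets S = sets borel" by fact
  have [measurable]: "frontier \<Omega> \<in> sets borel" "closure \<Omega> \<in> sets borel" "\<Omega> \<in> sets borel" using \<Omega>(1) by auto
  note [measurable] = extended_normal_measurable[OF \<Omega>(1,3)]
  have chart_version: "(\<integral>x. E x \<bullet> i \<partial>vol \<Omega>) = (\<integral>x. indicator (frontier \<Omega>) x * (g x * (outward_normal \<Omega> x \<bullet> i)) \<partial>S)"
    if g: "C1_upto \<Omega> g E" and ch: "graph_chart 1 \<Omega> p r b s h" and K: "compact K" "K \<subseteq> ball p r" "\<And>x. x \<notin> K \<Longrightarrow> g x = 0"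
    for g E p r b s h K
  proof -
    define g' where "g' x = indicator (closure \<Omega>) x * g x" for x
    have g': "C1_upto \<Omega> g' E" by (rule C1_upto_cong[OF \<Omega>(1) g]) (simp add: g'_def)
    have cg: "continuous_on (closure \<Omega>) g" using g by (simp add: C1_upto_def)
    have [measurable]: "g' \<in> borel_measurable borel"
      using cg unfolding g'_def using borel_measurable_continuous_on_indicator[of "closure \<Omega>" g] by simp
    have cn: "chart_normal b s h \<in> borel_measurable borel"
      using chart_normal_measurable[OF graph_chartD(5)[OF ch]] .
    have n0: "extended_normal \<Omega> \<in> borel_measurable borel" by (rule extended_normal_measurable[OF \<Omega>(1,3)])
    have K': "compact (K \<inter> closure \<Omega>)" using K(1) by (intro compact_Int_closed) auto
    have g0: "g' x = 0" if "x \<notin> K \<inter> closure \<Omega>" for x using that K(3) by (auto simp: g'_def)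
    have "(\<integral>x. E x \<bullet> i \<partial>vol \<Omega>) = (\<integral>x. g' x * (chart_normal b s h x \<bullet> i) \<partial>chart_measure b s h)"
      by (rule chart_gauss[OF \<Omega>(1,2) ch g' K' _ _ g0 i]) (use K in auto)
    also have "\<dots> = (\<integral>x. indicator (frontier \<Omega> \<inter> ball p r) x * (g' x * (extended_normal \<Omega> x \<bullet> i)) \<partial>chart_measure b s h)"
    proof (rule integral_cong_AE)
      show "AE x in chart_measure b s h. g' x * (chart_normal b s h x \<bullet> i) =
          indicator (frontier \<Omega> \<inter> ball p r) x * (g' x * (extended_normal \<Omega> x \<bullet> i))"
        using AE_chart_measure_graph[OF ch]
      proof eventually_elim
        case (elim x)
        show ?case
        proof (cases "x \<in> ball p r")
          case False
          then have "g' x = 0" using K(2) by (intro g0) auto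
          then show ?thesis by simp
        next
          case True
          then have fr: "x \<in> frontier \<Omega>" using elim frontier_in_chart[OF \<Omega>(1) ch] by simp
          then show ?thesis using True outward_normal_chart[OF \<Omega>(1) ch True fr] by (simp add: extended_normal_def)
        qed
      qed
    qed (unfold measurable_cong_sets[OF sets_chart_measure refl],
        intro borel_measurable_times borel_measurable_inner borel_measurable_const cn n0 borel_measurable_indicator; measurable)+
    also have "\<dots> = (\<integral>x. indicator (frontier \<Omega> \<inter> ball p r) x * (g' x * (extended_normal \<Omega> x \<bullet> i)) \<partial>S)"
      using S(3)[OF ch] by (intro integral_indicator_eq_of_emeasure_eq[symmetric] S(1)) auto
    also have "\<dots> = (\<integral>x. indicator (frontier \<Omega>) x * (g x * (outward_normal \<Omega> x \<bullet> i)) \<partial>S)"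
    proof (rule Bochner_Integration.integral_cong[OF refl])
      fix x
      show "indicator (frontier \<Omega> \<inter> ball p r) x * (g' x * (extended_normal \<Omega> x \<bullet> i)) =
          indicator (frontier \<Omega>) x * (g x * (outward_normal \<Omega> x \<bullet> i))"
      proof (cases "x \<in> frontier \<Omega>")
        case True
        then have "x \<in> closure \<Omega>" by (simp add: frontier_def)
        moreover have "g x = 0" if "x \<notin> ball p r" using that K(2) K(3) by blast
        ultimately show ?thesis using True by (cases "x \<in> ball p r") (auto simp: g'_def extended_normal_def)
      qed simp
    qed
    finally show ?thesis .
  qed
  have interior_version: "(\<integral>x. E x \<bullet> i \<partial>vol \<Omega>) = (\<integral>x. indicator (frontier \<Omega>) x * (g x * (outward_normal \<Omega> x \<bullet> i)) \<partial>S)"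
    if g: "C1_upto \<Omega> g E" and K: "compact K" "K \<subseteq> \<Omega>" "\<And>x. x \<notin> K \<Longrightarrow> g x = 0" for g E K
  proof -
    have "(\<integral>x. E x \<bullet> i \<partial>vol \<Omega>) = 0"
      by (rule integral_partial_interior_support[OF \<Omega>(1) g K(1,2) _ i]) (use K(3) in auto)
    moreover have "indicator (frontier \<Omega>) x * (g x * (outward_normal \<Omega> x \<bullet> i)) = 0" for x
    proof -
      have "frontier \<Omega> \<inter> \<Omega> = {}" using \<Omega>(1) by (simp add: frontier_disjoint_eq)
      then show ?thesis using K(2) K(3)[of x] by (cases "x \<in> K") (auto split: split_indicator)
    qed
    ultimately show ?thesis by (simp only: Bochner_Integration.integral_zero)
  qed
  define good where "good u v \<longleftrightarrow> cbox u v \<subseteq> \<Omega> \<or> (\<exists>p r b s h. graph_chart 1 \<Omega> p r b s h \<and> cbox u v \<subseteq> ball p r)" for u v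
  have "\<exists>u v. q \<in> box u v \<and> good u v" if q: "q \<in> closure \<Omega>" for q
  proof (cases "q \<in> \<Omega>")
    case True
    then show ?thesis using open_contains_cbox[OF \<Omega>(1) True] unfolding good_def by metis
  next
    case False
    then have "q \<in> frontier \<Omega>" using q \<Omega>(1) by (simp add: frontier_def interior_open)
    then obtain r b s h where ch: "graph_chart 1 \<Omega> q r b s h" using \<Omega>(3) unfolding Ck_boundary_def by blast
    then have "q \<in> ball q r" using graph_chartD(1) by auto
    then show ?thesis using open_contains_cbox[OF open_ball, of q q r] ch unfolding good_def by metis
  qed
  then obtain u v where uv: "\<And>q. q \<in> closure \<Omega> \<Longrightarrow> q \<in> box (u q) (v q) \<and> good (u q) (v q)" by metis
  have "compact (closure \<Omega>)" using \<Omega>(2) by (simp add: compact_closure)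
  moreover have "closure \<Omega> \<subseteq> (\<Union>q\<in>closure \<Omega>. box (u q) (v q))" using uv by blast
  ultimately obtain X where X: "X \<subseteq> closure \<Omega>" "finite X" "closure \<Omega> \<subseteq> (\<Union>q\<in>X. box (u q) (v q))"
    using compactE_image[of "closure \<Omega>" "closure \<Omega>" "\<lambda>q. box (u q) (v q)"] by (metis open_box)
  \<comment> \<open>All bumps with index 0: only positivity inside the boxes matters for a
      partition of unity.\<close>
  define \<beta> where "\<beta> q = box_bump (u q) (v q) 0" for q
  define B where "B x = (\<Sum>q\<in>X. \<beta> q x)" for x
  have \<beta>C1: "C1_upto \<Omega> (\<beta> q) (grad (\<beta> q))" for q unfolding \<beta>_def by (rule C1_upto_smooth[OF smooth_box_bump])
  have BC1: "C1_upto \<Omega> B (\<lambda>x. \<Sum>q\<in>X. grad (\<beta> q) x)"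
    unfolding B_def by (rule C1_upto_sum[OF X(2) \<beta>C1])
  have Bpos: "0 < B x" if x: "x \<in> closure \<Omega>" for x
  proof -
    obtain q where q: "q \<in> X" "x \<in> box (u q) (v q)" using X(3) x by blast
    then have "0 < \<beta> q x" using box_bump_range(1)[of "u q" "v q" 0 x] box_bump_nonzero_iff[of "u q" "v q" 0 x]
      by (simp add: \<beta>_def)
    then show ?thesis unfolding B_def
      using X(2) q(1) box_bump_range(1) by (intro sum_pos2) (auto simp: \<beta>_def)
  qed
  define D1 where "D1 x = (- (1 / (B x)\<^sup>2)) *\<^sub>R (\<Sum>q\<in>X. grad (\<beta> q) x)" for x
  have inv: "C1_upto \<Omega> (\<lambda>x. 1 / B x) D1"
    unfolding D1_def
  proof (rule C1_upto_compose[OF BC1])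
    fix t assume "t \<in> B ` closure \<Omega>"
    then have "t \<noteq> 0" using Bpos by force
    then show "((\<lambda>t. 1 / t) has_real_derivative - (1 / t\<^sup>2)) (at t)"
      by (auto intro!: derivative_eq_intros simp: power2_eq_square)
  next
    show "continuous_on (B ` closure \<Omega>) (\<lambda>t. - (1 / t\<^sup>2))"
      using Bpos by (intro continuous_intros) force
  qed
  define G where "G q x = f x * (\<beta> q x * (1 / B x))" for q x
  define E where "E q x = f x *\<^sub>R (\<beta> q x *\<^sub>R D1 x + (1 / B x) *\<^sub>R grad (\<beta> q) x) + (\<beta> q x * (1 / B x)) *\<^sub>R D x" for q x
  have GC1: "C1_upto \<Omega> (G q) (E q)" for q
    unfolding G_def E_def by (intro C1_upto_mult f \<beta>C1 inv)
  have G0: "G q x = 0" if "x \<notin> cbox (u q) (v q)" for q x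
    using that box_bump_nonzero_iff[of "u q" "v q" 0 x] box_subset_cbox[of "u q" "v q"] by (auto simp: G_def \<beta>_def)
  have piece: "(\<integral>x. E q x \<bullet> i \<partial>vol \<Omega>) = (\<integral>x. indicator (frontier \<Omega>) x * (G q x * (outward_normal \<Omega> x \<bullet> i)) \<partial>S)"
    if "q \<in> X" for q
  proof -
    have "good (u q) (v q)" using uv X(1) that by blast
    then show ?thesis
      unfolding good_def
      using interior_version[OF GC1 compact_cbox _ G0] chart_version[OF GC1 _ compact_cbox _ G0] by blast
  qed
  have Gsum: "(\<Sum>q\<in>X. G q x) = f x" if "x \<in> closure \<Omega>" for x
    using Bpos[OF that] by (simp add: G_def B_def flip: sum_distrib_left sum_divide_distrib)
  have "C1_upto \<Omega> (\<lambda>x. \<Sum>q\<in>X. G q x) (\<lambda>x. \<Sum>q\<in>X. E q x)" by (rule C1_upto_sum[OF X(2) GC1])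
  then have fE: "C1_upto \<Omega> f (\<lambda>x. \<Sum>q\<in>X. E q x)" by (rule C1_upto_cong[OF \<Omega>(1)]) (rule Gsum)
  have DE: "D x = (\<Sum>q\<in>X. E q x)" if "x \<in> \<Omega>" for x
  proof -
    have "(f has_derivative (\<lambda>v. D x \<bullet> v)) (at x)" "(f has_derivative (\<lambda>v. (\<Sum>q\<in>X. E q x) \<bullet> v)) (at x)"
      using f fE that by (auto simp: C1_upto_def)
    from has_derivative_unique[OF this] have "D x \<bullet> v = (\<Sum>q\<in>X. E q x) \<bullet> v" for v by metis
    then show ?thesis by (metis vector_eq_rdot)
  qed
  have intE: "integrable (vol \<Omega>) (\<lambda>x. E q x \<bullet> i)" for q
    using GC1[of q] by (intro integrable_vol_continuous \<Omega> continuous_intros) (auto simp: C1_upto_def)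
  have intG: "integrable S (\<lambda>x. indicator (frontier \<Omega>) x * (G q x * (outward_normal \<Omega> x \<bullet> i)))" for q
  proof -
    have "continuous_on (frontier \<Omega>) (\<lambda>x. G q x * (outward_normal \<Omega> x \<bullet> i))"
      using GC1[of q] continuous_outward_normal[OF \<Omega>(1,3)]
      by (intro continuous_intros) (auto simp: C1_upto_def frontier_def intro: continuous_on_subset)
    then obtain L where L: "\<And>x. x \<in> frontier \<Omega> \<Longrightarrow> \<bar>G q x * (outward_normal \<Omega> x \<bullet> i)\<bar> \<le> L"
      and "(\<lambda>x. indicator (frontier \<Omega>) x *\<^sub>R (G q x * (outward_normal \<Omega> x \<bullet> i))) \<in> borel_measurable borel"
      using continuous_bounded_on_compact[OF compact_frontier_bounded[OF \<Omega>(2)]]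
        borel_measurable_continuous_on_indicator[of "frontier \<Omega>"] by force
    then have m: "(\<lambda>x. indicator (frontier \<Omega>) x * (G q x * (outward_normal \<Omega> x \<bullet> i))) \<in> borel_measurable borel"
      by simp
    show ?thesis
    proof (rule S.integrable_const_bound[where B="\<bar>L\<bar>"])
      show "AE x in S. norm (indicator (frontier \<Omega>) x * (G q x * (outward_normal \<Omega> x \<bullet> i))) \<le> \<bar>L\<bar>"
        using L by (force intro!: AE_I2 split: split_indicator)
    qed (use m S(1) in \<open>simp add: measurable_cong_sets[OF S(1) refl]\<close>)
  qed
  have "(\<integral>x. D x \<bullet> i \<partial>vol \<Omega>) = (\<integral>x. (\<Sum>q\<in>X. E q x \<bullet> i) \<partial>vol \<Omega>)"
    by (rule Bochner_Integration.integral_cong[OF refl]) (simp add: DE space_restrict_space inner_sum_left)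
  also have "\<dots> = (\<Sum>q\<in>X. \<integral>x. E q x \<bullet> i \<partial>vol \<Omega>)" using intE by (rule Bochner_Integration.integral_sum)
  also have "\<dots> = (\<Sum>q\<in>X. \<integral>x. indicator (frontier \<Omega>) x * (G q x * (outward_normal \<Omega> x \<bullet> i)) \<partial>S)"
    by (intro sum.cong refl piece)
  also have "\<dots> = (\<integral>x. (\<Sum>q\<in>X. indicator (frontier \<Omega>) x * (G q x * (outward_normal \<Omega> x \<bullet> i))) \<partial>S)"
    using intG by (rule Bochner_Integration.integral_sum[symmetric])
  also have "\<dots> = (\<integral>x. indicator (frontier \<Omega>) x * (f x * (outward_normal \<Omega> x \<bullet> i)) \<partial>S)"
  proof (rule Bochner_Integration.integral_cong[OF refl])
    fix x
    show "(\<Sum>q\<in>X. indicator (frontier \<Omega>) x * (G q x * (outward_normal \<Omega> x \<bullet> i))) =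
        indicator (frontier \<Omega>) x * (f x * (outward_normal \<Omega> x \<bullet> i))"
      using Gsum[of x] by (cases "x \<in> frontier \<Omega>") (auto simp: frontier_def simp flip: sum_distrib_right)
  qed
  finally show ?thesis .
qed

section \<open>Square-integrable functions\<close>

lemma L2_measurable: "f \<in> L2 M \<Longrightarrow> f \<in> borel_measurable M"
  by (simp add: L2_def)

lemma L2_mult_integrable:
  assumes "f \<in> L2 M" "g \<in> L2 M" shows "integrable M (\<lambda>x. f x * g x)"
proof (rule Bochner_Integration.integrable_bound)
  show "integrable M (\<lambda>x. (f x)\<^sup>2 + (g x)\<^sup>2)" using assms by (simp add: L2_def)
  show "(\<lambda>x. f x * g x) \<in> borel_measurable M" using assms by (auto simp: L2_def)
  have "\<bar>s * t\<bar> \<le> s\<^sup>2 + t\<^sup>2" for s t :: real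
  proof -
    have "2 * (\<bar>s\<bar> * \<bar>t\<bar>) \<le> \<bar>s\<bar>\<^sup>2 + \<bar>t\<bar>\<^sup>2" using sum_squares_bound[of "\<bar>s\<bar>" "\<bar>t\<bar>"] by simp
    moreover have "0 \<le> \<bar>s\<bar> * \<bar>t\<bar>" by simp
    ultimately show ?thesis by (simp only: abs_mult power2_abs)
  qed
  then show "AE x in M. norm (f x * g x) \<le> norm ((f x)\<^sup>2 + (g x)\<^sup>2)"
    by (auto intro!: AE_I2 order_trans[OF _ abs_ge_self])
qed

lemma L2_bounded_mult:
  assumes "f \<in> L2 M" "m \<in> borel_measurable M" "AE x in M. \<bar>m x\<bar> \<le> C"
  shows "(\<lambda>x. m x * f x) \<in> L2 M"
proof -
  have "integrable M (\<lambda>x. C\<^sup>2 * (f x)\<^sup>2)" using assms by (simp add: L2_def)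
  then have "integrable M (\<lambda>x. (m x * f x)\<^sup>2)"
  proof (rule Bochner_Integration.integrable_bound)
    show "AE x in M. norm ((m x * f x)\<^sup>2) \<le> norm (C\<^sup>2 * (f x)\<^sup>2)"
      using assms(3)
    proof eventually_elim
      case (elim x)
      then have "(m x)\<^sup>2 \<le> C\<^sup>2" by (simp add: abs_le_square_iff[symmetric])
      then show ?case by (simp add: power_mult_distrib mult_right_mono)
    qed
  qed (use assms in \<open>auto simp: L2_def\<close>)
  then show ?thesis using assms by (auto simp: L2_def)
qed

lemma L2_cmult: "f \<in> L2 M \<Longrightarrow> (\<lambda>x. c * f x) \<in> L2 M"
  by (rule L2_bounded_mult[where C="\<bar>c\<bar>"]) auto

lemma L2_add:
  assumes "f \<in> L2 M" "g \<in> L2 M" shows "(\<lambda>x. f x + g x) \<in> L2 M"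
proof -
  have "integrable M (\<lambda>x. (f x)\<^sup>2 + (g x)\<^sup>2 + 2 * (f x * g x))"
    using assms L2_mult_integrable[OF assms] by (simp add: L2_def)
  moreover have "(\<lambda>x. (f x)\<^sup>2 + (g x)\<^sup>2 + 2 * (f x * g x)) = (\<lambda>x. (f x + g x)\<^sup>2)"
    by (simp add: fun_eq_iff power2_sum algebra_simps)
  ultimately show ?thesis using assms by (auto simp: L2_def)
qed

lemma L2_uminus: "f \<in> L2 M \<Longrightarrow> (\<lambda>x. - f x) \<in> L2 M"
  using L2_cmult[of f M "-1"] by simp

lemma L2_diff: "f \<in> L2 M \<Longrightarrow> g \<in> L2 M \<Longrightarrow> (\<lambda>x. f x - g x) \<in> L2 M"
  using L2_add[OF _ L2_uminus] by (metis (no_types, lifting) ext diff_conv_add_uminus)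

lemma L2_sum: "(\<And>i. i \<in> I \<Longrightarrow> f i \<in> L2 M) \<Longrightarrow> (\<lambda>x. \<Sum>i\<in>I. f i x) \<in> L2 M"
proof (induction I rule: infinite_finite_induct)
  case (insert i I)
  then have "(\<lambda>x. f i x + (\<Sum>i\<in>I. f i x)) \<in> L2 M" by (intro L2_add) auto
  with insert show ?case by simp
qed (auto simp: L2_def)

lemma L2_Cauchy_Schwarz:
  assumes f: "f \<in> L2 M" and g: "g \<in> L2 M"
  shows "\<bar>\<integral>x. f x * g x \<partial>M\<bar> \<le> L2_norm M f * L2_norm M g"
proof -
  have [measurable]: "f \<in> borel_measurable M" "g \<in> borel_measurable M" using f g by (auto simp: L2_def)
  have sq: "(\<integral>\<^sup>+x. (ennreal \<bar>u x\<bar>)\<^sup>2 \<partial>M) = ennreal (\<integral>x. (u x)\<^sup>2 \<partial>M)" if "u \<in> L2 M" for u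
    using that by (subst nn_integral_eq_integral[symmetric]) (auto simp: L2_def ennreal_power)
  have i: "integrable M (\<lambda>x. \<bar>f x\<bar> * \<bar>g x\<bar>)"
    using L2_mult_integrable[OF f g] integrable_abs by (fastforce simp: abs_mult)
  have "(ennreal (\<integral>x. \<bar>f x\<bar> * \<bar>g x\<bar> \<partial>M))\<^sup>2 = (\<integral>\<^sup>+x. ennreal \<bar>f x\<bar> * ennreal \<bar>g x\<bar> \<partial>M)\<^sup>2"
    using i by (subst nn_integral_eq_integral[symmetric]) (auto simp: ennreal_mult)
  also have "\<dots> \<le> ennreal (\<integral>x. (f x)\<^sup>2 \<partial>M) * ennreal (\<integral>x. (g x)\<^sup>2 \<partial>M)"
    using Cauchy_Schwarz_nn_integral[of "\<lambda>x. ennreal \<bar>f x\<bar>" M "\<lambda>x. ennreal \<bar>g x\<bar>"] by (simp add: sq f g)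
  finally have "(\<integral>x. \<bar>f x\<bar> * \<bar>g x\<bar> \<partial>M)\<^sup>2 \<le> (\<integral>x. (f x)\<^sup>2 \<partial>M) * (\<integral>x. (g x)\<^sup>2 \<partial>M)"
    by (simp add: ennreal_power flip: ennreal_mult)
  then have "(\<integral>x. \<bar>f x\<bar> * \<bar>g x\<bar> \<partial>M) \<le> sqrt ((\<integral>x. (f x)\<^sup>2 \<partial>M) * (\<integral>x. (g x)\<^sup>2 \<partial>M))"
    by (rule real_le_rsqrt)
  moreover have "\<bar>\<integral>x. f x * g x \<partial>M\<bar> \<le> (\<integral>x. \<bar>f x\<bar> * \<bar>g x\<bar> \<partial>M)"
    using integral_abs_bound[of M "\<lambda>x. f x * g x"] by (simp add: abs_mult)
  ultimately show ?thesis by (simp add: L2_norm_def real_sqrt_mult)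
qed

lemma L2_norm_nonneg: "0 \<le> L2_norm M f" by (simp add: L2_norm_def)

lemma L2_norm_abs_mult_le:
  assumes "f \<in> L2 M" "m \<in> borel_measurable M" "\<And>x. x \<in> space M \<Longrightarrow> \<bar>m x\<bar> \<le> C"
  shows "L2_norm M (\<lambda>x. m x * f x) \<le> \<bar>C\<bar> * L2_norm M f"
proof -
  have "(\<integral>x. (m x * f x)\<^sup>2 \<partial>M) \<le> (\<integral>x. C\<^sup>2 * (f x)\<^sup>2 \<partial>M)"
  proof (rule integral_mono)
    show "integrable M (\<lambda>x. (m x * f x)\<^sup>2)" using L2_bounded_mult[of f M m C] assms by (auto simp: L2_def)
    show "integrable M (\<lambda>x. C\<^sup>2 * (f x)\<^sup>2)" using assms by (auto simp: L2_def)
    fix x assume "x \<in> space M"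
    then have "\<bar>m x\<bar> \<le> \<bar>C\<bar>" using assms(3)[of x] by simp
    then have "(m x)\<^sup>2 \<le> C\<^sup>2" by (simp add: abs_le_square_iff[symmetric])
    then show "(m x * f x)\<^sup>2 \<le> C\<^sup>2 * (f x)\<^sup>2" by (simp add: power_mult_distrib mult_right_mono)
  qed
  then have "L2_norm M (\<lambda>x. m x * f x) \<le> sqrt (C\<^sup>2 * (\<integral>x. (f x)\<^sup>2 \<partial>M))"
    unfolding L2_norm_def by simp
  then show ?thesis by (simp add: real_sqrt_mult L2_norm_def)
qed

lemma L2_tendsto_const: "f \<in> L2 M \<Longrightarrow> L2_tendsto M (\<lambda>_. f) f net"
  by (simp add: L2_tendsto_def L2_norm_def)

lemma L2_tendsto_bounded_mult:
  assumes F: "L2_tendsto M F f net" and m: "m \<in> borel_measurable M" "\<And>x. x \<in> space M \<Longrightarrow> \<bar>m x\<bar> \<le> C"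
  shows "L2_tendsto M (\<lambda>n x. m x * F n x) (\<lambda>x. m x * f x) net"
proof -
  have mult: "(\<lambda>x. m x * g x) \<in> L2 M" if "g \<in> L2 M" for g
    using that m by (intro L2_bounded_mult[where C=C]) auto
  have f: "f \<in> L2 M" and ev: "\<forall>\<^sub>F n in net. F n \<in> L2 M"
    and lim: "((\<lambda>n. L2_norm M (\<lambda>x. F n x - f x)) \<longlongrightarrow> 0) net" using F by (auto simp: L2_tendsto_def)
  have "((\<lambda>n. \<bar>C\<bar> * L2_norm M (\<lambda>x. F n x - f x)) \<longlongrightarrow> \<bar>C\<bar> * 0) net" by (intro tendsto_intros lim)
  then have bound: "((\<lambda>n. \<bar>C\<bar> * L2_norm M (\<lambda>x. F n x - f x)) \<longlongrightarrow> 0) net" by (simp only: mult_zero_right)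
  have "\<forall>\<^sub>F n in net. L2_norm M (\<lambda>x. m x * F n x - m x * f x) \<le> \<bar>C\<bar> * L2_norm M (\<lambda>x. F n x - f x)"
    using ev
  proof eventually_elim
    case (elim n)
    have "L2_norm M (\<lambda>x. m x * (F n x - f x)) \<le> \<bar>C\<bar> * L2_norm M (\<lambda>x. F n x - f x)"
      by (rule L2_norm_abs_mult_le[OF L2_diff[OF elim f] m])
    then show ?case by (simp only: right_diff_distrib)
  qed
  then have "\<forall>\<^sub>F n in net. norm (L2_norm M (\<lambda>x. m x * F n x - m x * f x)) \<le> \<bar>C\<bar> * L2_norm M (\<lambda>x. F n x - f x)"
    by (simp only: real_norm_def abs_of_nonneg[OF L2_norm_nonneg])
  then have "((\<lambda>n. L2_norm M (\<lambda>x. m x * F n x - m x * f x)) \<longlongrightarrow> 0) net"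
    using bound by (rule Lim_null_comparison)
  moreover have "\<forall>\<^sub>F n in net. (\<lambda>x. m x * F n x) \<in> L2 M" using ev by eventually_elim (rule mult)
  ultimately show ?thesis using mult[OF f] by (simp add: L2_tendsto_def)
qed

text \<open>
  The difference of the integrals splits into \<open>(F - f)(G - g) + (F - f) g + f (G - g)\<close>, and the
  Cauchy-Schwarz inequality bounds every term.
\<close>

lemma L2_tendsto_integral_mult:
  assumes F: "L2_tendsto M F f net" and G: "L2_tendsto M G g net"
  shows "((\<lambda>n. \<integral>x. F n x * G n x \<partial>M) \<longlongrightarrow> (\<integral>x. f x * g x \<partial>M)) net"
proof -
  have f: "f \<in> L2 M" "\<forall>\<^sub>F n in net. F n \<in> L2 M" "((\<lambda>n. L2_norm M (\<lambda>x. F n x - f x)) \<longlongrightarrow> 0) net"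
    using F by (auto simp: L2_tendsto_def)
  have g: "g \<in> L2 M" "\<forall>\<^sub>F n in net. G n \<in> L2 M" "((\<lambda>n. L2_norm M (\<lambda>x. G n x - g x)) \<longlongrightarrow> 0) net"
    using G by (auto simp: L2_tendsto_def)
  let ?p = "\<lambda>n. L2_norm M (\<lambda>x. F n x - f x)" and ?q = "\<lambda>n. L2_norm M (\<lambda>x. G n x - g x)"
  have "((\<lambda>n. ?p n * ?q n + ?p n * L2_norm M g + L2_norm M f * ?q n) \<longlongrightarrow> 0 * 0 + 0 * L2_norm M g + L2_norm M f * 0) net"
    by (intro tendsto_intros f g)
  then have lim: "((\<lambda>n. ?p n * ?q n + ?p n * L2_norm M g + L2_norm M f * ?q n) \<longlongrightarrow> 0) net" by simp
  have "\<forall>\<^sub>F n in net. norm ((\<integral>x. F n x * G n x \<partial>M) - (\<integral>x. f x * g x \<partial>M)) \<le>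
      ?p n * ?q n + ?p n * L2_norm M g + L2_norm M f * ?q n"
    using f(2) g(2)
  proof eventually_elim
    case (elim n)
    note d = L2_diff[OF elim(1) f(1)] L2_diff[OF elim(2) g(1)]
    note i = L2_mult_integrable[OF d(1) d(2)] L2_mult_integrable[OF d(1) g(1)] L2_mult_integrable[OF f(1) d(2)]
    have "(\<integral>x. F n x * G n x \<partial>M) - (\<integral>x. f x * g x \<partial>M) = (\<integral>x. F n x * G n x - f x * g x \<partial>M)"
      using L2_mult_integrable[OF elim] L2_mult_integrable[OF f(1) g(1)] by simp
    also have "\<dots> = (\<integral>x. (F n x - f x) * (G n x - g x) + (F n x - f x) * g x + f x * (G n x - g x) \<partial>M)"
      by (simp add: algebra_simps)
    also have "\<dots> = (\<integral>x. (F n x - f x) * (G n x - g x) \<partial>M) + (\<integral>x. (F n x - f x) * g x \<partial>M) + (\<integral>x. f x * (G n x - g x) \<partial>M)"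
      using i by (simp only: Bochner_Integration.integral_add Bochner_Integration.integrable_add)
    finally show ?case
      using L2_Cauchy_Schwarz[OF d(1) d(2)] L2_Cauchy_Schwarz[OF d(1) g(1)] L2_Cauchy_Schwarz[OF f(1) d(2)]
      unfolding real_norm_def by linarith
  qed
  from Lim_null_comparison[OF this lim] show ?thesis by (rule Lim_null[THEN iffD2])
qed

lemma continuous_measurable_vol: "continuous_on S f \<Longrightarrow> f \<in> borel_measurable (vol S)"
  for f :: "'a::euclidean_space \<Rightarrow> 'b::topological_space"
  using borel_measurable_continuous_on_restrict[of S f]
  by (simp add: measurable_cong_sets[OF sets_restrict_space_cong[OF sets_lborel] refl])

lemma continuous_L2_vol:
  fixes f :: "'a::euclidean_space \<Rightarrow> real"
  assumes "open S" "bounded S" "continuous_on (closure S) f"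
  shows "f \<in> L2 (vol S)"
proof -
  have "integrable (vol S) (\<lambda>x. (f x)\<^sup>2)"
    using assms by (intro integrable_vol_continuous continuous_intros)
  moreover have "continuous_on S f" using assms(3) closure_subset by (rule continuous_on_subset)
  ultimately show ?thesis by (simp add: L2_def continuous_measurable_vol)
qed

section \<open>Uniqueness of weak derivatives\<close>

text \<open>
  Testing with bumps shows that the integral of \<open>d\<close> over every box inside \<open>cbox u v\<close> vanishes.
  So the positive and the negative part of \<open>d\<close> on \<open>box u v\<close> are densities of the same measure.
\<close>

lemma AE_zero_on_box:
  fixes d :: "'a::euclidean_space \<Rightarrow> real"
  assumes \<Omega>: "open \<Omega>" and d: "locally_L1 \<Omega> d"
    and test: "\<And>\<psi>. \<psi> \<in> test_functions \<Omega> \<Longrightarrow> (\<integral>x. d x * \<psi> x \<partial>vol \<Omega>) = 0"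
    and uv: "cbox u v \<subseteq> \<Omega>"
  shows "AE x in lborel. x \<in> box u v \<longrightarrow> d x = 0"
proof -
  define g where "g x = indicator (box u v) x * d x" for x
  have "set_integrable lborel (cbox u v) d" using d uv by (auto simp: locally_L1_def)
  then have "set_integrable lborel (box u v) d"
    by (rule set_integrable_subset) (auto simp: box_subset_cbox)
  then have g: "integrable lborel g" by (simp add: set_integrable_def g_def[abs_def])
  then have [measurable]: "g \<in> borel_measurable borel" using borel_measurable_integrable by force
  have zero: "(\<integral>x. indicator (box w z) x * d x \<partial>lborel) = 0" if wz: "cbox w z \<subseteq> \<Omega>" for w z
  proof -
    have "set_integrable lborel (cbox w z) d" using d wz by (auto simp: locally_L1_def)
    then have int: "integrable lborel (\<lambda>x. indicator (cbox w z) x * d x)" by (simp add: set_integrable_def)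
    then have [measurable]: "(\<lambda>x. indicator (cbox w z) x * d x) \<in> borel_measurable borel"
      using borel_measurable_integrable by force
    have bm[measurable]: "box_bump w z n \<in> borel_measurable borel" for n
      using C1_upto_smooth[OF smooth_box_bump, of UNIV w z n]
      by (intro borel_measurable_continuous_onI) (auto simp: C1_upto_def)
    have b0: "box_bump w z n x = 0" if "x \<notin> cbox w z" for n x
      using that box_bump_nonzero_iff[of w z n x] box_subset_cbox[of w z] by auto
    have "(\<lambda>n. \<integral>x. box_bump w z n x * (indicator (cbox w z) x * d x) \<partial>lborel) \<longlonglongrightarrow>
        (\<integral>x. indicator (box w z) x * (indicator (cbox w z) x * d x) \<partial>lborel)"
    proof (rule integral_dominated_convergence)
      show "integrable lborel (\<lambda>x. \<bar>indicator (cbox w z) x * d x\<bar>)" using int by (rule integrable_abs)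
      show "AE x in lborel. (\<lambda>n. box_bump w z n x * (indicator (cbox w z) x * d x)) \<longlonglongrightarrow>
          indicator (box w z) x * (indicator (cbox w z) x * d x)"
        by (intro AE_I2 tendsto_mult box_bump_tendsto tendsto_const)
      show "AE x in lborel. norm (box_bump w z n x * (indicator (cbox w z) x * d x)) \<le> \<bar>indicator (cbox w z) x * d x\<bar>" for n
      proof (intro AE_I2)
        fix x
        have "\<bar>box_bump w z n x\<bar> \<le> 1" using box_bump_range[of w z n x] by simp
        then show "norm (box_bump w z n x * (indicator (cbox w z) x * d x)) \<le> \<bar>indicator (cbox w z) x * d x\<bar>"
          unfolding real_norm_def abs_mult by (intro mult_left_le_one_le) auto
      qed
    qed auto
    moreover have "(\<integral>x. box_bump w z n x * (indicator (cbox w z) x * d x) \<partial>lborel) = 0" for n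
    proof -
      have "(\<integral>x. box_bump w z n x * (indicator (cbox w z) x * d x) \<partial>lborel) =
          (\<integral>x. indicator \<Omega> x *\<^sub>R (d x * box_bump w z n x) \<partial>lborel)"
      proof (rule Bochner_Integration.integral_cong[OF refl])
        fix x
        show "box_bump w z n x * (indicator (cbox w z) x * d x) = indicator \<Omega> x *\<^sub>R (d x * box_bump w z n x)"
          using b0[of x n] wz by (cases "x \<in> cbox w z") auto
      qed
      also have "\<dots> = (\<integral>x. d x * box_bump w z n x \<partial>vol \<Omega>)"
        using \<Omega> by (subst integral_restrict_space) auto
      also have "\<dots> = 0" by (intro test box_bump_test wz)
      finally show ?thesis .
    qed
    moreover have "indicator (box w z) x * (indicator (cbox w z) x * d x) = indicator (box w z) x * d x" for x
      using box_subset_cbox[of w z] by (auto split: split_indicator)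
    ultimately show ?thesis by (simp add: LIMSEQ_const_iff)
  qed
  have fin: "integral\<^sup>N lborel (\<lambda>x. ennreal (g x)) \<noteq> \<infinity>" "integral\<^sup>N lborel (\<lambda>x. ennreal (- g x)) \<noteq> \<infinity>"
    using g unfolding real_integrable_def by auto
  have "density lborel (\<lambda>x. ennreal (g x)) = density lborel (\<lambda>x. ennreal (- g x))"
  proof (rule measure_eqI_boxes)
    show "emeasure (density lborel (\<lambda>x. ennreal (g x))) (box a b) \<noteq> \<infinity>" for a b
    proof -
      have "emeasure (density lborel (\<lambda>x. ennreal (g x))) (box a b) \<le> integral\<^sup>N lborel (\<lambda>x. ennreal (g x))"
        by (subst emeasure_density) (auto intro!: nn_integral_mono split: split_indicator)
      then show ?thesis using fin(1) by (auto simp: top_unique)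
    qed
    fix a c :: 'a
    define X where "X = box a c"
    obtain w z where wz: "box u v \<inter> box a c = box w z" "cbox w z \<subseteq> cbox u v" using box_Int_subbox by blast
    have Xg: "indicator X x * g x = indicator (box w z) x * d x" for x
      unfolding wz(1)[symmetric] X_def g_def by (auto split: split_indicator)
    have iX: "integrable lborel (\<lambda>x. indicator X x * g x)"
      using integrable_mult_indicator[of X lborel g] g by (simp add: X_def)
    have "0 = (\<integral>x. indicator X x * g x \<partial>lborel)" using zero[of w z] wz uv by (simp add: Xg)
    also have "\<dots> = enn2real (\<integral>\<^sup>+x. ennreal (indicator X x * g x) \<partial>lborel) - enn2real (\<integral>\<^sup>+x. ennreal (- (indicator X x * g x)) \<partial>lborel)"
      by (rule real_lebesgue_integral_def[OF iX])
    finally have "enn2real (\<integral>\<^sup>+x. ennreal (indicator X x * g x) \<partial>lborel) = enn2real (\<integral>\<^sup>+x. ennreal (- (indicator X x * g x)) \<partial>lborel)"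
      by simp
    moreover have "(\<integral>\<^sup>+x. ennreal (indicator X x * g x) \<partial>lborel) < top" "(\<integral>\<^sup>+x. ennreal (- (indicator X x * g x)) \<partial>lborel) < top"
      using iX unfolding real_integrable_def by (auto simp: less_top)
    ultimately have eq: "(\<integral>\<^sup>+x. ennreal (indicator X x * g x) \<partial>lborel) = (\<integral>\<^sup>+x. ennreal (- (indicator X x * g x)) \<partial>lborel)"
      by (metis ennreal_enn2real)
    have "emeasure (density lborel (\<lambda>x. ennreal (k x))) X = (\<integral>\<^sup>+x. ennreal (indicator X x * k x) \<partial>lborel)"
      if [measurable]: "k \<in> borel_measurable borel" for k
      by (subst emeasure_density) (auto simp: X_def intro!: nn_integral_cong split: split_indicator)
    from this[of g] this[of "\<lambda>x. - g x"] eq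
    show "emeasure (density lborel (\<lambda>x. ennreal (g x))) (box a c) = emeasure (density lborel (\<lambda>x. ennreal (- g x))) (box a c)"
      by (simp add: X_def)
  qed simp_all
  then have "AE x in lborel. ennreal (g x) = ennreal (- g x)"
    using finite_density_unique[of "\<lambda>x. ennreal (g x)" lborel "\<lambda>x. ennreal (- g x)"] fin by simp
  then show ?thesis
  proof eventually_elim
    case (elim x)
    then have "g x = 0" by (cases "g x \<ge> 0") (auto simp: ennreal_neg)
    then show ?case by (auto simp: g_def)
  qed
qed

lemma AE_vol_iff: "open S \<Longrightarrow> (AE x in vol S. P x) \<longleftrightarrow> (AE x in lborel. x \<in> S \<longrightarrow> P x)"
  for S :: "'a::euclidean_space set"
  by (subst AE_restrict_space_iff) auto

lemma fundamental_lemma_of_calculus_of_variations: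
  fixes d :: "'a::euclidean_space \<Rightarrow> real"
  assumes \<Omega>: "open \<Omega>" and d: "locally_L1 \<Omega> d"
    and test: "\<And>\<psi>. \<psi> \<in> test_functions \<Omega> \<Longrightarrow> (\<integral>x. d x * \<psi> x \<partial>vol \<Omega>) = 0"
  shows "AE x in vol \<Omega>. d x = 0"
proof -
  obtain F where F: "countable F" "\<Union>F = \<Omega>" "\<And>Q. Q \<in> F \<Longrightarrow> \<exists>u v. Q = box u v \<and> cbox u v \<subseteq> \<Omega>"
    using countable_box_cover[OF \<Omega>] by metis
  have "AE x in lborel. \<forall>Q\<in>F. x \<in> Q \<longrightarrow> d x = 0"
  proof (rule AE_ball_countable[THEN iffD2, OF F(1)], intro ballI)
    fix Q assume "Q \<in> F"
    then show "AE x in lborel. x \<in> Q \<longrightarrow> d x = 0"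
      using AE_zero_on_box[OF assms] F(3) by blast
  qed
  then show ?thesis
    unfolding AE_vol_iff[OF \<Omega>] by eventually_elim (use F(2) in blast)
qed

lemma test_function_support:
  assumes "\<psi> \<in> test_functions \<Omega>"
  obtains K where "compact K" "K \<subseteq> \<Omega>" "\<And>x. x \<notin> K \<Longrightarrow> \<psi> x = 0" "\<And>i x. x \<notin> K \<Longrightarrow> partial i \<psi> x = 0"
proof
  let ?K = "closure {x. \<psi> x \<noteq> 0}"
  show "compact ?K" "?K \<subseteq> \<Omega>" using assms by (auto simp: test_functions_def)
  show z: "\<psi> x = 0" if "x \<notin> ?K" for x using that closure_subset[of "{x. \<psi> x \<noteq> 0}"] by blast
  show "partial i \<psi> x = 0" if x: "x \<notin> ?K" for i x
  proof (rule partial_eq[of \<psi> "\<lambda>_. 0"])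
    show "(\<psi> has_derivative (\<lambda>_. 0)) (at x)"
    proof (rule has_derivative_transform_within_open[OF has_derivative_const[of 0], where s="- ?K"])
      show "open (- ?K)" by (rule open_Compl[OF closed_closure])
      show "x \<in> - ?K" using x by blast
      show "0 = \<psi> y" if "y \<in> - ?K" for y using that by (intro z[symmetric]) blast
    qed
  qed
qed

lemma test_function_smooth: "\<psi> \<in> test_functions \<Omega> \<Longrightarrow> smooth_on UNIV \<psi>"
  by (simp add: test_functions_def)

lemma smooth_continuous:
  assumes "smooth_on UNIV \<psi>"
  shows "continuous_on A \<psi>" "i \<in> Basis \<Longrightarrow> continuous_on A (partial i \<psi>)"
proof -
  have "Ck_on 1 UNIV \<psi>" using assms by (simp add: smooth_on_def)
  then have "continuous_on UNIV \<psi>" "\<forall>i\<in>Basis. continuous_on UNIV (partial i \<psi>)"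
    using Ck_on_1_UNIV(1) by auto
  then show "continuous_on A \<psi>" "i \<in> Basis \<Longrightarrow> continuous_on A (partial i \<psi>)"
    by (auto intro: continuous_on_subset)
qed

lemma locally_L1_mult_integrable:
  fixes w \<eta> :: "'a::euclidean_space \<Rightarrow> real"
  assumes \<Omega>: "open \<Omega>" and w: "locally_L1 \<Omega> w" and K: "compact K" "K \<subseteq> \<Omega>"
    and \<eta>: "continuous_on UNIV \<eta>" "\<And>x. x \<notin> K \<Longrightarrow> \<eta> x = 0"
  shows "integrable (vol \<Omega>) (\<lambda>x. w x * \<eta> x)"
proof -
  have int: "integrable lborel (\<lambda>x. indicator K x *\<^sub>R w x)"
    using w K by (auto simp: locally_L1_def set_integrable_def)
  have [measurable]: "\<eta> \<in> borel_measurable borel" using \<eta>(1) by (rule borel_measurable_continuous_onI)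
  have [measurable]: "(\<lambda>x. indicator K x *\<^sub>R w x) \<in> borel_measurable borel"
    using borel_measurable_integrable[OF int] by simp
  obtain C where "\<And>x. x \<in> K \<Longrightarrow> \<bar>\<eta> x\<bar> \<le> C"
    using continuous_bounded_on_compact[OF K(1) continuous_on_subset[OF \<eta>(1) subset_UNIV]] by blast
  then have C: "\<bar>\<eta> x\<bar> \<le> \<bar>C\<bar>" for x using \<eta>(2)[of x] by (cases "x \<in> K") force+
  have "integrable lborel (\<lambda>x. \<eta> x * (indicator K x *\<^sub>R w x))"
  proof (rule Bochner_Integration.integrable_bound)
    show "integrable lborel (\<lambda>x. \<bar>C\<bar> * (indicator K x *\<^sub>R w x))" using int by (rule integrable_mult_right)
    show "AE x in lborel. norm (\<eta> x * (indicator K x *\<^sub>R w x)) \<le> norm (\<bar>C\<bar> * (indicator K x *\<^sub>R w x))"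
      using C by (intro AE_I2) (simp add: abs_mult mult_right_mono)
    show "(\<lambda>x. \<eta> x * (indicator K x *\<^sub>R w x)) \<in> borel_measurable lborel" by measurable
  qed
  moreover have "\<eta> x * (indicator K x *\<^sub>R w x) = indicator \<Omega> x *\<^sub>R (w x * \<eta> x)" for x
    using K(2) \<eta>(2)[of x] by (cases "x \<in> K") auto
  ultimately have "integrable lborel (\<lambda>x. indicator \<Omega> x *\<^sub>R (w x * \<eta> x))" by (simp only:)
  then show ?thesis using \<Omega> by (subst integrable_restrict_space) auto
qed

text \<open>
  The problems in question refer to weak derivatives through existential witnesses; this lemma
  identifies the witnesses almost everywhere. It allows \<open>u\<close> and \<open>u'\<close> to be different
  representatives.
\<close>

lemma weak_partial_unique:
  assumes \<Omega>: "open \<Omega>" and i: "i \<in> Basis"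
    and w: "weak_partial \<Omega> i u w" and w': "weak_partial \<Omega> i u' w'"
    and eq: "AE x in vol \<Omega>. u x = u' x"
  shows "AE x in vol \<Omega>. w x = w' x"
proof -
  have L: "locally_L1 \<Omega> u" "locally_L1 \<Omega> w" "locally_L1 \<Omega> u'" "locally_L1 \<Omega> w'"
    using w w' by (auto simp: weak_partial_def)
  have "AE x in vol \<Omega>. w x - w' x = 0"
  proof (rule fundamental_lemma_of_calculus_of_variations[OF \<Omega>])
    show "locally_L1 \<Omega> (\<lambda>x. w x - w' x)"
      unfolding locally_L1_def
    proof (intro allI impI)
      fix K assume "compact K \<and> K \<subseteq> \<Omega>"
      then have "set_integrable lborel K w" "set_integrable lborel K w'" using L by (auto simp: locally_L1_def)
      then show "set_integrable lborel K (\<lambda>x. w x - w' x)" by (rule set_integral_diff)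
    qed
    fix \<psi> assume \<psi>: "\<psi> \<in> test_functions \<Omega>"
    then obtain K where K: "compact K" "K \<subseteq> \<Omega>" "\<And>x. x \<notin> K \<Longrightarrow> \<psi> x = 0" "\<And>i x. x \<notin> K \<Longrightarrow> partial i \<psi> x = 0"
      using test_function_support by blast
    note c = smooth_continuous[OF test_function_smooth[OF \<psi>]]
    have m: "(\<lambda>x. v x * partial i \<psi> x) \<in> borel_measurable (vol \<Omega>)" if "locally_L1 \<Omega> v" for v
      by (rule borel_measurable_integrable, rule locally_L1_mult_integrable[OF \<Omega> that K(1,2) c(2)[OF i] K(4)])
    have "(\<integral>x. (w x - w' x) * \<psi> x \<partial>vol \<Omega>) = (\<integral>x. w x * \<psi> x \<partial>vol \<Omega>) - (\<integral>x. w' x * \<psi> x \<partial>vol \<Omega>)"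
      unfolding left_diff_distrib
      by (intro Bochner_Integration.integral_diff locally_L1_mult_integrable[OF \<Omega> _ K(1,2) c(1) K(3)] L)
    also have "\<dots> = - (\<integral>x. u x * partial i \<psi> x \<partial>vol \<Omega>) + (\<integral>x. u' x * partial i \<psi> x \<partial>vol \<Omega>)"
      using w w' \<psi> by (simp add: weak_partial_def)
    also have "(\<integral>x. u x * partial i \<psi> x \<partial>vol \<Omega>) = (\<integral>x. u' x * partial i \<psi> x \<partial>vol \<Omega>)"
    proof (rule integral_cong_AE)
      show "AE x in vol \<Omega>. u x * partial i \<psi> x = u' x * partial i \<psi> x"
        using eq by eventually_elim simp
    qed (rule m, rule L)+
    finally show "(\<integral>x. (w x - w' x) * \<psi> x \<partial>vol \<Omega>) = 0" by simp
  qed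
  then show ?thesis by eventually_elim simp
qed

lemma L2_imp_locally_L1:
  fixes u :: "'a::euclidean_space \<Rightarrow> real"
  assumes \<Omega>: "open \<Omega>" "bounded \<Omega>" and u: "u \<in> L2 (vol \<Omega>)"
  shows "locally_L1 \<Omega> u"
proof -
  have "(\<lambda>_. 1) \<in> L2 (vol \<Omega>)" using \<Omega> by (intro continuous_L2_vol) auto
  from L2_mult_integrable[OF this u] have "set_integrable lborel \<Omega> u"
    using \<Omega>(1) by (simp add: set_integrable_def integrable_restrict_space)
  then have "set_integrable lborel K u" if "compact K" "K \<subseteq> \<Omega>" for K
    by (rule set_integrable_subset) (use that in \<open>auto intro: borel_compact\<close>)
  then show ?thesis unfolding locally_L1_def by blast
qed

lemma smooth_L2_vol:
  assumes \<Omega>: "open \<Omega>" "bounded \<Omega>" and \<psi>: "smooth_on UNIV \<psi>" and i: "i \<in> Basis"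
  shows "\<psi> \<in> L2 (vol \<Omega>)" "partial i \<psi> \<in> L2 (vol \<Omega>)"
  using smooth_continuous[OF \<psi>] i by (auto intro!: continuous_L2_vol \<Omega>)

lemma H10_L2: "w \<in> H10 \<Omega> \<Longrightarrow> w \<in> L2 (vol \<Omega>)"
  by (auto simp: H10_def H1_tendsto_def L2_tendsto_def)

section \<open>Green's formula for Sobolev functions\<close>

text \<open>
  For test functions in place of \<open>U\<close> this is the definition of a weak derivative; both sides are
  continuous in the \<open>H^1\<close> norm.
\<close>

lemma green_H10:
  fixes \<Omega> :: "'a::euclidean_space set"
  assumes \<Omega>: "open \<Omega>" and i: "i \<in> Basis" and U: "U \<in> H10 \<Omega>" "weak_partial \<Omega> i U p" "p \<in> L2 (vol \<Omega>)"
    and F: "weak_partial \<Omega> i F Q" "F \<in> L2 (vol \<Omega>)" "Q \<in> L2 (vol \<Omega>)"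
  shows "(\<integral>x. F x * p x \<partial>vol \<Omega>) = - (\<integral>x. Q x * U x \<partial>vol \<Omega>)"
proof -
  obtain W where W: "\<And>n. W n \<in> test_functions \<Omega>" and H: "H1_tendsto \<Omega> W U" using U(1) by (auto simp: H10_def)
  obtain p' where p': "weak_partial \<Omega> i U p'" "L2_tendsto (vol \<Omega>) (\<lambda>n. partial i (W n)) p' sequentially"
    using H i by (auto simp: H1_tendsto_def)
  have p'2: "p' \<in> L2 (vol \<Omega>)" using p'(2) by (simp add: L2_tendsto_def)
  have ae: "AE x in vol \<Omega>. p x = p' x" by (rule weak_partial_unique[OF \<Omega> i U(2) p'(1)]) simp
  have 1: "(\<lambda>n. \<integral>x. F x * partial i (W n) x \<partial>vol \<Omega>) \<longlonglongrightarrow> (\<integral>x. F x * p' x \<partial>vol \<Omega>)"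
    by (rule L2_tendsto_integral_mult[OF L2_tendsto_const[OF F(2)] p'(2)])
  have 2: "(\<lambda>n. \<integral>x. Q x * W n x \<partial>vol \<Omega>) \<longlonglongrightarrow> (\<integral>x. Q x * U x \<partial>vol \<Omega>)"
    using H by (intro L2_tendsto_integral_mult[OF L2_tendsto_const[OF F(3)]]) (simp add: H1_tendsto_def)
  have "(\<integral>x. F x * partial i (W n) x \<partial>vol \<Omega>) = - (\<integral>x. Q x * W n x \<partial>vol \<Omega>)" for n
    using F(1) W[of n] by (simp add: weak_partial_def)
  with 1 have "(\<lambda>n. - (\<integral>x. Q x * W n x \<partial>vol \<Omega>)) \<longlonglongrightarrow> (\<integral>x. F x * p' x \<partial>vol \<Omega>)" by (simp only:)
  from LIMSEQ_unique[OF this tendsto_minus[OF 2]]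
  have "(\<integral>x. F x * p' x \<partial>vol \<Omega>) = - (\<integral>x. Q x * U x \<partial>vol \<Omega>)" .
  moreover have "(\<integral>x. F x * p x \<partial>vol \<Omega>) = (\<integral>x. F x * p' x \<partial>vol \<Omega>)"
  proof (rule integral_cong_AE)
    show "AE x in vol \<Omega>. F x * p x = F x * p' x" using ae by eventually_elim simp
  qed (use F(2) U(3) p'2 in \<open>auto dest!: L2_measurable\<close>)
  ultimately show ?thesis by simp
qed

text \<open>
  The surface measure is the restriction to the boundary of a finite Borel measure on the whole
  space, and Gauss's theorem is available for that measure.
\<close>

lemma surface_measure_properties:
  fixes \<Omega> :: "'a::euclidean_space set"
  assumes \<Omega>: "open \<Omega>" "bounded \<Omega>" "Ck_boundary 1 \<Omega>"
  shows "finite_measure (surface_measure \<Omega>)"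
    and "sets (surface_measure \<Omega>) = sets (restrict_space borel (frontier \<Omega>))"
    and "C1_upto \<Omega> f D \<Longrightarrow> i \<in> Basis \<Longrightarrow>
      (\<integral>x. D x \<bullet> i \<partial>vol \<Omega>) = (\<integral>x. f x * (outward_normal \<Omega> x \<bullet> i) \<partial>surface_measure \<Omega>)"
proof -
  obtain S where S: "sets S = sets borel" "finite_measure S"
      "\<And>p r b s h E. graph_chart 1 \<Omega> p r b s h \<Longrightarrow> E \<in> sets borel \<Longrightarrow> E \<subseteq> frontier \<Omega> \<inter> ball p r \<Longrightarrow>
        emeasure S E = emeasure (chart_measure b s h) E"
    using surface_measure_exists[OF \<Omega>] by metis
  have eq: "surface_measure \<Omega> = restrict_space S (frontier \<Omega>)"
    by (rule surface_measure_characterization[OF \<Omega> S(1,3)])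
  have fr: "frontier \<Omega> \<inter> space S \<in> sets S" using S(1) sets_eq_imp_space_eq[OF S(1)] by simp
  show "sets (surface_measure \<Omega>) = sets (restrict_space borel (frontier \<Omega>))"
    unfolding eq using S(1) by (rule sets_restrict_space_cong)
  show "finite_measure (surface_measure \<Omega>)"
    unfolding eq using S(2) by (rule finite_measure_restrict_space) (simp add: S(1))
  show "(\<integral>x. D x \<bullet> i \<partial>vol \<Omega>) = (\<integral>x. f x * (outward_normal \<Omega> x \<bullet> i) \<partial>surface_measure \<Omega>)"
    if "C1_upto \<Omega> f D" "i \<in> Basis"
  proof -
    have "(\<integral>x. D x \<bullet> i \<partial>vol \<Omega>) = (\<integral>x. indicator (frontier \<Omega>) x * (f x * (outward_normal \<Omega> x \<bullet> i)) \<partial>S)"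
      by (rule gauss[OF \<Omega> S(1,2) _ that]) (rule S(3))
    also have "\<dots> = (\<integral>x. f x * (outward_normal \<Omega> x \<bullet> i) \<partial>restrict_space S (frontier \<Omega>))"
      unfolding integral_restrict_space[OF fr] by (simp only: real_scaleR_def)
    finally show ?thesis unfolding eq .
  qed
qed

lemma space_surface_measure:
  assumes "open \<Omega>" "bounded \<Omega>" "Ck_boundary 1 \<Omega>"
  shows "space (surface_measure \<Omega>) = frontier \<Omega>"
  using sets_eq_imp_space_eq[OF surface_measure_properties(2)[OF assms]] by (simp add: space_restrict_space)

lemma continuous_measurable_surface:
  assumes "open \<Omega>" "bounded \<Omega>" "Ck_boundary 1 \<Omega>" "continuous_on (frontier \<Omega>) m"
  shows "m \<in> borel_measurable (surface_measure \<Omega>)"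
  using borel_measurable_continuous_on_restrict[OF assms(4)]
  by (simp add: measurable_cong_sets[OF surface_measure_properties(2)[OF assms(1-3)] refl])

text \<open>
  For smooth functions \<open>W\<close> and \<open>Y\<close> in place of \<open>P\<close> and \<open>V\<close> this is Gauss's theorem for \<open>a W Y\<close>.
  The approximations from the definition of traces converge in \<open>H^1\<close> in the domain and in \<open>L^2\<close>
  on the boundary, so every integral in that identity passes to the limit. The weak derivative
  \<open>Q\<close> is given abstractly, so it first has to be identified with the one that the product rule
  predicts.
\<close>

theorem green:
  fixes \<Omega> :: "'a::euclidean_space set"
  assumes \<Omega>: "open \<Omega>" "bounded \<Omega>" "Ck_boundary 1 \<Omega>" and i: "i \<in> Basis"
    and a: "C1_closure \<Omega> a"
    and P: "is_trace \<Omega> P \<beta>" and V: "is_trace \<Omega> V \<phi>"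
    and Q: "weak_partial \<Omega> i F Q" "Q \<in> L2 (vol \<Omega>)" "AE x in vol \<Omega>. F x = a x * P x"
    and R: "weak_partial \<Omega> i V R" "R \<in> L2 (vol \<Omega>)"
  shows "(\<integral>x. Q x * V x \<partial>vol \<Omega>) = - (\<integral>x. a x * P x * R x \<partial>vol \<Omega>) +
    (\<integral>x. a x * \<beta> x * \<phi> x * (outward_normal \<Omega> x \<bullet> i) \<partial>surface_measure \<Omega>)"
proof -
  let ?\<sigma> = "surface_measure \<Omega>"
  obtain Da where Da: "C1_upto \<Omega> a Da" using C1_closure_imp_C1_upto[OF a] by blast
  then have ac: "continuous_on (closure \<Omega>) a" and Dc: "continuous_on (closure \<Omega>) (\<lambda>x. Da x \<bullet> i)"
    by (auto simp: C1_upto_def intro: continuous_on_inner)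
  obtain Ca where Ca: "\<And>x. x \<in> closure \<Omega> \<Longrightarrow> \<bar>a x\<bar> \<le> Ca" using continuous_bounded_on_compact[OF compact_closure[THEN iffD2, OF \<Omega>(2)] ac] by blast
  obtain Cd where Cd: "\<And>x. x \<in> closure \<Omega> \<Longrightarrow> \<bar>Da x \<bullet> i\<bar> \<le> Cd" using continuous_bounded_on_compact[OF compact_closure[THEN iffD2, OF \<Omega>(2)] Dc] by blast
  have sp: "x \<in> closure \<Omega>" if "x \<in> space (vol \<Omega>)" for x using that closure_subset by (auto simp: space_restrict_space)
  have am: "a \<in> borel_measurable (vol \<Omega>)" and dm: "(\<lambda>x. Da x \<bullet> i) \<in> borel_measurable (vol \<Omega>)"
    using ac Dc closure_subset by (auto intro!: continuous_measurable_vol intro: continuous_on_subset)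
  obtain W where W: "\<And>n. smooth_on UNIV (W n)" "H1_tendsto \<Omega> W P" "L2_tendsto ?\<sigma> W \<beta> sequentially"
    using P by (auto simp: is_trace_def)
  obtain Y where Y: "\<And>n. smooth_on UNIV (Y n)" "H1_tendsto \<Omega> Y V" "L2_tendsto ?\<sigma> Y \<phi> sequentially"
    using V by (auto simp: is_trace_def)
  obtain Pi where Pi: "weak_partial \<Omega> i P Pi" "L2_tendsto (vol \<Omega>) (\<lambda>n. partial i (W n)) Pi sequentially"
    using W(2) i by (auto simp: H1_tendsto_def)
  obtain R' where R': "weak_partial \<Omega> i V R'" "L2_tendsto (vol \<Omega>) (\<lambda>n. partial i (Y n)) R' sequentially"
    using Y(2) i by (auto simp: H1_tendsto_def)
  have WP: "L2_tendsto (vol \<Omega>) W P sequentially" and YV: "L2_tendsto (vol \<Omega>) Y V sequentially"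
    using W Y by (auto simp: H1_tendsto_def)
  have L2s: "P \<in> L2 (vol \<Omega>)" "V \<in> L2 (vol \<Omega>)" "Pi \<in> L2 (vol \<Omega>)" "R' \<in> L2 (vol \<Omega>)"
    using WP YV Pi R' by (auto simp: L2_tendsto_def)
  have RR: "AE x in vol \<Omega>. R x = R' x" by (rule weak_partial_unique[OF \<Omega>(1) i R(1) R'(1)]) simp
  have aL2: "(\<lambda>x. a x * f x) \<in> L2 (vol \<Omega>)" "(\<lambda>x. (Da x \<bullet> i) * f x) \<in> L2 (vol \<Omega>)" if "f \<in> L2 (vol \<Omega>)" for f
  proof -
    show "(\<lambda>x. a x * f x) \<in> L2 (vol \<Omega>)"
      using Ca sp by (intro L2_bounded_mult[OF that am, of Ca]) (auto intro!: AE_I2)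
    show "(\<lambda>x. (Da x \<bullet> i) * f x) \<in> L2 (vol \<Omega>)"
      using Cd sp by (intro L2_bounded_mult[OF that dm, of Cd]) (auto intro!: AE_I2)
  qed
  have limA: "L2_tendsto (vol \<Omega>) (\<lambda>n x. a x * f n x) (\<lambda>x. a x * g x) sequentially"
    and limD: "L2_tendsto (vol \<Omega>) (\<lambda>n x. (Da x \<bullet> i) * f n x) (\<lambda>x. (Da x \<bullet> i) * g x) sequentially"
    if "L2_tendsto (vol \<Omega>) f g sequentially" for f g
    using that Ca Cd sp am dm by (auto intro!: L2_tendsto_bounded_mult)
  \<comment> \<open>The derivative of \<open>a P\<close> predicted by the product rule.\<close>
  define Q' where "Q' x = a x * Pi x + (Da x \<bullet> i) * P x" for x
  have Q'L2: "Q' \<in> L2 (vol \<Omega>)" unfolding Q'_def by (intro L2_add aL2 L2s)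
  have C1W: "C1_upto \<Omega> (\<lambda>x. a x * W n x) (\<lambda>x. a x *\<^sub>R grad (W n) x + W n x *\<^sub>R Da x)" for n
    by (intro C1_upto_mult Da C1_upto_smooth W)
  have "weak_partial \<Omega> i (\<lambda>x. a x * P x) Q'"
    unfolding weak_partial_def
  proof (intro conjI ballI)
    show "locally_L1 \<Omega> (\<lambda>x. a x * P x)" "locally_L1 \<Omega> Q'"
      using aL2 L2s Q'L2 by (auto intro!: L2_imp_locally_L1 \<Omega>)
    fix \<psi> assume \<psi>: "\<psi> \<in> test_functions \<Omega>"
    then obtain K where K: "compact K" "K \<subseteq> \<Omega>" "\<And>x. x \<notin> K \<Longrightarrow> \<psi> x = 0" "\<And>i x. x \<notin> K \<Longrightarrow> partial i \<psi> x = 0"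
      using test_function_support by blast
    note s = test_function_smooth[OF \<psi>]
    note \<psi>L2 = smooth_L2_vol[OF \<Omega>(1,2) s i]
    have step: "(\<integral>x. (a x * W n x) * partial i \<psi> x \<partial>vol \<Omega>) =
        - ((\<integral>x. (a x * partial i (W n) x) * \<psi> x \<partial>vol \<Omega>) + (\<integral>x. ((Da x \<bullet> i) * W n x) * \<psi> x \<partial>vol \<Omega>))" for n
    proof -
      note WL2 = smooth_L2_vol[OF \<Omega>(1,2) W(1) i, of n]
      have "(\<integral>x. ((a x * W n x) *\<^sub>R grad \<psi> x + \<psi> x *\<^sub>R (a x *\<^sub>R grad (W n) x + W n x *\<^sub>R Da x)) \<bullet> i \<partial>vol \<Omega>) = 0"
        by (rule integral_partial_interior_support[OF \<Omega>(1) C1_upto_mult[OF C1W C1_upto_smooth[OF s]] K(1,2) _ i])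
          (simp add: K(3))
      moreover have "((a x * W n x) *\<^sub>R grad \<psi> x + \<psi> x *\<^sub>R (a x *\<^sub>R grad (W n) x + W n x *\<^sub>R Da x)) \<bullet> i =
          (a x * W n x) * partial i \<psi> x + ((a x * partial i (W n) x) * \<psi> x + ((Da x \<bullet> i) * W n x) * \<psi> x)" for x
        using i by (simp add: inner_add_left grad_inner_Basis algebra_simps)
      ultimately have "(\<integral>x. (a x * W n x) * partial i \<psi> x + ((a x * partial i (W n) x) * \<psi> x + ((Da x \<bullet> i) * W n x) * \<psi> x) \<partial>vol \<Omega>) = 0"
        by (simp only:)
      moreover have "integrable (vol \<Omega>) (\<lambda>x. (a x * W n x) * partial i \<psi> x)"
        "integrable (vol \<Omega>) (\<lambda>x. (a x * partial i (W n) x) * \<psi> x)"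
        "integrable (vol \<Omega>) (\<lambda>x. ((Da x \<bullet> i) * W n x) * \<psi> x)"
        using aL2 WL2 \<psi>L2 by (auto intro!: L2_mult_integrable)
      ultimately show ?thesis by (simp only: Bochner_Integration.integral_add Bochner_Integration.integrable_add)
    qed
    have l1: "(\<lambda>n. \<integral>x. (a x * W n x) * partial i \<psi> x \<partial>vol \<Omega>) \<longlonglongrightarrow> (\<integral>x. (a x * P x) * partial i \<psi> x \<partial>vol \<Omega>)"
      by (intro L2_tendsto_integral_mult limA WP L2_tendsto_const \<psi>L2)
    have l2: "(\<lambda>n. \<integral>x. (a x * partial i (W n) x) * \<psi> x \<partial>vol \<Omega>) \<longlonglongrightarrow> (\<integral>x. (a x * Pi x) * \<psi> x \<partial>vol \<Omega>)"
      by (intro L2_tendsto_integral_mult limA Pi L2_tendsto_const \<psi>L2)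
    have l3: "(\<lambda>n. \<integral>x. ((Da x \<bullet> i) * W n x) * \<psi> x \<partial>vol \<Omega>) \<longlonglongrightarrow> (\<integral>x. ((Da x \<bullet> i) * P x) * \<psi> x \<partial>vol \<Omega>)"
      by (intro L2_tendsto_integral_mult limD WP L2_tendsto_const \<psi>L2)
    have "(\<integral>x. (a x * P x) * partial i \<psi> x \<partial>vol \<Omega>) =
        - ((\<integral>x. (a x * Pi x) * \<psi> x \<partial>vol \<Omega>) + (\<integral>x. ((Da x \<bullet> i) * P x) * \<psi> x \<partial>vol \<Omega>))"
      by (rule LIMSEQ_unique[OF l1]) (unfold step, intro tendsto_minus tendsto_add l2 l3)
    also have "(\<integral>x. (a x * Pi x) * \<psi> x \<partial>vol \<Omega>) + (\<integral>x. ((Da x \<bullet> i) * P x) * \<psi> x \<partial>vol \<Omega>) = (\<integral>x. Q' x * \<psi> x \<partial>vol \<Omega>)"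
      unfolding Q'_def distrib_right
      using aL2 L2s \<psi>L2 by (intro Bochner_Integration.integral_add[symmetric] L2_mult_integrable) auto
    finally show "(\<integral>x. a x * P x * partial i \<psi> x \<partial>vol \<Omega>) = - (\<integral>x. Q' x * \<psi> x \<partial>vol \<Omega>)" .
  qed
  from weak_partial_unique[OF \<Omega>(1) i Q(1) this Q(3)] have QQ: "AE x in vol \<Omega>. Q x = Q' x" .
  define m where "m x = a x * (outward_normal \<Omega> x \<bullet> i)" for x
  have mc: "continuous_on (frontier \<Omega>) m"
    unfolding m_def using ac continuous_outward_normal[OF \<Omega>(1,3)]
    by (intro continuous_intros) (auto simp: frontier_def intro: continuous_on_subset)
  obtain Cm where Cm: "\<And>x. x \<in> frontier \<Omega> \<Longrightarrow> \<bar>m x\<bar> \<le> Cm" using continuous_bounded_on_compact[OF compact_frontier_bounded[OF \<Omega>(2)] mc] by blast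
  have mm: "m \<in> borel_measurable ?\<sigma>" by (rule continuous_measurable_surface[OF \<Omega> mc])
  have step: "(\<integral>x. (a x * W n x) * partial i (Y n) x \<partial>vol \<Omega>) + ((\<integral>x. (a x * partial i (W n) x) * Y n x \<partial>vol \<Omega>) +
      (\<integral>x. ((Da x \<bullet> i) * W n x) * Y n x \<partial>vol \<Omega>)) = (\<integral>x. (m x * W n x) * Y n x \<partial>?\<sigma>)" for n
  proof -
    note WL2 = smooth_L2_vol[OF \<Omega>(1,2) W(1) i, of n]
    note YL2 = smooth_L2_vol[OF \<Omega>(1,2) Y(1) i, of n]
    have "(\<integral>x. ((a x * W n x) *\<^sub>R grad (Y n) x + Y n x *\<^sub>R (a x *\<^sub>R grad (W n) x + W n x *\<^sub>R Da x)) \<bullet> i \<partial>vol \<Omega>) =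
        (\<integral>x. ((a x * W n x) * Y n x) * (outward_normal \<Omega> x \<bullet> i) \<partial>?\<sigma>)"
      by (rule surface_measure_properties(3)[OF \<Omega> C1_upto_mult[OF C1W C1_upto_smooth[OF Y(1)]] i])
    moreover have "((a x * W n x) *\<^sub>R grad (Y n) x + Y n x *\<^sub>R (a x *\<^sub>R grad (W n) x + W n x *\<^sub>R Da x)) \<bullet> i =
        (a x * W n x) * partial i (Y n) x + ((a x * partial i (W n) x) * Y n x + ((Da x \<bullet> i) * W n x) * Y n x)" for x
      using i by (simp add: inner_add_left grad_inner_Basis algebra_simps)
    moreover have "((a x * W n x) * Y n x) * (outward_normal \<Omega> x \<bullet> i) = (m x * W n x) * Y n x" for x
      by (simp add: m_def)
    ultimately have "(\<integral>x. (a x * W n x) * partial i (Y n) x + ((a x * partial i (W n) x) * Y n x + ((Da x \<bullet> i) * W n x) * Y n x) \<partial>vol \<Omega>) =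
        (\<integral>x. (m x * W n x) * Y n x \<partial>?\<sigma>)"
      by (simp only:)
    moreover have "integrable (vol \<Omega>) (\<lambda>x. (a x * W n x) * partial i (Y n) x)"
      "integrable (vol \<Omega>) (\<lambda>x. (a x * partial i (W n) x) * Y n x)"
      "integrable (vol \<Omega>) (\<lambda>x. ((Da x \<bullet> i) * W n x) * Y n x)"
      using aL2 WL2 YL2 by (auto intro!: L2_mult_integrable)
    ultimately show ?thesis by (simp only: Bochner_Integration.integral_add Bochner_Integration.integrable_add)
  qed
  have r: "(\<lambda>n. \<integral>x. (m x * W n x) * Y n x \<partial>?\<sigma>) \<longlonglongrightarrow> (\<integral>x. (m x * \<beta> x) * \<phi> x \<partial>?\<sigma>)"
    by (intro L2_tendsto_integral_mult L2_tendsto_bounded_mult[where C=Cm] W Y mm Cm) (simp add: space_surface_measure[OF \<Omega>])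
  have l: "(\<lambda>n. (\<integral>x. (a x * W n x) * partial i (Y n) x \<partial>vol \<Omega>) + ((\<integral>x. (a x * partial i (W n) x) * Y n x \<partial>vol \<Omega>) +
      (\<integral>x. ((Da x \<bullet> i) * W n x) * Y n x \<partial>vol \<Omega>))) \<longlonglongrightarrow>
      (\<integral>x. (a x * P x) * R' x \<partial>vol \<Omega>) + ((\<integral>x. (a x * Pi x) * V x \<partial>vol \<Omega>) + (\<integral>x. ((Da x \<bullet> i) * P x) * V x \<partial>vol \<Omega>))"
    by (intro tendsto_add L2_tendsto_integral_mult limA limD WP YV Pi R')
  have "(\<integral>x. (a x * P x) * R' x \<partial>vol \<Omega>) + ((\<integral>x. (a x * Pi x) * V x \<partial>vol \<Omega>) + (\<integral>x. ((Da x \<bullet> i) * P x) * V x \<partial>vol \<Omega>)) =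
      (\<integral>x. (m x * \<beta> x) * \<phi> x \<partial>?\<sigma>)"
    by (rule LIMSEQ_unique[OF l[unfolded step] r])
  moreover have "(\<integral>x. (a x * Pi x) * V x \<partial>vol \<Omega>) + (\<integral>x. ((Da x \<bullet> i) * P x) * V x \<partial>vol \<Omega>) = (\<integral>x. Q' x * V x \<partial>vol \<Omega>)"
    unfolding Q'_def distrib_right
    using aL2 L2s by (intro Bochner_Integration.integral_add[symmetric] L2_mult_integrable) auto
  moreover have "(\<integral>x. Q' x * V x \<partial>vol \<Omega>) = (\<integral>x. Q x * V x \<partial>vol \<Omega>)"
  proof (rule integral_cong_AE)
    show "AE x in vol \<Omega>. Q' x * V x = Q x * V x" using QQ by eventually_elim simp
  qed (use Q(2) Q'L2 L2s in \<open>auto dest!: L2_measurable\<close>)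
  moreover have "(\<integral>x. (a x * P x) * R' x \<partial>vol \<Omega>) = (\<integral>x. (a x * P x) * R x \<partial>vol \<Omega>)"
  proof (rule integral_cong_AE)
    show "AE x in vol \<Omega>. (a x * P x) * R' x = (a x * P x) * R x" using RR by eventually_elim simp
  qed (use R(2) L2s am in \<open>auto dest!: L2_measurable\<close>)
  moreover have "(\<integral>x. (m x * \<beta> x) * \<phi> x \<partial>?\<sigma>) = (\<integral>x. a x * \<beta> x * \<phi> x * (outward_normal \<Omega> x \<bullet> i) \<partial>?\<sigma>)"
    by (simp add: m_def mult_ac)
  ultimately show ?thesis by simp
qed

text \<open>
  Green's second formula for \<open>A_0\<close>, at a fixed time. Since \<open>U\<close> vanishes on the boundary, moving
  both derivatives to \<open>V\<close> leaves the conormal derivative of \<open>U\<close> against the trace of \<open>V\<close> as the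
  only boundary term. The symmetry of \<open>a\<close> is used twice: to match the two volume terms and to
  bring the boundary term into the form of a conormal derivative.
\<close>

lemma elliptic_green:
  fixes \<Omega> :: "'a::euclidean_space set"
  assumes \<Omega>: "open \<Omega>" "bounded \<Omega>" "Ck_boundary 1 \<Omega>"
    and a: "\<And>i j. i \<in> Basis \<Longrightarrow> j \<in> Basis \<Longrightarrow> C1_closure \<Omega> (a i j)"
      "\<And>i j x. i \<in> Basis \<Longrightarrow> j \<in> Basis \<Longrightarrow> x \<in> closure \<Omega> \<Longrightarrow> a i j x = a j i x"
    and U: "U \<in> H10 \<Omega>" "\<And>i. i \<in> Basis \<Longrightarrow> weak_partial \<Omega> i U (p i)" "\<And>i. i \<in> Basis \<Longrightarrow> p i \<in> L2 (vol \<Omega>)"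
    and \<beta>: "\<And>i. i \<in> Basis \<Longrightarrow> is_trace \<Omega> (p i) (\<beta> i)"
    and p': "\<And>i. i \<in> Basis \<Longrightarrow> weak_partial \<Omega> i U (p' i)"
    and q: "\<And>i j. i \<in> Basis \<Longrightarrow> j \<in> Basis \<Longrightarrow> weak_partial \<Omega> i (\<lambda>x. a i j x * p' j x) (q i j)"
      "\<And>i j. i \<in> Basis \<Longrightarrow> j \<in> Basis \<Longrightarrow> q i j \<in> L2 (vol \<Omega>)"
    and V: "is_trace \<Omega> V \<phi>" "\<And>i. i \<in> Basis \<Longrightarrow> weak_partial \<Omega> i V (R i)" "\<And>i. i \<in> Basis \<Longrightarrow> R i \<in> L2 (vol \<Omega>)"
    and r: "\<And>i j. i \<in> Basis \<Longrightarrow> j \<in> Basis \<Longrightarrow> weak_partial \<Omega> i (\<lambda>x. a i j x * R j x) (r i j)"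
      "\<And>i j. i \<in> Basis \<Longrightarrow> j \<in> Basis \<Longrightarrow> r i j \<in> L2 (vol \<Omega>)"
  shows "(\<integral>x. (- (\<Sum>i\<in>Basis. \<Sum>j\<in>Basis. q i j x)) * V x \<partial>vol \<Omega>) =
    (\<integral>x. U x * (- (\<Sum>i\<in>Basis. \<Sum>j\<in>Basis. r i j x)) \<partial>vol \<Omega>) -
    (\<integral>x. (\<Sum>i\<in>Basis. \<Sum>j\<in>Basis. a i j x * \<beta> i x * (outward_normal \<Omega> x \<bullet> j)) * \<phi> x \<partial>surface_measure \<Omega>)"
proof -
  let ?\<sigma> = "surface_measure \<Omega>" and ?\<nu> = "outward_normal \<Omega>"
  have L2V: "V \<in> L2 (vol \<Omega>)" and L2\<phi>: "\<phi> \<in> L2 ?\<sigma>" using V(1) by (auto simp: is_trace_def H1_tendsto_def L2_tendsto_def)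
  have L2\<beta>: "\<beta> i \<in> L2 ?\<sigma>" if "i \<in> Basis" for i using \<beta>[OF that] by (auto simp: is_trace_def L2_tendsto_def)
  have L2U: "U \<in> L2 (vol \<Omega>)" by (rule H10_L2[OF U(1)])
  have ac: "continuous_on (closure \<Omega>) (a i j)" if "i \<in> Basis" "j \<in> Basis" for i j
    using a(1)[OF that] by (simp add: C1_closure_def)
  have aL2: "(\<lambda>x. a i j x * f x) \<in> L2 (vol \<Omega>)" if ij: "i \<in> Basis" "j \<in> Basis" and f: "f \<in> L2 (vol \<Omega>)" for i j f
  proof -
    obtain C where C: "\<And>x. x \<in> closure \<Omega> \<Longrightarrow> \<bar>a i j x\<bar> \<le> C" using continuous_bounded_on_compact[OF compact_closure[THEN iffD2, OF \<Omega>(2)] ac[OF ij]] by blast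
    have "a i j \<in> borel_measurable (vol \<Omega>)"
      using continuous_on_subset[OF ac[OF ij] closure_subset] by (rule continuous_measurable_vol)
    then show ?thesis
    proof (rule L2_bounded_mult[OF f], intro AE_I2)
      fix x assume "x \<in> space (vol \<Omega>)"
      then have "x \<in> closure \<Omega>" using closure_subset by (auto simp: space_restrict_space)
      then show "\<bar>a i j x\<bar> \<le> C" by (rule C)
    qed
  qed
  have mL2: "(\<lambda>x. (a i j x * (?\<nu> x \<bullet> k)) * f x) \<in> L2 ?\<sigma>" if ij: "i \<in> Basis" "j \<in> Basis" and f: "f \<in> L2 ?\<sigma>" for i j k f
  proof -
    have c: "continuous_on (frontier \<Omega>) (\<lambda>x. a i j x * (?\<nu> x \<bullet> k))"
      using ac[OF ij] continuous_outward_normal[OF \<Omega>(1,3)]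
      by (intro continuous_intros) (auto simp: frontier_def intro: continuous_on_subset)
    obtain C where C: "\<And>x. x \<in> frontier \<Omega> \<Longrightarrow> \<bar>a i j x * (?\<nu> x \<bullet> k)\<bar> \<le> C"
      using continuous_bounded_on_compact[OF compact_frontier_bounded[OF \<Omega>(2)] c] by blast
    show ?thesis
      using C by (intro L2_bounded_mult[OF f continuous_measurable_surface[OF \<Omega> c], of C] AE_I2)
        (simp add: space_surface_measure[OF \<Omega>])
  qed
  have gu: "(\<integral>x. q i j x * V x \<partial>vol \<Omega>) = - (\<integral>x. a i j x * p j x * R i x \<partial>vol \<Omega>) +
      (\<integral>x. a i j x * \<beta> j x * \<phi> x * (?\<nu> x \<bullet> i) \<partial>?\<sigma>)" if ij: "i \<in> Basis" "j \<in> Basis" for i j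
  proof (rule green[OF \<Omega> ij(1) a(1)[OF ij] \<beta>[OF ij(2)] V(1) q(1)[OF ij] q(2)[OF ij] _ V(2)[OF ij(1)] V(3)[OF ij(1)]])
    have "AE x in vol \<Omega>. p' j x = p j x" by (rule weak_partial_unique[OF \<Omega>(1) ij(2) p'[OF ij(2)] U(2)[OF ij(2)]]) simp
    then show "AE x in vol \<Omega>. a i j x * p' j x = a i j x * p j x" by eventually_elim simp
  qed
  have gv: "(\<integral>x. (a i j x * R j x) * p i x \<partial>vol \<Omega>) = - (\<integral>x. r i j x * U x \<partial>vol \<Omega>)" if ij: "i \<in> Basis" "j \<in> Basis" for i j
    by (rule green_H10[OF \<Omega>(1) ij(1) U(1) U(2)[OF ij(1)] U(3)[OF ij(1)] r(1)[OF ij] aL2[OF ij V(3)[OF ij(2)]] r(2)[OF ij]])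
  have sym: "(\<integral>x. a i j x * p j x * R i x \<partial>vol \<Omega>) = (\<integral>x. (a j i x * R i x) * p j x \<partial>vol \<Omega>)" if ij: "i \<in> Basis" "j \<in> Basis" for i j
  proof (rule Bochner_Integration.integral_cong[OF refl])
    fix x assume "x \<in> space (vol \<Omega>)"
    then have "x \<in> closure \<Omega>" using closure_subset by (auto simp: space_restrict_space)
    then show "a i j x * p j x * R i x = (a j i x * R i x) * p j x" using a(2)[OF ij] by simp
  qed
  have "(\<integral>x. (- (\<Sum>i\<in>Basis. \<Sum>j\<in>Basis. q i j x)) * V x \<partial>vol \<Omega>) = - (\<integral>x. (\<Sum>i\<in>Basis. \<Sum>j\<in>Basis. q i j x * V x) \<partial>vol \<Omega>)"
    by (simp add: sum_distrib_right)
  also have "\<dots> = - (\<Sum>i\<in>Basis. \<Sum>j\<in>Basis. \<integral>x. q i j x * V x \<partial>vol \<Omega>)"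
    using q(2) L2V by (simp add: Bochner_Integration.integral_sum Bochner_Integration.integrable_sum L2_mult_integrable)
  also have "\<dots> = (\<Sum>i\<in>Basis. \<Sum>j\<in>Basis. (\<integral>x. (a j i x * R i x) * p j x \<partial>vol \<Omega>)) -
      (\<Sum>i\<in>Basis. \<Sum>j\<in>Basis. \<integral>x. a i j x * \<beta> j x * \<phi> x * (?\<nu> x \<bullet> i) \<partial>?\<sigma>)"
    by (simp add: gu sym sum.distrib sum_negf sum_subtractf)
  also have "(\<Sum>i\<in>Basis. \<Sum>j\<in>Basis. (\<integral>x. (a j i x * R i x) * p j x \<partial>vol \<Omega>)) =
      - (\<Sum>i\<in>Basis. \<Sum>j\<in>Basis. \<integral>x. r i j x * U x \<partial>vol \<Omega>)"
    by (subst sum.swap) (simp add: gv sum_negf)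
  also have "\<dots> = - (\<integral>x. (\<Sum>i\<in>Basis. \<Sum>j\<in>Basis. r i j x * U x) \<partial>vol \<Omega>)"
    using r(2) L2U by (simp add: Bochner_Integration.integral_sum Bochner_Integration.integrable_sum L2_mult_integrable)
  also have "\<dots> = (\<integral>x. U x * (- (\<Sum>i\<in>Basis. \<Sum>j\<in>Basis. r i j x)) \<partial>vol \<Omega>)"
    by (simp add: sum_distrib_left mult.commute)
  also have "(\<Sum>i\<in>Basis. \<Sum>j\<in>Basis. \<integral>x. a i j x * \<beta> j x * \<phi> x * (?\<nu> x \<bullet> i) \<partial>?\<sigma>) =
      (\<integral>x. (\<Sum>i\<in>Basis. \<Sum>j\<in>Basis. ((a i j x * (?\<nu> x \<bullet> i)) * \<beta> j x) * \<phi> x) \<partial>?\<sigma>)"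
    using mL2 L2\<beta> L2\<phi> 
    by (simp add: Bochner_Integration.integral_sum Bochner_Integration.integrable_sum L2_mult_integrable)
      (simp add: mult_ac)
  also have "\<dots> = (\<integral>x. (\<Sum>i\<in>Basis. \<Sum>j\<in>Basis. a i j x * \<beta> i x * (?\<nu> x \<bullet> j)) * \<phi> x \<partial>?\<sigma>)"
  proof (rule Bochner_Integration.integral_cong[OF refl])
    fix x assume "x \<in> space ?\<sigma>"
    then have x: "x \<in> closure \<Omega>" by (simp add: space_surface_measure[OF \<Omega>] frontier_def)
    have "(\<Sum>i\<in>Basis. \<Sum>j\<in>Basis. ((a i j x * (?\<nu> x \<bullet> i)) * \<beta> j x) * \<phi> x) =
        (\<Sum>i\<in>Basis. \<Sum>j\<in>Basis. ((a j i x * (?\<nu> x \<bullet> j)) * \<beta> i x) * \<phi> x)"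
      by (rule sum.swap)
    also have "\<dots> = (\<Sum>i\<in>Basis. \<Sum>j\<in>Basis. (a i j x * \<beta> i x * (?\<nu> x \<bullet> j)) * \<phi> x)"
      by (intro sum.cong refl) (simp add: a(2)[OF _ _ x] mult_ac)
    finally show "(\<Sum>i\<in>Basis. \<Sum>j\<in>Basis. ((a i j x * (?\<nu> x \<bullet> i)) * \<beta> j x) * \<phi> x) =
        (\<Sum>i\<in>Basis. \<Sum>j\<in>Basis. a i j x * \<beta> i x * (?\<nu> x \<bullet> j)) * \<phi> x"
      by (simp add: sum_distrib_right)
  qed
  finally show ?thesis .
qed

section \<open>Fractional integrals\<close>

text \<open>
  Substituting \<open>s = \<tau> + (t - \<tau>) \<sigma>\<close> gives the Beta integral.
\<close>

lemma frac_kernel_integral: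
  fixes a b \<tau> t :: real
  assumes "a > 0" "b > 0" "\<tau> < t"
  shows "has_bochner_integral lborel (\<lambda>s. indicator {\<tau><..<t} s * ((t - s) powr (a - 1) * (s - \<tau>) powr (b - 1)))
    ((t - \<tau>) powr (a + b - 1) * Beta a b)"
proof -
  define c where "c = t - \<tau>"
  have c: "c > 0" using assms by (simp add: c_def)
  define k where "k s = indicator {0..1} s *\<^sub>R (s powr (b - 1) * (1 - s) powr (a - 1))" for s :: real
  define K where "K s = indicator {\<tau><..<t} s * ((t - s) powr (a - 1) * (s - \<tau>) powr (b - 1))" for s
  have K: "K (\<tau> + c * s) = c powr (a + b - 2) * k s" for s
  proof (cases "0 < s \<and> s < 1")
    case True
    then have "0 < c * s" "c * s < c * 1" using c by (auto intro: mult_strict_left_mono)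
    then have "\<tau> + c * s \<in> {\<tau><..<t}" by (simp add: c_def)
    moreover have "t - (\<tau> + c * s) = c * (1 - s)" by (simp add: c_def algebra_simps)
    moreover have "c powr (a - 1) * c powr (b - 1) = c powr (a + b - 2)"
      using powr_add[of c "a - 1" "b - 1"] by (simp add: algebra_simps)
    ultimately show ?thesis using True c by (simp add: K_def k_def powr_mult mult_ac)
  next
    case False
    then have "\<not> (0 < c * s \<and> c * s < c)" using c by (simp add: zero_less_mult_iff mult_less_cancel_left2)
    then have "\<tau> + c * s \<notin> {\<tau><..<t}" by (auto simp: c_def)
    moreover have "k s = 0" using False by (cases "s = 0 \<or> s = 1") (auto simp: k_def split: split_indicator)
    ultimately show ?thesis by (simp add: K_def)
  qed
  have si: "set_integrable lborel {0..1} (\<lambda>s. s powr (b - 1) * (1 - s) powr (a - 1))"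
    using integrable_Beta[of b a] assms by simp
  then have ik: "integrable lborel k" by (simp add: set_integrable_def k_def[abs_def])
  have "integral\<^sup>L lborel k = Beta b a"
    using set_borel_integral_eq_integral(2)[OF si] has_integral_Beta_real[of b a] assms
    by (simp add: set_lebesgue_integral_def k_def[abs_def] integral_unique)
  then have vk: "integral\<^sup>L lborel k = Beta a b" by (simp add: Beta_commute)
  have "integrable lborel (\<lambda>s. K (\<tau> + c * s))" unfolding K using ik by simp
  then have iK: "integrable lborel K" using c by (simp add: lborel_integrable_real_affine_iff)
  have "integral\<^sup>L lborel K = \<bar>c\<bar> *\<^sub>R (\<integral>s. K (\<tau> + c * s) \<partial>lborel)"
    using c by (intro lborel_integral_real_affine) simp
  also have "\<dots> = (c * c powr (a + b - 2)) * Beta a b" unfolding K using c vk by simp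
  also have "c * c powr (a + b - 2) = c powr (a + b - 1)"
    using c powr_add[of c 1 "a + b - 2"] by simp
  finally show ?thesis using iK unfolding has_bochner_integral_iff K_def[symmetric] c_def[symmetric]
    by (simp add: K_def[abs_def])
qed

lemma frac_int_cong_AE:
  assumes f: "f \<in> borel_measurable (vol {0<..<T})" "g \<in> borel_measurable (vol {0<..<T})"
    and eq: "AE s in vol {0<..<T}. f s = g s" and t: "t \<le> T"
  shows "frac_int \<gamma> f t = frac_int \<gamma> g t"
proof -
  have [measurable]: "(\<lambda>s. indicator {0<..<T} s *\<^sub>R f s) \<in> borel_measurable borel"
    "(\<lambda>s. indicator {0<..<T} s *\<^sub>R g s) \<in> borel_measurable borel"
    using f by (simp_all add: borel_measurable_restrict_space_iff)
  have ind: "indicator {0<..<t} s *\<^sub>R ((t - s) powr (\<gamma> - 1) * h s) =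
      indicator {0<..<t} s * ((t - s) powr (\<gamma> - 1) * (indicator {0<..<T} s *\<^sub>R h s))" for s and h :: "real \<Rightarrow> real"
    using t by (auto split: split_indicator)
  have "(LINT s:{0<..<t}|lborel. (t - s) powr (\<gamma> - 1) * f s) = (LINT s:{0<..<t}|lborel. (t - s) powr (\<gamma> - 1) * g s)"
    unfolding set_lebesgue_integral_def ind
  proof (rule integral_cong_AE)
    show "AE s in lborel. indicator {0<..<t} s * ((t - s) powr (\<gamma> - 1) * (indicator {0<..<T} s *\<^sub>R f s)) =
        indicator {0<..<t} s * ((t - s) powr (\<gamma> - 1) * (indicator {0<..<T} s *\<^sub>R g s))"
      using eq[unfolded AE_vol_iff[OF open_greaterThanLessThan]] by eventually_elim (auto split: split_indicator)
  qed measurable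
  then show ?thesis by (simp add: frac_int_def)
qed

lemma frac_int_measurable:
  assumes [measurable]: "w \<in> borel_measurable borel"
  shows "frac_int \<gamma> w \<in> borel_measurable borel"
proof -
  have eq: "indicator {0<..<t} s *\<^sub>R ((t - s) powr (\<gamma> - 1) * w s) =
      (if 0 < s \<and> s < t then (t - s) powr (\<gamma> - 1) * w s else 0)" for t s
    by (auto split: split_indicator)
  show ?thesis
    unfolding frac_int_def[abs_def] set_lebesgue_integral_def eq by measurable
qed

text \<open>
  By Fubini's theorem the composition has the kernel computed above. The condition \<open>a + b \<ge> 1\<close>
  keeps that kernel bounded, so the identity holds for every \<open>t\<close> and every integrable \<open>w\<close>.
\<close>

lemma frac_int_semigroup:
  assumes ab: "a > 0" "b > 0" "a + b \<ge> 1" and w: "integrable lborel w"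
  shows "frac_int a (frac_int b w) t = frac_int (a + b) w t"
    and "set_integrable lborel {0<..<t} (\<lambda>s. (t - s) powr (a - 1) * frac_int b w s)"
proof -
  have [measurable]: "w \<in> borel_measurable borel" using borel_measurable_integrable[OF w] by simp
  define K where "K \<tau> s = indicator {\<tau><..<t} s * ((t - s) powr (a - 1) * (s - \<tau>) powr (b - 1))" for \<tau> s :: real
  have Kif: "K \<tau> s = (if \<tau> < s \<and> s < t then (t - s) powr (a - 1) * (s - \<tau>) powr (b - 1) else 0)" for \<tau> s
    by (auto simp: K_def split: split_indicator)
  have Kint: "has_bochner_integral lborel (K \<tau>) (if \<tau> < t then (t - \<tau>) powr (a + b - 1) * Beta a b else 0)" for \<tau>
  proof (cases "\<tau> < t")
    case True
    with frac_kernel_integral[OF ab(1,2) True] show ?thesis by (simp add: K_def[abs_def])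
  next
    case False
    then have "K \<tau> = (\<lambda>_. 0)" by (auto simp: fun_eq_iff Kif)
    then show ?thesis using False by (simp add: has_bochner_integral_zero)
  qed
  have Bpos: "0 \<le> Beta a b" using ab by (simp add: Beta_def Gamma_real_nonneg less_imp_le)
  \<comment> \<open>The integrand of the double integral over \<open>0 < \<tau> < s < t\<close>.\<close>
  define f where "f \<tau> s = indicator {0<..<t} \<tau> * w \<tau> * K \<tau> s" for \<tau> s
  have fif: "f \<tau> s = (if 0 < \<tau> \<and> \<tau> < s \<and> s < t then w \<tau> * ((t - s) powr (a - 1) * (s - \<tau>) powr (b - 1)) else 0)" for \<tau> s
    by (auto simp: f_def Kif split: split_indicator)
  have meas: "case_prod f \<in> borel_measurable (lborel \<Otimes>\<^sub>M lborel)"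
    unfolding fif[abs_def] case_prod_beta' by measurable
  have int: "integrable (lborel \<Otimes>\<^sub>M lborel) (case_prod f)"
  proof (rule lborel_pair.Fubini_integrable[OF meas])
    have n: "norm (case (\<tau>, s) of (x, y) \<Rightarrow> f x y) = indicator {0<..<t} \<tau> * \<bar>w \<tau>\<bar> * K \<tau> s" for \<tau> s
      by (auto simp: f_def Kif abs_mult split: split_indicator)
    have v: "(\<integral>s. norm (case (\<tau>, s) of (x, y) \<Rightarrow> f x y) \<partial>lborel) =
        indicator {0<..<t} \<tau> * ((t - \<tau>) powr (a + b - 1) * Beta a b) * \<bar>w \<tau>\<bar>" for \<tau>
      unfolding n using has_bochner_integral_integral_eq[OF Kint[of \<tau>]] by (auto split: split_indicator)
    show "integrable lborel (\<lambda>\<tau>. \<integral>s. norm (case (\<tau>, s) of (x, y) \<Rightarrow> f x y) \<partial>lborel)"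
      unfolding v
    proof (rule Bochner_Integration.integrable_bound)
      show "integrable lborel (\<lambda>\<tau>. (\<bar>t\<bar> powr (a + b - 1) * Beta a b) * w \<tau>)" using w by simp
      show "AE \<tau> in lborel. norm (indicator {0<..<t} \<tau> * ((t - \<tau>) powr (a + b - 1) * Beta a b) * \<bar>w \<tau>\<bar>)
          \<le> norm (\<bar>t\<bar> powr (a + b - 1) * Beta a b * w \<tau>)"
      proof (intro AE_I2)
        fix \<tau>
        show "norm (indicator {0<..<t} \<tau> * ((t - \<tau>) powr (a + b - 1) * Beta a b) * \<bar>w \<tau>\<bar>)
          \<le> norm (\<bar>t\<bar> powr (a + b - 1) * Beta a b * w \<tau>)"
        proof (cases "\<tau> \<in> {0<..<t}")
          case True
          then have "(t - \<tau>) powr (a + b - 1) \<le> \<bar>t\<bar> powr (a + b - 1)" using ab by (intro powr_mono2) auto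
          then show ?thesis using True Bpos by (simp add: abs_mult mult_right_mono)
        qed simp
      qed
    qed simp
    show "AE \<tau> in lborel. integrable lborel (\<lambda>s. case (\<tau>, s) of (x, y) \<Rightarrow> f x y)"
      using Kint by (auto intro!: AE_I2 simp: f_def has_bochner_integral_iff)
  qed
  have inner1: "(\<integral>s. f \<tau> s \<partial>lborel) = Beta a b * (indicator {0<..<t} \<tau> *\<^sub>R ((t - \<tau>) powr (a + b - 1) * w \<tau>))" for \<tau>
    unfolding f_def using has_bochner_integral_integral_eq[OF Kint[of \<tau>]] by (auto split: split_indicator)
  have inner2: "(\<integral>\<tau>. f \<tau> s \<partial>lborel) = Gamma b * (indicator {0<..<t} s *\<^sub>R ((t - s) powr (a - 1) * frac_int b w s))" for s
  proof (cases "s \<in> {0<..<t}")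
    case True
    have "(\<integral>\<tau>. f \<tau> s \<partial>lborel) = (\<integral>\<tau>. (t - s) powr (a - 1) * (indicator {0<..<s} \<tau> *\<^sub>R ((s - \<tau>) powr (b - 1) * w \<tau>)) \<partial>lborel)"
      using True by (intro Bochner_Integration.integral_cong) (auto simp: fif split: split_indicator)
    also have "\<dots> = (t - s) powr (a - 1) * (Gamma b * frac_int b w s)"
      using Gamma_real_pos[OF ab(2)] by (simp add: frac_int_def set_lebesgue_integral_def)
    finally show ?thesis using True by simp
  next
    case False
    then have "f \<tau> s = 0" for \<tau> by (auto simp: fif)
    then show ?thesis using False by simp
  qed
  have G: "Gamma a > 0" "Gamma b > 0" "Gamma (a + b) > 0" using ab by (auto intro: Gamma_real_pos)
  have "integrable lborel (\<lambda>s. \<integral>\<tau>. f \<tau> s \<partial>lborel)" by (rule lborel_pair.integrable_snd[OF int])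
  then show "set_integrable lborel {0<..<t} (\<lambda>s. (t - s) powr (a - 1) * frac_int b w s)"
    unfolding inner2 set_integrable_def using G by simp
  have "(\<integral>s. \<integral>\<tau>. f \<tau> s \<partial>lborel \<partial>lborel) = (\<integral>\<tau>. \<integral>s. f \<tau> s \<partial>lborel \<partial>lborel)"
    by (rule lborel_pair.Fubini_integral[OF int])
  then have "Gamma b * (LINT s:{0<..<t}|lborel. (t - s) powr (a - 1) * frac_int b w s) =
      Beta a b * (LINT s:{0<..<t}|lborel. (t - s) powr (a + b - 1) * w s)"
    unfolding inner1 inner2 set_lebesgue_integral_def by simp
  then show "frac_int a (frac_int b w) t = frac_int (a + b) w t"
    using G by (simp add: frac_int_def[of a] frac_int_def[of "a + b"] Beta_def field_simps)
qed

section \<open>Weak time derivatives of fractional integrals\<close>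

lemma partial_real: "(f has_real_derivative d) (at x) \<Longrightarrow> partial 1 f x = d"
  by (subst partial_eq[of f "\<lambda>h. d * h"]) (auto simp: has_field_derivative_def)

lemma smooth_real_derivative:
  assumes "smooth_on UNIV (\<psi> :: real \<Rightarrow> real)"
  shows "(\<psi> has_real_derivative partial 1 \<psi> t) (at t)"
proof -
  have "Ck_on 1 UNIV \<psi>" using assms by (simp add: smooth_on_def)
  from Ck_on_1_UNIV(3)[OF this, of t] have "(\<psi> has_derivative (\<lambda>h. grad \<psi> t * h)) (at t)" by simp
  then have d: "(\<psi> has_real_derivative grad \<psi> t) (at t)" by (simp add: has_field_derivative_def)
  then show ?thesis using partial_real[OF d] by simp
qed

text \<open>
  Exchange the order of integration and integrate the derivative of the test function.
\<close>

lemma weak_partial_frac_int_1: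
  assumes T: "T > 0" and w: "integrable lborel w"
  shows "weak_partial {0<..<T} 1 (frac_int 1 w) w"
proof -
  have [measurable]: "w \<in> borel_measurable borel" using borel_measurable_integrable[OF w] by simp
  have fi: "frac_int 1 w t = (\<integral>\<tau>. (if 0 < \<tau> \<and> \<tau> < t then w \<tau> else 0) \<partial>lborel)" for t
  proof -
    have "frac_int 1 w t = (\<integral>\<tau>. indicator {0<..<t} \<tau> *\<^sub>R ((t - \<tau>) powr 0 * w \<tau>) \<partial>lborel)"
      by (simp add: frac_int_def set_lebesgue_integral_def)
    also have "\<dots> = (\<integral>\<tau>. (if 0 < \<tau> \<and> \<tau> < t then w \<tau> else 0) \<partial>lborel)"
      by (rule Bochner_Integration.integral_cong) (auto split: split_indicator)
    finally show ?thesis .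
  qed
  have bd: "\<bar>frac_int 1 w t\<bar> \<le> (\<integral>\<tau>. \<bar>w \<tau>\<bar> \<partial>lborel)" for t
  proof -
    have i: "integrable lborel (\<lambda>\<tau>. if 0 < \<tau> \<and> \<tau> < t then w \<tau> else 0)"
      by (rule Bochner_Integration.integrable_bound[OF w]) auto
    have "\<bar>frac_int 1 w t\<bar> \<le> (\<integral>\<tau>. \<bar>if 0 < \<tau> \<and> \<tau> < t then w \<tau> else 0\<bar> \<partial>lborel)"
      unfolding fi by (rule integral_abs_bound)
    also have "\<dots> \<le> (\<integral>\<tau>. \<bar>w \<tau>\<bar> \<partial>lborel)"
      by (rule integral_mono[OF integrable_abs[OF i] integrable_abs[OF w]]) simp
    finally show ?thesis .
  qed
  have "integrable lborel (\<lambda>x. indicator K x *\<^sub>R w x)" if "compact K" for K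
    by (rule integrable_mult_indicator[OF _ w]) (use that in \<open>simp add: borel_compact\<close>)
  then have L: "locally_L1 {0<..<T} w" unfolding locally_L1_def set_integrable_def by blast
  have [measurable]: "frac_int 1 w \<in> borel_measurable borel" by (rule frac_int_measurable) simp
  have L': "locally_L1 {0<..<T} (frac_int 1 w)"
    unfolding locally_L1_def set_integrable_def
  proof (intro allI impI)
    fix K assume K: "compact K \<and> K \<subseteq> {0<..<T}"
    then have [measurable]: "K \<in> sets borel" by (auto intro: borel_compact)
    show "integrable lborel (\<lambda>t. indicator K t *\<^sub>R frac_int 1 w t)"
    proof (rule Bochner_Integration.integrable_bound)
      show "integrable lborel (\<lambda>t. indicator K t * (\<integral>\<tau>. \<bar>w \<tau>\<bar> \<partial>lborel))"
        using K emeasure_compact_finite[of K] by (intro integrable_mult_left integrable_real_indicator) auto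
      show "AE t in lborel. norm (indicator K t *\<^sub>R frac_int 1 w t) \<le> norm (indicator K t * (\<integral>\<tau>. \<bar>w \<tau>\<bar> \<partial>lborel))"
        using bd by (auto intro!: AE_I2 order_trans[OF bd abs_ge_self] split: split_indicator)
    qed measurable
  qed
  show ?thesis unfolding weak_partial_def
  proof (intro conjI L L' ballI)
    fix \<psi> assume \<psi>: "\<psi> \<in> test_functions {0<..<T}"
    then obtain K where K: "compact K" "K \<subseteq> {0<..<T}" "\<And>x. x \<notin> K \<Longrightarrow> \<psi> x = 0" "\<And>i x. x \<notin> K \<Longrightarrow> partial i \<psi> x = 0"
      using test_function_support by blast
    note s = test_function_smooth[OF \<psi>]
    have c: "continuous_on UNIV \<psi>" "continuous_on UNIV (partial 1 \<psi>)" using smooth_continuous[OF s] by auto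
    have [measurable]: "\<psi> \<in> borel_measurable borel" "partial 1 \<psi> \<in> borel_measurable borel"
      using c by (auto intro: borel_measurable_continuous_onI)
    define f where "f \<tau> t = (if 0 < \<tau> \<and> \<tau> < t \<and> t < T then w \<tau> * partial 1 \<psi> t else 0)" for \<tau> t
    obtain C where "\<And>x. x \<in> K \<Longrightarrow> \<bar>partial 1 \<psi> x\<bar> \<le> C"
      using continuous_bounded_on_compact[OF K(1) continuous_on_subset[OF c(2) subset_UNIV]] by blast
    then have C: "\<bar>partial 1 \<psi> x\<bar> \<le> \<bar>C\<bar>" for x using K(4)[of x 1] by (cases "x \<in> K") force+
    have iI: "integrable lborel (indicator {0<..<T} :: real \<Rightarrow> real)"
      using T by (intro integrable_real_indicator) auto
    have int: "integrable (lborel \<Otimes>\<^sub>M lborel) (case_prod f)"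
    proof (rule Bochner_Integration.integrable_bound)
      show "integrable (lborel \<Otimes>\<^sub>M lborel) (\<lambda>(\<tau>, t). w \<tau> * (\<bar>C\<bar> * indicator {0<..<T} t))"
      proof (rule lborel_pair.Fubini_integrable)
        show "integrable lborel (\<lambda>\<tau>. \<integral>t. norm (case (\<tau>, t) of (\<tau>, t) \<Rightarrow> w \<tau> * (\<bar>C\<bar> * indicator {0<..<T} t)) \<partial>lborel)"
          using w by (simp add: abs_mult)
      qed (use w iI in auto)
      show "AE z in lborel \<Otimes>\<^sub>M lborel. norm (case z of (\<tau>, t) \<Rightarrow> f \<tau> t) \<le> norm (case z of (\<tau>, t) \<Rightarrow> w \<tau> * (\<bar>C\<bar> * indicator {0<..<T} t))"
        using C by (auto intro!: AE_I2 mult_left_mono simp: f_def abs_mult)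
      show "case_prod f \<in> borel_measurable (lborel \<Otimes>\<^sub>M lborel)"
        unfolding f_def[abs_def] case_prod_beta' by measurable
    qed
    have inner1: "(\<integral>\<tau>. f \<tau> t \<partial>lborel) = indicator {0<..<T} t *\<^sub>R (frac_int 1 w t * partial 1 \<psi> t)" for t
    proof (cases "t \<in> {0<..<T}")
      case True
      have "(\<integral>\<tau>. f \<tau> t \<partial>lborel) = (\<integral>\<tau>. (if 0 < \<tau> \<and> \<tau> < t then w \<tau> else 0) * partial 1 \<psi> t \<partial>lborel)"
        using True by (intro Bochner_Integration.integral_cong) (auto simp: f_def)
      then show ?thesis using True by (simp add: fi)
    next
      case False
      then have "f \<tau> t = 0" for \<tau> by (auto simp: f_def)
      then show ?thesis using False by simp
    qed
    have inner2: "(\<integral>t. f \<tau> t \<partial>lborel) = - (indicator {0<..<T} \<tau> *\<^sub>R (w \<tau> * \<psi> \<tau>))" for \<tau>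
    proof (cases "\<tau> \<in> {0<..<T}")
      case True
      have "(\<integral>t. f \<tau> t \<partial>lborel) = (\<integral>t. w \<tau> * (indicator {\<tau>..T} t *\<^sub>R partial 1 \<psi> t) \<partial>lborel)"
      proof (rule integral_cong_AE)
        have "AE t in lborel. t \<noteq> \<tau>" "AE t in lborel. t \<noteq> T" by (rule AE_lborel_singleton)+
        then show "AE t in lborel. f \<tau> t = w \<tau> * (indicator {\<tau>..T} t *\<^sub>R partial 1 \<psi> t)"
          by eventually_elim (use True in \<open>auto simp: f_def split: split_indicator\<close>)
      qed (auto simp: f_def)
      also have "\<dots> = w \<tau> * (\<psi> T - \<psi> \<tau>)"
      proof -
        have "(\<integral>t. indicator {\<tau>..T} t *\<^sub>R partial 1 \<psi> t \<partial>lborel) = \<psi> T - \<psi> \<tau>"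
        proof (rule integral_FTC_Icc)
          show "\<tau> \<le> T" using True by simp
          show "(\<psi> has_vector_derivative partial 1 \<psi> x) (at x within {\<tau>..T})" for x
            using smooth_real_derivative[OF s, of x]
            by (simp add: has_real_derivative_iff_has_vector_derivative has_vector_derivative_at_within)
          show "continuous_on {\<tau>..T} (partial 1 \<psi>)" using c(2) by (auto intro: continuous_on_subset)
        qed
        then show ?thesis by simp
      qed
      also have "\<psi> T = 0" by (rule K(3)) (use K(2) in auto)
      finally show ?thesis using True by simp
    next
      case False
      then have "f \<tau> t = 0" for t by (auto simp: f_def)
      then show ?thesis using False by simp
    qed
    have "(\<integral>t. \<integral>\<tau>. f \<tau> t \<partial>lborel \<partial>lborel) = (\<integral>\<tau>. \<integral>t. f \<tau> t \<partial>lborel \<partial>lborel)"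
      by (rule lborel_pair.Fubini_integral[OF int])
    then show "(\<integral>x. frac_int 1 w x * partial 1 \<psi> x \<partial>vol {0<..<T}) = - (\<integral>x. w x * \<psi> x \<partial>vol {0<..<T})"
      unfolding inner1 inner2 by (simp add: integral_restrict_space)
  qed
qed

lemma integral_vol_reflect:
  fixes f :: "real \<Rightarrow> real"
  shows "(\<integral>t. f (T - t) \<partial>vol {0<..<T}) = (\<integral>t. f t \<partial>vol {0<..<T})"
proof -
  have "(\<integral>t. f t \<partial>vol {0<..<T}) = (\<integral>t. indicator {0<..<T} t *\<^sub>R f t \<partial>lborel)"
    by (simp add: integral_restrict_space)
  also have "\<dots> = (\<integral>t. indicator {0<..<T} (T + (-1) * t) *\<^sub>R f (T + (-1) * t) \<partial>lborel)"
    by (subst lborel_integral_real_affine[of "-1" _ T]) simp_all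
  also have "\<dots> = (\<integral>t. indicator {0<..<T} t *\<^sub>R f (T - t) \<partial>lborel)"
    by (rule Bochner_Integration.integral_cong) (auto split: split_indicator)
  finally show ?thesis by (simp add: integral_restrict_space)
qed

lemma AE_vol_reflect:
  assumes "AE t in vol {0<..<T::real}. P t" shows "AE t in vol {0<..<T}. P (T - t)"
proof -
  have "lborel = density (distr lborel borel (\<lambda>x. T + (-1) * x)) (\<lambda>_. ennreal \<bar>-1\<bar>)"
    by (rule lborel_real_affine) simp
  then have d: "lborel = distr lborel borel (\<lambda>x. T - x)" by (simp add: density_1)
  have "AE t in distr lborel borel (\<lambda>x. T - x). t \<in> {0<..<T} \<longrightarrow> P t"
    using assms unfolding AE_vol_iff[OF open_greaterThanLessThan] d[symmetric] .
  then have "AE t in lborel. T - t \<in> {0<..<T} \<longrightarrow> P (T - t)"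
    by (rule AE_distrD[rotated]) simp
  then show ?thesis unfolding AE_vol_iff[OF open_greaterThanLessThan] by eventually_elim auto
qed

lemma Ck_on_reflect:
  "Ck_on k UNIV \<psi> \<Longrightarrow> Ck_on k UNIV (\<lambda>t::real. \<psi> (T - t))"
proof (induction k arbitrary: \<psi>)
  case 0
  then have "continuous_on UNIV \<psi>" by simp
  from continuous_on_compose2[OF this, of UNIV "\<lambda>t. T - t"] show ?case
    by (simp add: continuous_intros)
next
  case (Suc k)
  have d: "((\<lambda>t. \<psi> (T - t)) has_real_derivative (- 1) * partial 1 \<psi> (T - t)) (at t)" for t
  proof -
    have "\<psi> differentiable (at (T - t))" using Suc.prems by simp
    then obtain l where l: "(\<psi> has_real_derivative l) (at (T - t))" by (auto simp: real_differentiable_def)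
    have "((\<lambda>t. T - t) has_real_derivative (- 1)) (at t)" by (auto intro!: derivative_eq_intros)
    from DERIV_chain2[OF l this] show ?thesis using partial_real[OF l] by (simp add: mult.commute)
  qed
  have p: "partial 1 (\<lambda>t. \<psi> (T - t)) = (\<lambda>t. (- 1) * partial 1 \<psi> (T - t))"
    by (rule ext) (rule partial_real[OF d])
  have "Ck_on k UNIV (partial 1 \<psi>)" using Suc.prems by simp
  then have "Ck_on k UNIV (\<lambda>t. partial 1 \<psi> (T - t))" by (rule Suc.IH)
  then have "Ck_on k UNIV (partial 1 (\<lambda>t. \<psi> (T - t)))" unfolding p by (intro Ck_on_mult Ck_on_const)
  moreover have "(\<lambda>t. \<psi> (T - t)) differentiable (at t)" for t
    using d[of t] by (auto simp: real_differentiable_def)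
  ultimately show ?case by simp
qed

lemma test_functions_reflect:
  assumes "\<psi> \<in> test_functions {0<..<T::real}"
  shows "(\<lambda>t. \<psi> (T - t)) \<in> test_functions {0<..<T}" "partial 1 (\<lambda>t. \<psi> (T - t)) t = - partial 1 \<psi> (T - t)"
proof -
  obtain K where K: "compact K" "K \<subseteq> {0<..<T}" "\<And>x. x \<notin> K \<Longrightarrow> \<psi> x = 0" "\<And>i x. x \<notin> K \<Longrightarrow> partial i \<psi> x = 0"
    using test_function_support[OF assms] by blast
  have s: "smooth_on UNIV \<psi>" using assms by (rule test_function_smooth)
  let ?K = "(\<lambda>t. T - t) ` K"
  have cK: "compact ?K" using K(1) by (intro compact_continuous_image continuous_intros)
  have "{t. \<psi> (T - t) \<noteq> 0} \<subseteq> ?K"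
  proof
    fix t assume "t \<in> {t. \<psi> (T - t) \<noteq> 0}"
    then have "T - t \<in> K" using K(3) by blast
    then have "T - (T - t) \<in> ?K" by (rule imageI)
    then show "t \<in> ?K" by simp
  qed
  then have cl: "closure {t. \<psi> (T - t) \<noteq> 0} \<subseteq> ?K" using cK by (intro closure_minimal compact_imp_closed)
  have "?K \<subseteq> {0<..<T}" using K(2) by (auto dest!: subsetD)
  moreover have "compact (closure {t. \<psi> (T - t) \<noteq> 0})"
    using compact_Int_closed[OF cK closed_closure, of "{t. \<psi> (T - t) \<noteq> 0}"] cl by (simp add: Int_absorb1)
  moreover have "smooth_on UNIV (\<lambda>t. \<psi> (T - t))" using s by (auto simp: smooth_on_def intro: Ck_on_reflect)
  ultimately show "(\<lambda>t. \<psi> (T - t)) \<in> test_functions {0<..<T}" using cl by (auto simp: test_functions_def)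
  have "((\<lambda>t. T - t) has_real_derivative (- 1)) (at t)" by (auto intro!: derivative_eq_intros)
  from DERIV_chain2[OF smooth_real_derivative[OF s] this]
  show "partial 1 (\<lambda>t. \<psi> (T - t)) t = - partial 1 \<psi> (T - t)" by (subst partial_real) auto
qed

lemma locally_L1_reflect:
  assumes "locally_L1 {0<..<T::real} v" shows "locally_L1 {0<..<T} (\<lambda>t. c * v (T - t))"
  unfolding locally_L1_def
proof (intro allI impI)
  fix K assume K: "compact K \<and> K \<subseteq> {0<..<T}"
  let ?K = "(\<lambda>t. T - t) ` K"
  have "compact ?K" using K by (intro compact_continuous_image continuous_intros) auto
  moreover have "?K \<subseteq> {0<..<T}" using K by (auto dest!: subsetD)
  ultimately have "integrable lborel (\<lambda>t. indicator ?K t *\<^sub>R v t)"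
    using assms by (auto simp: locally_L1_def set_integrable_def)
  then have "integrable lborel (\<lambda>t. indicator ?K (T + (-1) * t) *\<^sub>R v (T + (-1) * t))"
    by (subst lborel_integrable_real_affine_iff) simp
  moreover have "indicator ?K (T + (-1) * t) = (indicator K t :: real)" for t
    by (auto split: split_indicator)
  ultimately have "integrable lborel (\<lambda>t. c * (indicator K t *\<^sub>R v (T - t)))" by simp
  then show "set_integrable lborel K (\<lambda>t. c * v (T - t))" by (simp add: set_integrable_def mult_ac)
qed

lemma weak_partial_reflect:
  assumes "weak_partial {0<..<T::real} 1 v v'"
  shows "weak_partial {0<..<T} 1 (\<lambda>t. c * v (T - t)) (\<lambda>t. - c * v' (T - t))"
  unfolding weak_partial_def
proof (intro conjI ballI)
  show "locally_L1 {0<..<T} (\<lambda>t. c * v (T - t))" "locally_L1 {0<..<T} (\<lambda>t. - c * v' (T - t))"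
    using assms locally_L1_reflect[of T v c] locally_L1_reflect[of T v' "- c"] by (simp_all add: weak_partial_def)
  fix \<psi> assume \<psi>: "\<psi> \<in> test_functions {0<..<T}"
  define \<eta> where "\<eta> t = \<psi> (T - t)" for t
  have \<eta>: "\<eta> \<in> test_functions {0<..<T}" "\<And>t. partial 1 \<eta> t = - partial 1 \<psi> (T - t)"
    using test_functions_reflect[OF \<psi>] by (simp_all add: \<eta>_def[abs_def])
  have "(\<integral>t. c * v (T - t) * partial 1 \<psi> t \<partial>vol {0<..<T}) = (\<integral>t. c * v t * partial 1 \<psi> (T - t) \<partial>vol {0<..<T})"
    using integral_vol_reflect[of T "\<lambda>t. c * v t * partial 1 \<psi> (T - t)"] by simp
  also have "\<dots> = - c * (\<integral>t. v t * partial 1 \<eta> t \<partial>vol {0<..<T})" by (simp add: \<eta>(2) mult.assoc)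
  also have "\<dots> = c * (\<integral>t. v' t * \<eta> t \<partial>vol {0<..<T})" using assms \<eta>(1) by (simp add: weak_partial_def)
  also have "\<dots> = c * (\<integral>t. v' (T - t) * \<eta> (T - t) \<partial>vol {0<..<T})"
    using integral_vol_reflect[of T "\<lambda>t. v' t * \<eta> t"] by simp
  finally show "(\<integral>t. c * v (T - t) * partial 1 \<psi> t \<partial>vol {0<..<T}) = - (\<integral>t. - c * v' (T - t) * \<psi> t \<partial>vol {0<..<T})"
    by (simp add: \<eta>_def mult.assoc)
qed

text \<open>
  The reflection \<open>t \<mapsto> T - t\<close> interchanges forward and backward fractional integrals, so that
  statements about the backward Caputo derivative follow from the forward ones.
\<close>

lemma frac_int_back_reflect: "frac_int_back T \<gamma> g t = frac_int \<gamma> (\<lambda>s. g (T - s)) (T - t)"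
proof -
  have "(LINT \<tau>:{t<..<T}|lborel. (\<tau> - t) powr (\<gamma> - 1) * g \<tau>) =
      (\<integral>s. indicator {t<..<T} (T + (-1) * s) *\<^sub>R ((T + (-1) * s - t) powr (\<gamma> - 1) * g (T + (-1) * s)) \<partial>lborel)"
    unfolding set_lebesgue_integral_def by (subst lborel_integral_real_affine[of "-1" _ T]) simp_all
  also have "\<dots> = (LINT s:{0<..<T - t}|lborel. (T - t - s) powr (\<gamma> - 1) * g (T - s))"
    unfolding set_lebesgue_integral_def
    by (rule Bochner_Integration.integral_cong) (auto split: split_indicator simp: algebra_simps)
  finally show ?thesis by (simp add: frac_int_back_def frac_int_def)
qed

lemma frac_int_restrict:
  assumes "t \<le> T" shows "frac_int \<gamma> (\<lambda>s. indicator {0<..<T} s * w s) t = frac_int \<gamma> w t"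
proof -
  have "indicator {0<..<t} s *\<^sub>R ((t - s) powr (\<gamma> - 1) * (indicator {0<..<T} s * w s)) =
      indicator {0<..<t} s *\<^sub>R ((t - s) powr (\<gamma> - 1) * w s)" for s
    using assms by (auto split: split_indicator)
  then show ?thesis by (simp only: frac_int_def set_lebesgue_integral_def)
qed

lemma frac_int_back_restrict:
  assumes "t \<ge> 0" shows "frac_int_back T \<gamma> (\<lambda>s. indicator {0<..<T} s * w s) t = frac_int_back T \<gamma> w t"
proof -
  have "indicator {t<..<T} s *\<^sub>R ((s - t) powr (\<gamma> - 1) * (indicator {0<..<T} s * w s)) =
      indicator {t<..<T} s *\<^sub>R ((s - t) powr (\<gamma> - 1) * w s)" for s
    using assms by (auto split: split_indicator)
  then show ?thesis by (simp only: frac_int_back_def set_lebesgue_integral_def)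
qed

text \<open>
  By the semigroup law \<open>u = J^1 J^{\<alpha>-1} w\<close>, so the weak derivative of \<open>u\<close> is \<open>J^{\<alpha>-1} w\<close>;
  applying \<open>J^{2-\<alpha>}\<close> gives \<open>J^1 w\<close>, whose weak derivative is \<open>w\<close>. Uniqueness of weak derivatives
  is used at both differentiations.
\<close>

lemma caputo_frac_int_eq:
  assumes T: "T > 0" and \<alpha>: "1 < \<alpha>" "\<alpha> < 2" and w: "integrable lborel w"
    and u: "weak_partial {0<..<T} 1 u u'" "AE t in vol {0<..<T}. u t = frac_int \<alpha> w t"
      "u' \<in> borel_measurable (vol {0<..<T})"
    and D: "weak_partial {0<..<T} 1 (frac_int (2 - \<alpha>) u') D"
  shows "AE t in vol {0<..<T}. D t = w t"
proof -
  let ?I = "{0<..<T}"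
  have [measurable]: "w \<in> borel_measurable borel" using borel_measurable_integrable[OF w] by simp
  define y where "y = frac_int (\<alpha> - 1) w"
  \<comment> \<open>Cut off outside the time interval to be integrable on the whole line.\<close>
  define y0 where "y0 s = indicator ?I s * y s" for s
  have [measurable]: "y \<in> borel_measurable borel" unfolding y_def by (rule frac_int_measurable) simp
  have y0m: "y0 \<in> borel_measurable (vol ?I)"
    unfolding y0_def[abs_def] by (rule measurable_restrict_space1) simp
  have "integrable lborel y0"
  proof -
    have "set_integrable lborel {0<..<T} (\<lambda>s. (T - s) powr (1 - 1) * y s)"
      unfolding y_def using \<alpha> by (intro frac_int_semigroup(2) w) auto
    moreover have "indicator {0<..<T} s *\<^sub>R ((T - s) powr (1 - 1) * y s) = y0 s" for s
      by (auto simp: y0_def split: split_indicator)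
    ultimately show ?thesis by (simp add: set_integrable_def)
  qed
  from weak_partial_frac_int_1[OF T this] have wy: "weak_partial ?I 1 (frac_int 1 y0) y0" .
  have y0: "frac_int \<gamma> y0 t = frac_int \<gamma> y t" if "t \<le> T" for \<gamma> t
    unfolding y0_def[abs_def] by (rule frac_int_restrict[OF that])
  have "AE t in vol ?I. u t = frac_int 1 y0 t"
    using u(2) AE_space
  proof eventually_elim
    case (elim t)
    then have "t \<le> T" by (simp add: space_restrict_space)
    then have "frac_int 1 y0 t = frac_int (1 + (\<alpha> - 1)) w t"
      unfolding y0[OF \<open>t \<le> T\<close>] y_def using \<alpha> by (intro frac_int_semigroup(1) w) auto
    then show ?case using elim by simp
  qed
  from weak_partial_unique[OF _ _ u(1) wy this] have u'y: "AE t in vol ?I. u' t = y0 t" by simp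
  have "AE t in vol ?I. frac_int (2 - \<alpha>) u' t = frac_int 1 w t"
    using AE_space
  proof eventually_elim
    case (elim t)
    then have t: "t \<le> T" by (simp add: space_restrict_space)
    have "frac_int (2 - \<alpha>) u' t = frac_int (2 - \<alpha>) y0 t"
      by (rule frac_int_cong_AE[OF u(3) y0m u'y t])
    also have "\<dots> = frac_int (2 - \<alpha> + (\<alpha> - 1)) w t"
      unfolding y0[OF t] y_def using \<alpha> by (intro frac_int_semigroup(1) w) auto
    finally show ?case by simp
  qed
  from weak_partial_unique[OF _ _ D weak_partial_frac_int_1[OF T w] this] show ?thesis by simp
qed

text \<open>
  The forward statement for \<open>t \<mapsto> v (T - t)\<close>. One sign comes from reflecting \<open>v'\<close>, another from
  the minus sign in the backward Caputo derivative.
\<close>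

lemma caputo_back_frac_int_back_eq:
  assumes T: "T > 0" and \<alpha>: "1 < \<alpha>" "\<alpha> < 2" and y: "integrable lborel y"
    and v: "weak_partial {0<..<T} 1 v v'" "AE t in vol {0<..<T}. v t = frac_int_back T \<alpha> y t"
      "v' \<in> borel_measurable (vol {0<..<T})"
    and D: "weak_partial {0<..<T} 1 (frac_int_back T (2 - \<alpha>) v') (\<lambda>t. - D t)"
  shows "AE t in vol {0<..<T}. D t = - y t"
proof -
  let ?I = "{0<..<T}"
  have w: "integrable lborel (\<lambda>s. y (T - s))"
    using lborel_integrable_real_affine_iff[of "-1" y T] y by simp
  have u: "weak_partial ?I 1 (\<lambda>t. v (T - t)) (\<lambda>t. - v' (T - t))"
    using weak_partial_reflect[OF v(1), of 1] by simp
  have ae: "AE t in vol ?I. v (T - t) = frac_int \<alpha> (\<lambda>s. y (T - s)) t"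
    using AE_vol_reflect[OF v(2)] by eventually_elim (simp add: frac_int_back_reflect)
  have m: "(\<lambda>t. - v' (T - t)) \<in> borel_measurable (vol ?I)"
  proof -
    have m0: "(\<lambda>s. indicator ?I s *\<^sub>R v' s) \<in> borel_measurable borel"
      using v(3) by (simp add: borel_measurable_restrict_space_iff)
    have "(\<lambda>t. - (indicator ?I (T - t) *\<^sub>R v' (T - t))) \<in> borel_measurable borel"
      by (intro borel_measurable_uminus measurable_compose[OF _ m0]) simp
    moreover have "- (indicator ?I (T - t) *\<^sub>R v' (T - t)) = indicator ?I t *\<^sub>R (- v' (T - t))" for t
      by (auto split: split_indicator)
    ultimately have "(\<lambda>t. indicator ?I t *\<^sub>R (- v' (T - t))) \<in> borel_measurable borel" by (simp only:)
    then show ?thesis by (subst borel_measurable_restrict_space_iff) (simp, simp)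
  qed
  have neg: "frac_int (2 - \<alpha>) (\<lambda>t. - v' (T - t)) t = (- 1) * frac_int_back T (2 - \<alpha>) v' (T - t)" for t
    by (simp add: frac_int_back_reflect frac_int_def set_lebesgue_integral_def)
  have "weak_partial ?I 1 (frac_int (2 - \<alpha>) (\<lambda>t. - v' (T - t))) (\<lambda>t. - D (T - t))"
    unfolding neg[abs_def] using weak_partial_reflect[OF D, of "-1"] by simp
  from caputo_frac_int_eq[OF T \<alpha> w u ae m this]
  have "AE t in vol ?I. - D (T - t) = y (T - t)" .
  from AE_vol_reflect[OF this] show ?thesis by eventually_elim simp
qed

text \<open>
  For \<open>\<alpha> > 1\<close> the kernel is bounded, so Fubini's theorem applies to all integrable functions.
\<close>

lemma frac_int_adjoint:
  assumes T: "T > 0" and \<alpha>: "1 < \<alpha>" and w: "integrable lborel w" and y: "integrable lborel y"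
  shows "(\<integral>t. w t * frac_int_back T \<alpha> y t \<partial>vol {0<..<T}) = (\<integral>t. frac_int \<alpha> w t * y t \<partial>vol {0<..<T})"
proof -
  have [measurable]: "w \<in> borel_measurable borel" "y \<in> borel_measurable borel"
    using borel_measurable_integrable[OF w] borel_measurable_integrable[OF y] by simp_all
  define f where "f t \<tau> = (if 0 < t \<and> t < \<tau> \<and> \<tau> < T then w t * ((\<tau> - t) powr (\<alpha> - 1) * y \<tau>) else 0)" for t \<tau>
  have int: "integrable (lborel \<Otimes>\<^sub>M lborel) (case_prod f)"
  proof (rule Bochner_Integration.integrable_bound)
    show "integrable (lborel \<Otimes>\<^sub>M lborel) (\<lambda>(t, \<tau>). w t * (T powr (\<alpha> - 1) * y \<tau>))"
    proof (rule lborel_pair.Fubini_integrable)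
      show "integrable lborel (\<lambda>t. \<integral>\<tau>. norm (case (t, \<tau>) of (t, \<tau>) \<Rightarrow> w t * (T powr (\<alpha> - 1) * y \<tau>)) \<partial>lborel)"
        using w by (simp add: abs_mult)
    qed (use y in auto)
    show "case_prod f \<in> borel_measurable (lborel \<Otimes>\<^sub>M lborel)"
      unfolding f_def[abs_def] case_prod_beta' by measurable
    have "\<bar>f t \<tau>\<bar> \<le> \<bar>w t * (T powr (\<alpha> - 1) * y \<tau>)\<bar>" for t \<tau>
    proof (cases "0 < t \<and> t < \<tau> \<and> \<tau> < T")
      case True
      then have "(\<tau> - t) powr (\<alpha> - 1) \<le> T powr (\<alpha> - 1)" using \<alpha> by (intro powr_mono2) auto
      then show ?thesis using True by (auto simp: f_def abs_mult intro!: mult_left_mono mult_right_mono)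
    qed (auto simp: f_def)
    then show "AE z in lborel \<Otimes>\<^sub>M lborel. norm (case z of (t, \<tau>) \<Rightarrow> f t \<tau>) \<le> norm (case z of (t, \<tau>) \<Rightarrow> w t * (T powr (\<alpha> - 1) * y \<tau>))"
      by (auto intro!: AE_I2)
  qed
  have "0 < Gamma \<alpha>" by (rule Gamma_real_pos) (use \<alpha> in simp)
  then have G: "Gamma \<alpha> \<noteq> 0" by simp
  have i1: "(\<integral>\<tau>. f t \<tau> \<partial>lborel) = Gamma \<alpha> * (indicator {0<..<T} t *\<^sub>R (w t * frac_int_back T \<alpha> y t))" for t
  proof (cases "t \<in> {0<..<T}")
    case True
    have "(\<integral>\<tau>. f t \<tau> \<partial>lborel) = (\<integral>\<tau>. w t * (indicator {t<..<T} \<tau> *\<^sub>R ((\<tau> - t) powr (\<alpha> - 1) * y \<tau>)) \<partial>lborel)"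
      using True by (intro Bochner_Integration.integral_cong) (auto simp: f_def split: split_indicator)
    then show ?thesis using True G by (simp add: frac_int_back_def set_lebesgue_integral_def)
  next
    case False
    then have "f t \<tau> = 0" for \<tau> by (auto simp: f_def)
    then show ?thesis using False by simp
  qed
  have i2: "(\<integral>t. f t \<tau> \<partial>lborel) = Gamma \<alpha> * (indicator {0<..<T} \<tau> *\<^sub>R (frac_int \<alpha> w \<tau> * y \<tau>))" for \<tau>
  proof (cases "\<tau> \<in> {0<..<T}")
    case True
    have "(\<integral>t. f t \<tau> \<partial>lborel) = (\<integral>t. (indicator {0<..<\<tau>} t *\<^sub>R ((\<tau> - t) powr (\<alpha> - 1) * w t)) * y \<tau> \<partial>lborel)"
      using True by (intro Bochner_Integration.integral_cong) (auto simp: f_def split: split_indicator)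
    then show ?thesis using True G by (simp add: frac_int_def set_lebesgue_integral_def)
  next
    case False
    then have "f t \<tau> = 0" for t by (auto simp: f_def)
    then show ?thesis using False by simp
  qed
  have "(\<integral>\<tau>. \<integral>t. f t \<tau> \<partial>lborel \<partial>lborel) = (\<integral>t. \<integral>\<tau>. f t \<tau> \<partial>lborel \<partial>lborel)"
    by (rule lborel_pair.Fubini_integral[OF int])
  then show ?thesis unfolding i1 i2 using G by (simp add: integral_restrict_space)
qed

section \<open>Integration by parts in time\<close>

lemma AE_pair_swap:
  assumes "sigma_finite_measure M1" "sigma_finite_measure M2" and Q: "AE z in M1 \<Otimes>\<^sub>M M2. Q z"
  shows "AE x in M2. AE t in M1. Q (t, x)"
proof -
  interpret P: pair_sigma_finite M1 M2 by (simp add: pair_sigma_finite_def assms)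
  interpret P': pair_sigma_finite M2 M1 by (simp add: pair_sigma_finite_def assms)
  have "AE z in distr (M2 \<Otimes>\<^sub>M M1) (M1 \<Otimes>\<^sub>M M2) (\<lambda>(x, y). (y, x)). Q z"
    using Q unfolding P.distr_pair_swap[symmetric] .
  from AE_distrD[OF measurable_pair_swap' this]
  have "AE z in M2 \<Otimes>\<^sub>M M1. Q (case z of (x, t) \<Rightarrow> (t, x))" .
  from P'.AE_pair[OF this] show ?thesis by simp
qed

lemma L2_sections:
  assumes "sigma_finite_measure M1" "sigma_finite_measure M2" and f: "f \<in> L2 (M1 \<Otimes>\<^sub>M M2)"
  shows "AE t in M1. (\<lambda>x. f (t, x)) \<in> L2 M2" "AE x in M2. (\<lambda>t. f (t, x)) \<in> L2 M1"
proof -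
  interpret P: pair_sigma_finite M1 M2 by (simp add: pair_sigma_finite_def assms)
  have m: "f \<in> borel_measurable (M1 \<Otimes>\<^sub>M M2)" using f by (rule L2_measurable)
  have i: "integrable (M1 \<Otimes>\<^sub>M M2) (\<lambda>(t, x). (f (t, x))\<^sup>2)" using f by (simp add: L2_def split_beta')
  show "AE t in M1. (\<lambda>x. f (t, x)) \<in> L2 M2"
    using P.AE_integrable_fst[OF i] AE_space
    by eventually_elim (use measurable_Pair2[OF m] in \<open>simp add: L2_def\<close>)
  show "AE x in M2. (\<lambda>t. f (t, x)) \<in> L2 M1"
    using P.AE_integrable_snd[OF i] AE_space
    by eventually_elim (use measurable_Pair1[OF m] in \<open>simp add: L2_def\<close>)
qed

lemma sigma_finite_vol: "open S \<Longrightarrow> sigma_finite_measure (vol S)"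
  by (rule sigma_finite_measure_restrict_space) (auto simp: lborel.sigma_finite_measure_axioms)

lemma L2_time_integrable:
  assumes "w \<in> L2 (vol {0<..<T::real})"
  shows "integrable lborel (\<lambda>s. indicator {0<..<T} s * w s)"
proof -
  have "(\<lambda>_. 1) \<in> L2 (vol {0<..<T})" by (intro continuous_L2_vol) auto
  from L2_mult_integrable[OF this assms] show ?thesis by (simp add: integrable_restrict_space)
qed

text \<open>
  The zero initial and terminal values are encoded in the representations by fractional
  integrals. They reduce integration by parts to the fact that \<open>J^\<alpha>\<close> and \<open>J_{T-}^\<alpha>\<close> are adjoint,
  and no boundary terms in time appear.
\<close>

lemma caputo_duality_at_point:
  assumes T: "T > 0" and \<alpha>: "1 < \<alpha>" "\<alpha> < 2"
    and L: "w \<in> L2 (vol {0<..<T})" "u' \<in> L2 (vol {0<..<T})" "D \<in> L2 (vol {0<..<T})" "u \<in> L2 (vol {0<..<T})"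
      "y \<in> L2 (vol {0<..<T})" "v' \<in> L2 (vol {0<..<T})" "E \<in> L2 (vol {0<..<T})" "v \<in> L2 (vol {0<..<T})"
    and u: "weak_partial {0<..<T} 1 u u'" "AE t in vol {0<..<T}. u t = frac_int \<alpha> w t"
    and D: "weak_partial {0<..<T} 1 (frac_int (2 - \<alpha>) u') D"
    and v: "weak_partial {0<..<T} 1 v v'" "AE t in vol {0<..<T}. v t = frac_int_back T \<alpha> y t"
    and E: "weak_partial {0<..<T} 1 (frac_int_back T (2 - \<alpha>) v') (\<lambda>t. - E t)"
  shows "(\<integral>t. D t * v t \<partial>vol {0<..<T}) = - (\<integral>t. u t * E t \<partial>vol {0<..<T})"
proof -
  let ?I = "{0<..<T}"
  define w0 where "w0 s = indicator ?I s * w s" for s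
  define y0 where "y0 s = indicator ?I s * y s" for s
  have int: "integrable lborel w0" "integrable lborel y0"
    unfolding w0_def y0_def by (intro L2_time_integrable L)+
  have m0: "w0 \<in> borel_measurable (vol ?I)" "y0 \<in> borel_measurable (vol ?I)"
    using borel_measurable_integrable[OF int(1)] borel_measurable_integrable[OF int(2)]
    by (auto intro: measurable_restrict_space1)
  have u0: "AE t in vol ?I. u t = frac_int \<alpha> w0 t"
    using u(2) AE_space
    by eventually_elim (simp add: w0_def[abs_def] frac_int_restrict space_restrict_space)
  have v0: "AE t in vol ?I. v t = frac_int_back T \<alpha> y0 t"
    using v(2) AE_space
    by eventually_elim (simp add: y0_def[abs_def] frac_int_back_restrict space_restrict_space)
  have Dw: "AE t in vol ?I. D t = w0 t"
    by (rule caputo_frac_int_eq[OF T \<alpha> int(1) u(1) u0 L2_measurable[OF L(2)] D])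
  have Ey: "AE t in vol ?I. E t = - y0 t"
    by (rule caputo_back_frac_int_back_eq[OF T \<alpha> int(2) v(1) v0 L2_measurable[OF L(6)] E])
  have fm: "frac_int \<alpha> w0 \<in> borel_measurable (vol ?I)"
    using frac_int_measurable[of w0 \<alpha>] borel_measurable_integrable[OF int(1)]
    by (auto intro: measurable_restrict_space1)
  have bm: "frac_int_back T \<alpha> y0 \<in> borel_measurable (vol ?I)"
  proof -
    have "(\<lambda>s. y0 (T - s)) \<in> borel_measurable borel"
      using borel_measurable_integrable[OF int(2)] by (intro measurable_compose[of "\<lambda>s. T - s" borel borel y0]) auto
    from frac_int_measurable[OF this, of \<alpha>]
    have "(\<lambda>t. frac_int \<alpha> (\<lambda>s. y0 (T - s)) (T - t)) \<in> borel_measurable borel"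
      by (intro measurable_compose[of "\<lambda>t. T - t" borel borel "frac_int \<alpha> (\<lambda>s. y0 (T - s))"]) auto
    then have "frac_int_back T \<alpha> y0 \<in> borel_measurable borel" by (simp add: frac_int_back_reflect[abs_def])
    then show ?thesis by (auto intro: measurable_restrict_space1)
  qed
  have "(\<integral>t. D t * v t \<partial>vol ?I) = (\<integral>t. w0 t * frac_int_back T \<alpha> y0 t \<partial>vol ?I)"
  proof (rule integral_cong_AE)
    show "AE t in vol ?I. D t * v t = w0 t * frac_int_back T \<alpha> y0 t" using Dw v0 by eventually_elim simp
  qed (intro borel_measurable_times m0 bm L2_measurable L)+
  also have "\<dots> = (\<integral>t. frac_int \<alpha> w0 t * y0 t \<partial>vol ?I)" by (rule frac_int_adjoint[OF T \<alpha>(1) int])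
  also have "\<dots> = (\<integral>t. - (u t * E t) \<partial>vol ?I)"
  proof (rule integral_cong_AE)
    show "AE t in vol ?I. frac_int \<alpha> w0 t * y0 t = - (u t * E t)" using Ey u0 by eventually_elim simp
  qed (intro borel_measurable_uminus borel_measurable_times m0 fm L2_measurable L)+
  finally show ?thesis by simp
qed

lemma space_derivD:
  assumes "space_deriv T \<Omega> i u w"
  shows "u \<in> L2 (cyl T \<Omega>)" "w \<in> L2 (cyl T \<Omega>)"
    "AE t in vol {0<..<T}. weak_partial \<Omega> i (\<lambda>x. u (t, x)) (\<lambda>x. w (t, x))"
  using assms by (auto simp: space_deriv_def)

lemma time_derivD:
  assumes "time_deriv T \<Omega> u w"
  shows "u \<in> L2 (cyl T \<Omega>)" "w \<in> L2 (cyl T \<Omega>)"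
    "AE x in vol \<Omega>. weak_partial {0<..<T} 1 (\<lambda>t. u (t, x)) (\<lambda>t. w (t, x))"
  using assms by (auto simp: time_deriv_def)

lemma caputo_duality:
  fixes \<Omega> :: "'a::euclidean_space set"
  assumes \<Omega>: "open \<Omega>" and T: "T > 0" and \<alpha>: "1 < \<alpha>" "\<alpha> < 2"
    and u: "u \<in> H_frac \<alpha> T \<Omega>" "caputo \<alpha> T \<Omega> u D"
    and v: "v \<in> H_frac_back \<alpha> T \<Omega>" "caputo_back \<alpha> T \<Omega> v E"
  shows "(\<integral>z. D z * v z \<partial>cyl T \<Omega>) = - (\<integral>z. u z * E z \<partial>cyl T \<Omega>)"
proof -
  let ?I = "{0<..<T}"
  have sf: "sigma_finite_measure (vol ?I)" "sigma_finite_measure (vol \<Omega>)"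
    using \<Omega> by (auto intro: sigma_finite_vol)
  interpret P: pair_sigma_finite "vol ?I" "vol \<Omega>" by (simp add: pair_sigma_finite_def sf)
  obtain w where w: "w \<in> L2 (cyl T \<Omega>)" "AE z in cyl T \<Omega>. u z = J \<alpha> w z" and uL: "u \<in> L2 (cyl T \<Omega>)"
    using u(1) by (auto simp: H_frac_def)
  obtain y where y: "y \<in> L2 (cyl T \<Omega>)" "AE z in cyl T \<Omega>. v z = J_back T \<alpha> y z" and vL: "v \<in> L2 (cyl T \<Omega>)"
    using v(1) by (auto simp: H_frac_back_def)
  obtain u' where u': "time_deriv T \<Omega> u u'" "time_deriv T \<Omega> (J (2 - \<alpha>) u') D"
    using u(2) by (auto simp: caputo_def)
  obtain v' where v': "time_deriv T \<Omega> v v'" "time_deriv T \<Omega> (J_back T (2 - \<alpha>) v') (\<lambda>z. - E z)"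
    using v(2) by (auto simp: caputo_back_def)
  note u1 = time_derivD[OF u'(1)] and u2 = time_derivD[OF u'(2)] and v1 = time_derivD[OF v'(1)] and v2 = time_derivD[OF v'(2)]
  have EL: "E \<in> L2 (cyl T \<Omega>)" using L2_uminus[OF v2(2)] by simp
  note sec = L2_sections(2)[OF sf, folded cyl_def]
  have "AE x in vol \<Omega>. AE t in vol ?I. u (t, x) = J \<alpha> w (t, x)"
    using w(2) unfolding cyl_def by (rule AE_pair_swap[OF sf])
  moreover have "AE x in vol \<Omega>. AE t in vol ?I. v (t, x) = J_back T \<alpha> y (t, x)"
    using y(2) unfolding cyl_def by (rule AE_pair_swap[OF sf])
  ultimately have key: "AE x in vol \<Omega>. (\<integral>t. D (t, x) * v (t, x) \<partial>vol ?I) = - (\<integral>t. u (t, x) * E (t, x) \<partial>vol ?I)"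
    using sec[OF w(1)] sec[OF u1(2)] sec[OF u2(2)] sec[OF uL] sec[OF y(1)] sec[OF v1(2)] sec[OF EL] sec[OF vL]
      u1(3) u2(3) v1(3) v2(3)
  proof eventually_elim
    case (elim x)
    show ?case
      by (rule caputo_duality_at_point[OF T \<alpha> elim(3-10) elim(11) _ _ elim(13)])
        (use elim in \<open>simp_all add: J_def J_back_def\<close>)
  qed
  have i1: "integrable (vol ?I \<Otimes>\<^sub>M vol \<Omega>) (\<lambda>(t, x). D (t, x) * v (t, x))"
    using L2_mult_integrable[OF u2(2) vL] by (simp add: cyl_def split_beta')
  have i2: "integrable (vol ?I \<Otimes>\<^sub>M vol \<Omega>) (\<lambda>(t, x). u (t, x) * E (t, x))"
    using L2_mult_integrable[OF uL EL] by (simp add: cyl_def split_beta')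
  have "(\<integral>z. D z * v z \<partial>cyl T \<Omega>) = (\<integral>x. (\<integral>t. D (t, x) * v (t, x) \<partial>vol ?I) \<partial>vol \<Omega>)"
    using P.integral_snd[OF i1] by (simp add: cyl_def split_beta')
  also have "\<dots> = (\<integral>x. - (\<integral>t. u (t, x) * E (t, x) \<partial>vol ?I) \<partial>vol \<Omega>)"
    using key borel_measurable_integrable[OF P.integrable_snd[OF i1]] borel_measurable_integrable[OF P.integrable_snd[OF i2]]
    by (intro integral_cong_AE) auto
  also have "\<dots> = - (\<integral>z. u z * E z \<partial>cyl T \<Omega>)"
    using P.integral_snd[OF i2] by (simp add: cyl_def split_beta')
  finally show ?thesis .
qed

section \<open>The boundary identity and the stability estimate\<close>

lemma integral_cyl:
  fixes \<Omega> :: "'a::euclidean_space set" and F :: "real \<times> 'a \<Rightarrow> real"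
  assumes "open \<Omega>" and i: "integrable (cyl T \<Omega>) F"
  shows "(\<integral>z. F z \<partial>cyl T \<Omega>) = (\<integral>t. (\<integral>x. F (t, x) \<partial>vol \<Omega>) \<partial>vol {0<..<T})"
    "integrable (vol {0<..<T}) (\<lambda>t. \<integral>x. F (t, x) \<partial>vol \<Omega>)"
proof -
  interpret P: pair_sigma_finite "vol {0<..<T}" "vol \<Omega>"
    using assms(1) by (auto simp: pair_sigma_finite_def intro: sigma_finite_vol)
  have i': "integrable (vol {0<..<T} \<Otimes>\<^sub>M vol \<Omega>) (\<lambda>(t, x). F (t, x))" using i by (simp add: cyl_def split_beta')
  show "(\<integral>z. F z \<partial>cyl T \<Omega>) = (\<integral>t. (\<integral>x. F (t, x) \<partial>vol \<Omega>) \<partial>vol {0<..<T})"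
    using P.integral_fst[OF i'] by (simp add: cyl_def split_beta')
  show "integrable (vol {0<..<T}) (\<lambda>t. \<integral>x. F (t, x) \<partial>vol \<Omega>)" using P.integrable_fst[OF i'] .
qed

lemma integral_cyl_cong_AE:
  fixes \<Omega> :: "'a::euclidean_space set" and F G :: "real \<times> 'a \<Rightarrow> real"
  assumes "open \<Omega>" "integrable (cyl T \<Omega>) F" "integrable (cyl T \<Omega>) G"
    and "AE t in vol {0<..<T}. (\<integral>x. F (t, x) \<partial>vol \<Omega>) = (\<integral>x. G (t, x) \<partial>vol \<Omega>)"
  shows "(\<integral>z. F z \<partial>cyl T \<Omega>) = (\<integral>z. G z \<partial>cyl T \<Omega>)"
  unfolding integral_cyl(1)[OF assms(1,2)] integral_cyl(1)[OF assms(1,3)]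
  by (intro integral_cong_AE borel_measurable_integrable integral_cyl(2) assms)

lemma lateral_frontier:
  assumes "open \<Omega>" "bounded \<Omega>" "Ck_boundary 1 \<Omega>"
  shows "lateral T \<Omega> (frontier \<Omega>) = vol {0<..<T} \<Otimes>\<^sub>M surface_measure \<Omega>"
proof -
  note sp = space_surface_measure[OF assms]
  have fr: "frontier \<Omega> \<inter> space (surface_measure \<Omega>) \<in> sets (surface_measure \<Omega>)"
    by (metis sp Int_absorb sets.top)
  have "restrict_space (surface_measure \<Omega>) (frontier \<Omega>) = surface_measure \<Omega>"
  proof (rule measure_eqI)
    show s: "sets (restrict_space (surface_measure \<Omega>) (frontier \<Omega>)) = sets (surface_measure \<Omega>)"
    proof (rule set_eqI)
      fix A
      show "A \<in> sets (restrict_space (surface_measure \<Omega>) (frontier \<Omega>)) \<longleftrightarrow> A \<in> sets (surface_measure \<Omega>)"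
        unfolding sets_restrict_space_iff[OF fr] using sets.sets_into_space[of A "surface_measure \<Omega>"] sp by blast
    qed
    fix A assume "A \<in> sets (restrict_space (surface_measure \<Omega>) (frontier \<Omega>))"
    then have "A \<subseteq> frontier \<Omega>" using sets.sets_into_space[of A "surface_measure \<Omega>"] sp s by blast
    then show "emeasure (restrict_space (surface_measure \<Omega>) (frontier \<Omega>)) A = emeasure (surface_measure \<Omega>) A"
      by (rule emeasure_restrict_space[OF fr])
  qed
  then show ?thesis by (simp add: lateral_def)
qed

text \<open>
  Multiply the equation for \<open>u\<close> by \<open>v\<close> and integrate by parts: in time for almost every \<open>x\<close>, in
  space for almost every \<open>t\<close>. What is left inside the cylinder is \<open>u\<close> times the adjoint equation
  for \<open>v\<close>, that is zero; what is left on the lateral boundary is the conormal derivative of \<open>u\<close>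
  against \<open>\<phi>\<close>.
\<close>

theorem B_form_boundary_identity:
  fixes \<Omega> :: "'a::euclidean_space set"
  assumes \<Omega>: "open \<Omega>" "bounded \<Omega>" "Ck_boundary 1 \<Omega>"
    and co: "coefficients \<Omega> a B c" and \<alpha>: "1 < \<alpha>" "\<alpha> < 2" and T: "T > 0"
    and fm: "f \<in> borel_measurable (vol \<Omega>)" and gm: "g \<in> borel_measurable (vol {0<..<T})"
    and fw: "forward_solution \<Omega> \<alpha> T a B c g f u" and zc: "is_conormal T \<Omega> a u z"
    and ad: "adjoint_solution \<Omega> \<alpha> T a B c \<phi> v"
  shows "z \<in> L2 (lateral T \<Omega> (frontier \<Omega>))"
    and "integrable (cyl T \<Omega>) (\<lambda>(t, x). f x * g t * v (t, x))"
    and "(\<integral>(t, x). f x * g t * v (t, x) \<partial>cyl T \<Omega>) = - (\<integral>y. z y * \<phi> y \<partial>lateral T \<Omega> (frontier \<Omega>))"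
proof -
  let ?I = "{0<..<T}" and ?\<sigma> = "surface_measure \<Omega>" and ?C = "cyl T \<Omega>"
  interpret \<sigma>: finite_measure ?\<sigma> by (rule surface_measure_properties(1)[OF \<Omega>])
  have sfI: "sigma_finite_measure (vol ?I)" and sf\<Omega>: "sigma_finite_measure (vol \<Omega>)"
    using \<Omega> by (auto intro: sigma_finite_vol)
  have sf\<sigma>: "sigma_finite_measure ?\<sigma>" by unfold_locales
  interpret L: pair_sigma_finite "vol ?I" ?\<sigma> by (simp add: pair_sigma_finite_def sfI sf\<sigma>)
  note lat = lateral_frontier[OF \<Omega>, of T]
  have a: "C1_closure \<Omega> (a i j)" "\<And>x. x \<in> closure \<Omega> \<Longrightarrow> a i j x = a j i x" if "i \<in> Basis" "j \<in> Basis" for i j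
    using co that by (auto simp: coefficients_def)
  obtain D zu pu where uH: "u \<in> H_frac \<alpha> T \<Omega>" "u \<in> L2_H10 T \<Omega>" and Du: "caputo \<alpha> T \<Omega> u D"
    and Au: "is_A0 T \<Omega> a u zu" and pu: "\<And>i. i \<in> Basis \<Longrightarrow> space_deriv T \<Omega> i u (pu i)"
    and equ: "AE (t, x) in ?C. D (t, x) + zu (t, x) + (\<Sum>i\<in>Basis. (B x \<bullet> i) * pu i (t, x)) + c x * u (t, x) = f x * g t"
    using fw unfolding forward_solution_def by blast
  obtain p' q where p': "\<And>j. j \<in> Basis \<Longrightarrow> space_deriv T \<Omega> j u (p' j)"
    and q: "\<And>i j. i \<in> Basis \<Longrightarrow> j \<in> Basis \<Longrightarrow> space_deriv T \<Omega> i (\<lambda>(t, x). a i j x * p' j (t, x)) (q i j)"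
    and zu: "zu = (\<lambda>y. - (\<Sum>i\<in>Basis. \<Sum>j\<in>Basis. q i j y))"
    using Au unfolding is_A0_def by blast
  obtain p b where p: "\<And>i. i \<in> Basis \<Longrightarrow> space_deriv T \<Omega> i u (p i)"
    and b: "\<And>i. i \<in> Basis \<Longrightarrow> lateral_trace T \<Omega> (p i) (b i)"
    and z: "z = (\<lambda>(t, x). \<Sum>i\<in>Basis. \<Sum>j\<in>Basis. a i j x * b i (t, x) * (outward_normal \<Omega> x \<bullet> j))"
    using zc unfolding is_conormal_def by blast
  obtain E zv s where vH: "v \<in> H_frac_back \<alpha> T \<Omega>" and Ev: "caputo_back \<alpha> T \<Omega> v E"
    and Av: "is_A0 T \<Omega> a v zv"
    and s: "\<And>i. i \<in> Basis \<Longrightarrow> space_deriv T \<Omega> i (\<lambda>(t, x). (B x \<bullet> i) * v (t, x)) (s i)"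
    and eqv: "AE (t, x) in ?C. E (t, x) - zv (t, x) + (\<Sum>i\<in>Basis. s i (t, x)) - c x * v (t, x) = 0"
    and tr: "lateral_trace T \<Omega> v \<phi>"
    using ad unfolding adjoint_solution_def by blast
  obtain R r where R: "\<And>j. j \<in> Basis \<Longrightarrow> space_deriv T \<Omega> j v (R j)"
    and r: "\<And>i j. i \<in> Basis \<Longrightarrow> j \<in> Basis \<Longrightarrow> space_deriv T \<Omega> i (\<lambda>(t, x). a i j x * R j (t, x)) (r i j)"
    and zv: "zv = (\<lambda>y. - (\<Sum>i\<in>Basis. \<Sum>j\<in>Basis. r i j y))"
    using Av unfolding is_A0_def by blast
  have uL: "u \<in> L2 ?C" and vL: "v \<in> L2 ?C" using uH vH by (auto simp: H_frac_def H_frac_back_def)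
  have DL: "D \<in> L2 ?C" using Du by (auto simp: caputo_def dest: time_derivD)
  have "(\<lambda>y. - E y) \<in> L2 ?C" using Ev by (auto simp: caputo_back_def dest: time_derivD)
  from L2_uminus[OF this] have EL: "E \<in> L2 ?C" by simp
  have zuL: "zu \<in> L2 ?C" unfolding zu by (intro L2_uminus L2_sum space_derivD(2)[OF q])
  have zvL: "zv \<in> L2 ?C" unfolding zv by (intro L2_uminus L2_sum space_derivD(2)[OF r])
  have sL: "s i \<in> L2 ?C" and puL: "pu i \<in> L2 ?C" and BvL: "(\<lambda>(t, x). (B x \<bullet> i) * v (t, x)) \<in> L2 ?C" if "i \<in> Basis" for i
    using s[OF that] pu[OF that] by (auto simp: space_deriv_def)
  have bL: "b i \<in> L2 (vol ?I \<Otimes>\<^sub>M ?\<sigma>)" if "i \<in> Basis" for i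
    using b[OF that] lat by (simp add: lateral_trace_def)
  have \<phi>L: "\<phi> \<in> L2 (vol ?I \<Otimes>\<^sub>M ?\<sigma>)" using tr lat by (simp add: lateral_trace_def)
  have coefL: "(\<lambda>y. (a i j (snd y) * (outward_normal \<Omega> (snd y) \<bullet> k)) * h y) \<in> L2 (vol ?I \<Otimes>\<^sub>M ?\<sigma>)"
    if ij: "i \<in> Basis" "j \<in> Basis" and h: "h \<in> L2 (vol ?I \<Otimes>\<^sub>M ?\<sigma>)" for i j k h
  proof -
    have "continuous_on (closure \<Omega>) (a i j)" using a(1)[OF ij] by (simp add: C1_closure_def)
    then have cc: "continuous_on (frontier \<Omega>) (\<lambda>x. a i j x * (outward_normal \<Omega> x \<bullet> k))"
      using continuous_outward_normal[OF \<Omega>(1,3)]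
      by (intro continuous_intros) (auto simp: frontier_def intro: continuous_on_subset)
    obtain K where K: "\<And>x. x \<in> frontier \<Omega> \<Longrightarrow> \<bar>a i j x * (outward_normal \<Omega> x \<bullet> k)\<bar> \<le> K"
      using continuous_bounded_on_compact[OF compact_frontier_bounded[OF \<Omega>(2)] cc] by blast
    show ?thesis
    proof (rule L2_bounded_mult[OF h])
      show "(\<lambda>y. a i j (snd y) * (outward_normal \<Omega> (snd y) \<bullet> k)) \<in> borel_measurable (vol ?I \<Otimes>\<^sub>M ?\<sigma>)"
        using measurable_compose[OF measurable_snd continuous_measurable_surface[OF \<Omega> cc]] .
      show "AE y in vol ?I \<Otimes>\<^sub>M ?\<sigma>. \<bar>a i j (snd y) * (outward_normal \<Omega> (snd y) \<bullet> k)\<bar> \<le> K"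
        using K by (intro AE_I2) (auto simp: space_pair_measure space_surface_measure[OF \<Omega>])
    qed
  qed
  have z': "z = (\<lambda>y. \<Sum>i\<in>Basis. \<Sum>j\<in>Basis. (a i j (snd y) * (outward_normal \<Omega> (snd y) \<bullet> j)) * b i y)"
    unfolding z by (auto simp: fun_eq_iff mult_ac)
  have zL: "z \<in> L2 (vol ?I \<Otimes>\<^sub>M ?\<sigma>)" unfolding z' by (intro L2_sum coefL bL)
  then show "z \<in> L2 (lateral T \<Omega> (frontier \<Omega>))" by (simp add: lat)
  note sec = L2_sections(1)[OF sfI sf\<Omega>, folded cyl_def]
  have int_z\<phi>: "integrable (vol ?I \<Otimes>\<^sub>M ?\<sigma>) (\<lambda>(t, x). z (t, x) * \<phi> (t, x))"
    using L2_mult_integrable[OF zL \<phi>L] by (simp add: split_beta')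
  have u10: "AE t in vol ?I. (\<lambda>x. u (t, x)) \<in> H10 \<Omega>" using uH(2) by (simp add: L2_H10_def)
  have all1: "AE t in vol ?I. \<forall>i\<in>Basis. P i t" if "\<And>i. i \<in> Basis \<Longrightarrow> AE t in vol ?I. P i t" for P :: "'a \<Rightarrow> real \<Rightarrow> bool"
    using that by (intro AE_finite_allI) auto
  \<comment> \<open>Almost every time slice satisfies all hypotheses of Green's formula, since
      there are only finitely many basis vectors.\<close>
  have green_t: "AE t in vol ?I. (\<integral>x. zu (t, x) * v (t, x) \<partial>vol \<Omega>) =
      (\<integral>x. u (t, x) * zv (t, x) \<partial>vol \<Omega>) - (\<integral>x. z (t, x) * \<phi> (t, x) \<partial>?\<sigma>)"
  proof -
    have 1: "AE t in vol ?I. \<forall>i\<in>Basis. weak_partial \<Omega> i (\<lambda>x. u (t, x)) (\<lambda>x. p i (t, x))" by (intro all1 space_derivD(3)[OF p])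
    have 2: "AE t in vol ?I. \<forall>i\<in>Basis. (\<lambda>x. p i (t, x)) \<in> L2 (vol \<Omega>)" by (intro all1 sec space_derivD(2)[OF p])
    have 3: "AE t in vol ?I. \<forall>i\<in>Basis. is_trace \<Omega> (\<lambda>x. p i (t, x)) (\<lambda>x. b i (t, x))"
      using b by (intro all1) (simp add: lateral_trace_def)
    have 4: "AE t in vol ?I. \<forall>i\<in>Basis. weak_partial \<Omega> i (\<lambda>x. u (t, x)) (\<lambda>x. p' i (t, x))" by (intro all1 space_derivD(3)[OF p'])
    have 5: "AE t in vol ?I. \<forall>i\<in>Basis. \<forall>j\<in>Basis. weak_partial \<Omega> i (\<lambda>x. a i j x * p' j (t, x)) (\<lambda>x. q i j (t, x))"
      using space_derivD(3)[OF q] by (intro all1) simp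
    have 6: "AE t in vol ?I. \<forall>i\<in>Basis. \<forall>j\<in>Basis. (\<lambda>x. q i j (t, x)) \<in> L2 (vol \<Omega>)" by (intro all1 sec space_derivD(2)[OF q])
    have 7: "AE t in vol ?I. is_trace \<Omega> (\<lambda>x. v (t, x)) (\<lambda>x. \<phi> (t, x))" using tr by (simp add: lateral_trace_def)
    have 8: "AE t in vol ?I. \<forall>i\<in>Basis. weak_partial \<Omega> i (\<lambda>x. v (t, x)) (\<lambda>x. R i (t, x))" by (intro all1 space_derivD(3)[OF R])
    have 9: "AE t in vol ?I. \<forall>i\<in>Basis. (\<lambda>x. R i (t, x)) \<in> L2 (vol \<Omega>)" by (intro all1 sec space_derivD(2)[OF R])
    have 10: "AE t in vol ?I. \<forall>i\<in>Basis. \<forall>j\<in>Basis. weak_partial \<Omega> i (\<lambda>x. a i j x * R j (t, x)) (\<lambda>x. r i j (t, x))"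
      using space_derivD(3)[OF r] by (intro all1) simp
    have 11: "AE t in vol ?I. \<forall>i\<in>Basis. \<forall>j\<in>Basis. (\<lambda>x. r i j (t, x)) \<in> L2 (vol \<Omega>)" by (intro all1 sec space_derivD(2)[OF r])
    show ?thesis
      using u10 1 2 3 4 5 6 7 8 9 10 11
    proof eventually_elim
      case (elim t)
      have "(\<integral>x. (- (\<Sum>i\<in>Basis. \<Sum>j\<in>Basis. q i j (t, x))) * v (t, x) \<partial>vol \<Omega>) =
        (\<integral>x. u (t, x) * (- (\<Sum>i\<in>Basis. \<Sum>j\<in>Basis. r i j (t, x))) \<partial>vol \<Omega>) -
        (\<integral>x. (\<Sum>i\<in>Basis. \<Sum>j\<in>Basis. a i j x * b i (t, x) * (outward_normal \<Omega> x \<bullet> j)) * \<phi> (t, x) \<partial>?\<sigma>)"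
      proof (rule elliptic_green[OF \<Omega>, where p="\<lambda>i x. p i (t, x)" and p'="\<lambda>i x. p' i (t, x)" and R="\<lambda>i x. R i (t, x)"])
        show "C1_closure \<Omega> (a i j)" if "i \<in> Basis" "j \<in> Basis" for i j by (rule a(1)[OF that])
        show "a i j x = a j i x" if "i \<in> Basis" "j \<in> Basis" "x \<in> closure \<Omega>" for i j x by (rule a(2)[OF that])
        show "is_trace \<Omega> (\<lambda>x. v (t, x)) (\<lambda>x. \<phi> (t, x))" by (rule elim(8))
      qed (use elim in blast)+
      then show ?case by (simp only: zu zv z prod.case)
    qed
  qed
  have int1: "integrable ?C (\<lambda>y. zu y * v y)" "integrable ?C (\<lambda>y. u y * zv y)" by (intro L2_mult_integrable zuL vL uL zvL)+
  have spacepart: "(\<integral>y. zu y * v y \<partial>?C) = (\<integral>y. u y * zv y \<partial>?C) - (\<integral>y. z y * \<phi> y \<partial>(vol ?I \<Otimes>\<^sub>M ?\<sigma>))"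
  proof -
    note f1 = L.integrable_fst[OF int_z\<phi>]
    have "(\<integral>y. zu y * v y \<partial>?C) = (\<integral>t. (\<integral>x. zu (t, x) * v (t, x) \<partial>vol \<Omega>) \<partial>vol ?I)" by (rule integral_cyl(1)[OF \<Omega>(1) int1(1)])
    also have "\<dots> = (\<integral>t. (\<integral>x. u (t, x) * zv (t, x) \<partial>vol \<Omega>) - (\<integral>x. z (t, x) * \<phi> (t, x) \<partial>?\<sigma>) \<partial>vol ?I)"
      by (rule integral_cong_AE[OF _ _ green_t])
        (intro borel_measurable_integrable integral_cyl(2)[OF \<Omega>(1) int1(1)] Bochner_Integration.integrable_diff integral_cyl(2)[OF \<Omega>(1) int1(2)] f1)+
    also have "\<dots> = (\<integral>t. (\<integral>x. u (t, x) * zv (t, x) \<partial>vol \<Omega>) \<partial>vol ?I) - (\<integral>t. (\<integral>x. z (t, x) * \<phi> (t, x) \<partial>?\<sigma>) \<partial>vol ?I)"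
      by (intro Bochner_Integration.integral_diff integral_cyl(2)[OF \<Omega>(1) int1(2)] f1)
    also have "(\<integral>t. (\<integral>x. u (t, x) * zv (t, x) \<partial>vol \<Omega>) \<partial>vol ?I) = (\<integral>y. u y * zv y \<partial>?C)"
      by (rule integral_cyl(1)[OF \<Omega>(1) int1(2), symmetric])
    also have "(\<integral>t. (\<integral>x. z (t, x) * \<phi> (t, x) \<partial>?\<sigma>) \<partial>vol ?I) = (\<integral>y. z y * \<phi> y \<partial>(vol ?I \<Otimes>\<^sub>M ?\<sigma>))"
      using L.integral_fst[OF int_z\<phi>] by (simp add: split_beta')
    finally show ?thesis .
  qed
  have drift: "(\<integral>y. ((B (snd y) \<bullet> i) * v y) * pu i y \<partial>?C) = - (\<integral>y. u y * s i y \<partial>?C)" if i: "i \<in> Basis" for i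
  proof -
    have BvL': "(\<lambda>y. (B (snd y) \<bullet> i) * v y) \<in> L2 ?C" using BvL[OF i] by (simp add: split_beta')
    have "(\<integral>y. ((B (snd y) \<bullet> i) * v y) * pu i y \<partial>?C) = (\<integral>y. - (u y * s i y) \<partial>?C)"
    proof (rule integral_cyl_cong_AE[OF \<Omega>(1)])
      show "integrable ?C (\<lambda>y. ((B (snd y) \<bullet> i) * v y) * pu i y)" by (rule L2_mult_integrable[OF BvL' puL[OF i]])
      show "integrable ?C (\<lambda>y. - (u y * s i y))" by (intro Bochner_Integration.integrable_minus L2_mult_integrable uL sL i)
      show "AE t in vol ?I. (\<integral>x. ((B (snd (t, x)) \<bullet> i) * v (t, x)) * pu i (t, x) \<partial>vol \<Omega>) = (\<integral>x. - (u (t, x) * s i (t, x)) \<partial>vol \<Omega>)"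
        using u10 space_derivD(3)[OF pu[OF i]] sec[OF puL[OF i]] space_derivD(3)[OF s[OF i]] sec[OF BvL'] sec[OF sL[OF i]]
      proof eventually_elim
        case (elim t)
        have "(\<integral>x. ((B x \<bullet> i) * v (t, x)) * pu i (t, x) \<partial>vol \<Omega>) = - (\<integral>x. s i (t, x) * u (t, x) \<partial>vol \<Omega>)"
          by (rule green_H10[OF \<Omega>(1) i elim(1-3)]) (use elim in simp_all)
        then show ?case by (simp add: mult.commute)
      qed
    qed
    then show ?thesis by simp
  qed
  have timepart: "(\<integral>y. D y * v y \<partial>?C) = - (\<integral>y. u y * E y \<partial>?C)"
    by (rule caputo_duality[OF \<Omega>(1) T \<alpha> uH(1) Du vH Ev])
  \<comment> \<open>Equal to \<open>c v\<close> by the adjoint equation, and visibly square-integrable.\<close>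
  define cv where "cv y = E y - zv y + (\<Sum>i\<in>Basis. s i y)" for y
  have cvL: "cv \<in> L2 ?C" unfolding cv_def by (intro L2_add L2_diff L2_sum EL zvL sL)
  define H where "H y = D y * v y + zu y * v y + (\<Sum>i\<in>Basis. ((B (snd y) \<bullet> i) * v y) * pu i y) + u y * cv y" for y
  have i3: "integrable ?C (\<lambda>y. ((B (snd y) \<bullet> i) * v y) * pu i y)" if "i \<in> Basis" for i
    using L2_mult_integrable[OF BvL[OF that] puL[OF that]] by (simp add: split_beta')
  note i4 = L2_mult_integrable[OF DL vL] L2_mult_integrable[OF uL EL] L2_mult_integrable[OF uL cvL]
  have i5: "integrable ?C (\<lambda>y. \<Sum>i\<in>Basis. ((B (snd y) \<bullet> i) * v y) * pu i y)"
    by (intro Bochner_Integration.integrable_sum i3)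
  have Hint: "integrable ?C H" unfolding H_def by (intro Bochner_Integration.integrable_add i4 int1 i5)
  have fgm: "(\<lambda>(t, x). f x * g t * v (t, x)) \<in> borel_measurable ?C"
  proof -
    have "(\<lambda>y. f (snd y) * g (fst y) * v y) \<in> borel_measurable ?C"
      using L2_measurable[OF vL] measurable_compose[OF measurable_snd fm] measurable_compose[OF measurable_fst gm]
      unfolding cyl_def by (intro borel_measurable_times) auto
    then show ?thesis by (simp add: split_beta')
  qed
  have AEH: "AE y in ?C. H y = (case y of (t, x) \<Rightarrow> f x * g t * v (t, x))"
    using equ eqv
  proof eventually_elim
    case (elim y)
    obtain t x where y: "y = (t, x)" by (cases y)
    have 1: "f x * g t = D y + zu y + (\<Sum>i\<in>Basis. (B x \<bullet> i) * pu i y) + c x * u y" using elim(1) by (simp add: y)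
    have 2: "cv y = c x * v y" using elim(2) by (simp add: y cv_def)
    have "H y = (D y + zu y + (\<Sum>i\<in>Basis. (B x \<bullet> i) * pu i y) + c x * u y) * v y"
    proof -
      have "(\<Sum>i\<in>Basis. ((B (snd y) \<bullet> i) * v y) * pu i y) = (\<Sum>i\<in>Basis. (B x \<bullet> i) * pu i y) * v y"
        unfolding sum_distrib_right by (rule sum.cong) (simp_all add: y mult_ac)
      moreover have "u y * (c x * v y) = c x * u y * v y" by simp
      ultimately show ?thesis unfolding H_def 2 by (simp only: distrib_right)
    qed
    then show ?case unfolding 1[symmetric] by (simp add: y)
  qed
  show "integrable ?C (\<lambda>(t, x). f x * g t * v (t, x))"
    using Hint fgm AEH by (rule integrable_cong_AE_imp) 
  have "(\<integral>(t, x). f x * g t * v (t, x) \<partial>?C) = (\<integral>y. H y \<partial>?C)"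
    using AEH borel_measurable_integrable[OF Hint] fgm by (intro integral_cong_AE) auto
  also have "\<dots> = (\<integral>y. D y * v y \<partial>?C) + (\<integral>y. zu y * v y \<partial>?C) +
      (\<Sum>i\<in>Basis. \<integral>y. ((B (snd y) \<bullet> i) * v y) * pu i y \<partial>?C) + (\<integral>y. u y * cv y \<partial>?C)"
    unfolding H_def using i4 int1 i5 i3
    by (simp only: Bochner_Integration.integral_add Bochner_Integration.integrable_add Bochner_Integration.integral_sum)
  also have "(\<integral>y. u y * cv y \<partial>?C) = (\<integral>y. u y * E y \<partial>?C) - (\<integral>y. u y * zv y \<partial>?C) + (\<Sum>i\<in>Basis. \<integral>y. u y * s i y \<partial>?C)"
  proof -
    have ius: "integrable ?C (\<lambda>y. u y * s i y)" if "i \<in> Basis" for i by (rule L2_mult_integrable[OF uL sL[OF that]])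
    have "u y * cv y = u y * E y - u y * zv y + (\<Sum>i\<in>Basis. u y * s i y)" for y
      by (simp add: cv_def right_diff_distrib distrib_left sum_distrib_left)
    then show ?thesis
      using i4(2) int1(2) ius
      by (simp only: Bochner_Integration.integral_add Bochner_Integration.integral_diff Bochner_Integration.integrable_diff
          Bochner_Integration.integrable_sum Bochner_Integration.integral_sum)
  qed
  also have "(\<Sum>i\<in>Basis. \<integral>y. ((B (snd y) \<bullet> i) * v y) * pu i y \<partial>?C) = - (\<Sum>i\<in>Basis. \<integral>y. u y * s i y \<partial>?C)"
    by (simp add: drift sum_negf)
  finally show "(\<integral>(t, x). f x * g t * v (t, x) \<partial>?C) = - (\<integral>y. z y * \<phi> y \<partial>lateral T \<Omega> (frontier \<Omega>))"
    unfolding lat timepart spacepart by simp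
qed

text \<open>
  Restricting the surface measure to \<open>\<Gamma>\<close> before or after forming the product with time gives the
  same integrals.
\<close>

lemma lateral_restrict:
  fixes \<Omega> \<Gamma> :: "'a::euclidean_space set" and h :: "real \<times> 'a \<Rightarrow> real"
  assumes \<Omega>: "open \<Omega>" "bounded \<Omega>" "Ck_boundary 1 \<Omega>" and \<Gamma>: "openin (top_of_set (frontier \<Omega>)) \<Gamma>"
    and h: "h \<in> borel_measurable (lateral T \<Omega> (frontier \<Omega>))"
  shows "h \<in> borel_measurable (lateral T \<Omega> \<Gamma>)"
    and "(\<integral>\<^sup>+y. ennreal (h y) \<partial>lateral T \<Omega> \<Gamma>) = (\<integral>\<^sup>+y. ennreal (indicator (UNIV \<times> \<Gamma>) y * h y) \<partial>lateral T \<Omega> (frontier \<Omega>))"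
    and "(\<lambda>y. indicator (UNIV \<times> \<Gamma>) y * h y) \<in> borel_measurable (lateral T \<Omega> (frontier \<Omega>))"
proof -
  let ?I = "{0<..<T}" and ?\<sigma> = "surface_measure \<Omega>"
  let ?\<rho> = "restrict_space ?\<sigma> \<Gamma>"
  interpret \<sigma>: finite_measure ?\<sigma> by (rule surface_measure_properties(1)[OF \<Omega>])
  note sp = space_surface_measure[OF \<Omega>]
  have \<Gamma>s: "\<Gamma> \<in> sets ?\<sigma>"
  proof -
    obtain W where "open W" "\<Gamma> = frontier \<Omega> \<inter> W" using \<Gamma> by (auto simp: openin_open)
    then show ?thesis
      unfolding surface_measure_properties(2)[OF \<Omega>] by (subst sets_restrict_space_iff) auto
  qed
  have \<Gamma>s': "\<Gamma> \<inter> space ?\<sigma> \<in> sets ?\<sigma>" using \<Gamma>s by auto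
  interpret \<rho>: finite_measure ?\<rho> by (rule finite_measure_restrict_space[OF \<sigma>.finite_measure_axioms \<Gamma>s])
  have h': "h \<in> borel_measurable (vol ?I \<Otimes>\<^sub>M ?\<sigma>)" using h by (simp add: lateral_frontier[OF \<Omega>])
  have id: "(\<lambda>y. y) \<in> measurable (vol ?I \<Otimes>\<^sub>M ?\<rho>) (vol ?I \<Otimes>\<^sub>M ?\<sigma>)"
  proof -
    have "(\<lambda>x. x) \<in> measurable ?\<rho> ?\<sigma>" by (rule measurable_restrict_space1) simp
    from measurable_compose[OF measurable_snd this]
    have "(\<lambda>y. (fst y, snd y)) \<in> measurable (vol ?I \<Otimes>\<^sub>M ?\<rho>) (vol ?I \<Otimes>\<^sub>M ?\<sigma>)"
      by (intro measurable_Pair measurable_fst)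
    then show ?thesis by simp
  qed
  from measurable_compose[OF id h'] have hm: "h \<in> borel_measurable (vol ?I \<Otimes>\<^sub>M ?\<rho>)" .
  then show "h \<in> borel_measurable (lateral T \<Omega> \<Gamma>)" by (simp add: lateral_def)
  have ind: "(\<lambda>y. indicator \<Gamma> (snd y) * h y) \<in> borel_measurable (vol ?I \<Otimes>\<^sub>M ?\<sigma>)"
    by (intro borel_measurable_times h' measurable_compose[OF measurable_snd borel_measurable_indicator[OF \<Gamma>s]])
  have ieq: "indicator (UNIV \<times> \<Gamma>) y * h y = indicator \<Gamma> (snd y) * h y" for y
    by (cases y) (auto split: split_indicator)
  show "(\<lambda>y. indicator (UNIV \<times> \<Gamma>) y * h y) \<in> borel_measurable (lateral T \<Omega> (frontier \<Omega>))"
    unfolding lateral_frontier[OF \<Omega>] ieq by (rule ind)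
  have "(\<integral>\<^sup>+y. ennreal (h y) \<partial>lateral T \<Omega> \<Gamma>) = (\<integral>\<^sup>+t. \<integral>\<^sup>+x. ennreal (h (t, x)) \<partial>?\<rho> \<partial>vol ?I)"
    unfolding lateral_def using hm by (subst \<rho>.nn_integral_fst[symmetric]) auto
  also have "\<dots> = (\<integral>\<^sup>+t. \<integral>\<^sup>+x. ennreal (indicator \<Gamma> (snd (t, x)) * h (t, x)) \<partial>?\<sigma> \<partial>vol ?I)"
    using \<Gamma>s' by (intro nn_integral_cong, subst nn_integral_restrict_space)
      (auto intro!: nn_integral_cong split: split_indicator)
  also have "\<dots> = (\<integral>\<^sup>+y. ennreal (indicator \<Gamma> (snd y) * h y) \<partial>(vol ?I \<Otimes>\<^sub>M ?\<sigma>))"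
    using ind by (subst \<sigma>.nn_integral_fst) auto
  finally show "(\<integral>\<^sup>+y. ennreal (h y) \<partial>lateral T \<Omega> \<Gamma>) = (\<integral>\<^sup>+y. ennreal (indicator (UNIV \<times> \<Gamma>) y * h y) \<partial>lateral T \<Omega> (frontier \<Omega>))"
    by (simp add: lateral_frontier[OF \<Omega>] ieq)
qed

lemma L2_lateral_restrict:
  fixes \<Omega> \<Gamma> :: "'a::euclidean_space set" and h :: "real \<times> 'a \<Rightarrow> real"
  assumes \<Omega>: "open \<Omega>" "bounded \<Omega>" "Ck_boundary 1 \<Omega>" and \<Gamma>: "openin (top_of_set (frontier \<Omega>)) \<Gamma>"
    and h: "h \<in> L2 (lateral T \<Omega> (frontier \<Omega>))"
  shows "h \<in> L2 (lateral T \<Omega> \<Gamma>)"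
proof -
  have h2: "(\<lambda>y. (h y)\<^sup>2) \<in> borel_measurable (lateral T \<Omega> (frontier \<Omega>))" using L2_measurable[OF h] by simp
  have "(\<integral>\<^sup>+y. ennreal (indicator (UNIV \<times> \<Gamma>) y * (h y)\<^sup>2) \<partial>lateral T \<Omega> (frontier \<Omega>)) \<le>
      (\<integral>\<^sup>+y. ennreal ((h y)\<^sup>2) \<partial>lateral T \<Omega> (frontier \<Omega>))"
    by (intro nn_integral_mono) (auto split: split_indicator)
  also have "\<dots> < \<infinity>" using h by (auto simp: L2_def integrable_iff_bounded)
  finally have "(\<integral>\<^sup>+y. ennreal ((h y)\<^sup>2) \<partial>lateral T \<Omega> \<Gamma>) < \<infinity>"
    unfolding lateral_restrict(2)[OF \<Omega> \<Gamma> h2] .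
  then show ?thesis
    using lateral_restrict(1)[OF \<Omega> \<Gamma> L2_measurable[OF h]] by (simp add: L2_def integrable_iff_bounded)
qed

lemma integral_lateral_restrict:
  fixes \<Omega> \<Gamma> :: "'a::euclidean_space set" and h :: "real \<times> 'a \<Rightarrow> real"
  assumes \<Omega>: "open \<Omega>" "bounded \<Omega>" "Ck_boundary 1 \<Omega>" and \<Gamma>: "openin (top_of_set (frontier \<Omega>)) \<Gamma>"
    and h: "integrable (lateral T \<Omega> (frontier \<Omega>)) h"
    and zero: "\<And>t x. t \<in> {0<..<T} \<Longrightarrow> x \<in> frontier \<Omega> \<Longrightarrow> x \<notin> \<Gamma> \<Longrightarrow> h (t, x) = 0"
  shows "(\<integral>y. h y \<partial>lateral T \<Omega> (frontier \<Omega>)) = (\<integral>y. h y \<partial>lateral T \<Omega> \<Gamma>)"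
proof -
  let ?F = "lateral T \<Omega> (frontier \<Omega>)" and ?G = "lateral T \<Omega> \<Gamma>"
  have hm: "h \<in> borel_measurable ?F" "(\<lambda>y. - h y) \<in> borel_measurable ?F"
    using borel_measurable_integrable[OF h] by auto
  have sp: "space ?F = {0<..<T} \<times> frontier \<Omega>"
    by (simp add: lateral_frontier[OF \<Omega>] space_pair_measure space_surface_measure[OF \<Omega>] space_restrict_space)
  have eq: "(\<integral>\<^sup>+y. ennreal (k y) \<partial>?F) = (\<integral>\<^sup>+y. ennreal (k y) \<partial>?G)"
    if k: "k \<in> borel_measurable ?F" and kz: "\<And>y. h y = 0 \<Longrightarrow> k y = 0" for k
    unfolding lateral_restrict(2)[OF \<Omega> \<Gamma> k]
  proof (rule nn_integral_cong)
    fix y assume "y \<in> space ?F"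
    then show "ennreal (k y) = ennreal (indicator (UNIV \<times> \<Gamma>) y * k y)"
      using zero[of "fst y" "snd y"] kz[of y] unfolding sp by (cases y) (auto split: split_indicator)
  qed
  have pos: "(\<integral>\<^sup>+y. ennreal (h y) \<partial>?F) = (\<integral>\<^sup>+y. ennreal (h y) \<partial>?G)"
    and neg: "(\<integral>\<^sup>+y. ennreal (- h y) \<partial>?F) = (\<integral>\<^sup>+y. ennreal (- h y) \<partial>?G)"
    using eq[OF hm(1)] eq[OF hm(2)] by auto
  have "integrable ?G h"
    using h lateral_restrict(1)[OF \<Omega> \<Gamma> hm(1)] pos neg by (simp add: real_integrable_def)
  then show ?thesis using real_lebesgue_integral_def[OF h] real_lebesgue_integral_def[of ?G h] pos neg by simp
qed

text \<open>
  The constant is 1: by linearity the form for \<open>f1 - f2\<close> is a boundary integral of \<open>z1 - z2\<close>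
  against \<open>\<phi>\<close> over \<open>(0,T) \<times> \<Gamma>\<close>, and \<open>\<phi>\<close> has norm 1 there.
\<close>

theorem theorem1p2:
  fixes \<Omega> \<Gamma> :: "'a::euclidean_space set"
    and a :: "'a \<Rightarrow> 'a \<Rightarrow> 'a \<Rightarrow> real" and B :: "'a \<Rightarrow> 'a" and c :: "'a \<Rightarrow> real"
    and \<alpha> T :: real and g :: "real \<Rightarrow> real"
  assumes "open \<Omega>" and "connected \<Omega>" and "bounded \<Omega>" and "\<Omega> \<noteq> {}" and "Ck_boundary 2 \<Omega>"
    and "coefficients \<Omega> a B c"
    and "1 < \<alpha>" and "\<alpha> < 2" and "T > 0"
    and "C1_interval T g" and "g 0 \<noteq> 0"
    and "openin (top_of_set (frontier \<Omega>)) \<Gamma>" and "\<Gamma> \<noteq> {}"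
  shows "\<exists>C>0. \<forall>f1 f2 u1 u2 z1 z2.
           f1 \<in> H10 \<Omega> \<longrightarrow> f2 \<in> H10 \<Omega> \<longrightarrow>
           forward_solution \<Omega> \<alpha> T a B c g f1 u1 \<longrightarrow> forward_solution \<Omega> \<alpha> T a B c g f2 u2 \<longrightarrow>
           is_conormal T \<Omega> a u1 z1 \<longrightarrow> is_conormal T \<Omega> a u2 z2 \<longrightarrow>
           B_norm \<Omega> \<Gamma> \<alpha> T a B c g (\<lambda>x. f1 x - f2 x)
             \<le> ennreal (C * L2_norm (lateral T \<Omega> \<Gamma>) (\<lambda>y. z1 y - z2 y))"
proof (intro exI[of _ 1] conjI allI impI)
  fix f1 f2 u1 u2 z1 z2
  assume f: "f1 \<in> H10 \<Omega>" "f2 \<in> H10 \<Omega>"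
    and fw: "forward_solution \<Omega> \<alpha> T a B c g f1 u1" "forward_solution \<Omega> \<alpha> T a B c g f2 u2"
    and z: "is_conormal T \<Omega> a u1 z1" "is_conormal T \<Omega> a u2 z2"
  have \<Omega>: "open \<Omega>" "bounded \<Omega>" "Ck_boundary 1 \<Omega>" using assms(1,3,5) by (auto intro: Ck_boundary_mono)
  have fm: "f1 \<in> borel_measurable (vol \<Omega>)" "f2 \<in> borel_measurable (vol \<Omega>)" using f by (auto intro: L2_measurable H10_L2)
  have gm: "g \<in> borel_measurable (vol {0<..<T})"
  proof -
    obtain g' where "\<And>t. t \<in> {0..T} \<Longrightarrow> (g has_real_derivative g' t) (at t within {0..T})"
      using assms(10) unfolding C1_interval_def by blast
    then have "continuous_on {0..T} g" by (rule DERIV_continuous_on)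
    then have "continuous_on {0<..<T} g" by (rule continuous_on_subset) auto
    then show ?thesis by (rule continuous_measurable_vol)
  qed
  show "B_norm \<Omega> \<Gamma> \<alpha> T a B c g (\<lambda>x. f1 x - f2 x) \<le> ennreal (1 * L2_norm (lateral T \<Omega> \<Gamma>) (\<lambda>y. z1 y - z2 y))"
    unfolding B_norm_def
  proof (rule Sup_least)
    fix X assume "X \<in> {ennreal \<bar>B_form \<Omega> T g (\<lambda>x. f1 x - f2 x) v\<bar> | \<phi> v.
            \<phi> \<in> boundary_data \<Omega> \<Gamma> T \<and> L2_norm (lateral T \<Omega> \<Gamma>) \<phi> = 1 \<and> adjoint_solution \<Omega> \<alpha> T a B c \<phi> v}"
    then obtain \<phi> v where X: "X = ennreal \<bar>B_form \<Omega> T g (\<lambda>x. f1 x - f2 x) v\<bar>"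
      and \<phi>: "\<phi> \<in> boundary_data \<Omega> \<Gamma> T" "L2_norm (lateral T \<Omega> \<Gamma>) \<phi> = 1" and v: "adjoint_solution \<Omega> \<alpha> T a B c \<phi> v"
      by blast
    let ?F = "lateral T \<Omega> (frontier \<Omega>)" and ?G = "lateral T \<Omega> \<Gamma>"
    note id1 = B_form_boundary_identity[OF \<Omega> assms(6-9) fm(1) gm fw(1) z(1) v]
    note id2 = B_form_boundary_identity[OF \<Omega> assms(6-9) fm(2) gm fw(2) z(2) v]
    have \<phi>L: "\<phi> \<in> L2 ?F" using v by (auto simp: adjoint_solution_def lateral_trace_def)
    have zL: "(\<lambda>y. z1 y - z2 y) \<in> L2 ?F" by (rule L2_diff[OF id1(1) id2(1)])
    have "B_form \<Omega> T g (\<lambda>x. f1 x - f2 x) v = (\<integral>(t, x). (f1 x - f2 x) * g t * v (t, x) \<partial>cyl T \<Omega>)"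
    proof -
      have "integrable (cyl T \<Omega>) (\<lambda>(t, x). (f1 x - f2 x) * g t * v (t, x))"
        using Bochner_Integration.integrable_diff[OF id1(2) id2(2)] by (simp add: split_beta' left_diff_distrib)
      from integral_cyl(1)[OF \<Omega>(1) this] show ?thesis by (simp add: B_form_def)
    qed
    also have "\<dots> = (\<integral>(t, x). f1 x * g t * v (t, x) \<partial>cyl T \<Omega>) - (\<integral>(t, x). f2 x * g t * v (t, x) \<partial>cyl T \<Omega>)"
      by (subst Bochner_Integration.integral_diff[OF id1(2) id2(2), symmetric]) (simp add: split_beta' left_diff_distrib)
    also have "\<dots> = - ((\<integral>y. z1 y * \<phi> y \<partial>?F) - (\<integral>y. z2 y * \<phi> y \<partial>?F))" unfolding id1(3) id2(3) by simp
    also have "(\<integral>y. z1 y * \<phi> y \<partial>?F) - (\<integral>y. z2 y * \<phi> y \<partial>?F) = (\<integral>y. (z1 y - z2 y) * \<phi> y \<partial>?F)"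
      using L2_mult_integrable[OF id1(1) \<phi>L] L2_mult_integrable[OF id2(1) \<phi>L] by (simp add: left_diff_distrib)
    also have "\<dots> = (\<integral>y. (z1 y - z2 y) * \<phi> y \<partial>?G)"
    proof (rule integral_lateral_restrict[OF \<Omega> assms(12) L2_mult_integrable[OF zL \<phi>L]])
      fix t x assume tx: "t \<in> {0<..<T}" "x \<in> frontier \<Omega>" "x \<notin> \<Gamma>"
      obtain K where K: "K \<subseteq> {0<..<T} \<times> \<Gamma>" "\<forall>z\<in>{0<..<T} \<times> frontier \<Omega> - K. \<phi> z = 0"
        using \<phi>(1) unfolding boundary_data_def by blast
      have "(t, x) \<in> {0<..<T} \<times> frontier \<Omega> - K" using tx K(1) by blast
      then show "(z1 (t, x) - z2 (t, x)) * \<phi> (t, x) = 0" using K(2) by simp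
    qed
    finally have "\<bar>B_form \<Omega> T g (\<lambda>x. f1 x - f2 x) v\<bar> = \<bar>\<integral>y. (z1 y - z2 y) * \<phi> y \<partial>?G\<bar>" by simp
    also have "\<dots> \<le> L2_norm ?G (\<lambda>y. z1 y - z2 y) * L2_norm ?G \<phi>"
      by (intro L2_Cauchy_Schwarz L2_lateral_restrict[OF \<Omega> assms(12)] zL \<phi>L)
    finally show "X \<le> ennreal (1 * L2_norm ?G (\<lambda>y. z1 y - z2 y))" unfolding X \<phi>(2) by (intro ennreal_leI) simp
  qed
qed simp

end
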